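(* Assume Condition D and that $(H_1,H_2)$ is pure-state controllable. Then: 1) there exist $c>0$, $0<q<1$ such that $|P_n(\psi,A)-\pi^*(A)|\le cq^n$ for all Borel $A\subset S$, all $\psi\in S$ and all $n\ge1$; 2) for every bounded measurable $f$ on $S$ and every $\psi(0)\in S$, almost surely $\frac1T\int_0^Tf(\psi(t))\,dt\to\int_Sf\,d\pi^*$ as $T\to\infty$.
   Context: $\mathcal H=\mathbb C^N$, $N>1$, $S=\{\psi\in\mathcal H:(\psi,\psi)=1\}$, $\pi^*$ the normalized unitarily invariant (uniform) measure on $S$. $H_1,H_2$ Hermitian, $U_k^t=e^{-itH_k}$; $J_n(s_1,\dots,s_n)=U_{k_n}^{s_n}\cdots U_{k_2}^{s_2}U_1^{s_1}$ with $k_j=1$ for odd $j$, $k_j=2$ for even $j$; $\mathcal J_n(H_1,H_2)=\{J_n(s):s_j\ge0\}$. The pair is pure-state controllable if there is $n$ such that for every $\psi\in S$, $\{J\psi:J\in\mathcal J_n(H_1,H_2)\}=S$. Condition D: $\tau_1,\tau_2,\dots$ i.i.d. positive with $\mathbb E\tau_1<\infty$ and a density positive on $[0,\infty)$; $t_0=0$, $t_n=\tau_1+\dots+\tau_n$. $X(t)=J_n(\tau_1,\dots,\tau_{n-1},t-t_{n-1})$ for $t_{n-1}\le t<t_n$, $X_n=J_n(\tau_1,\dots,\tau_n)$, $\psi(t)=X(t)\psi(0)$, and $P_n(\psi,\cdot)$ is the distribution of $X_n\psi$. *)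

theory Defs
  imports "HOL-Analysis.Analysis" "HOL-Probability.Probability"
begin

primrec mpow :: "complex^'n^'n \<Rightarrow> nat \<Rightarrow> complex^'n^'n" where
  "mpow A 0 = mat 1"
| "mpow A (Suc k) = A ** mpow A k"

definition mexp :: "complex^'n^'n \<Rightarrow> complex^'n^'n" where
  "mexp A = (\<Sum>k. (1 / fact k) *\<^sub>R mpow A k)"

definition hermitian :: "complex^'n^'n \<Rightarrow> bool" where
  "hermitian H \<longleftrightarrow> (\<forall>i j. H $ i $ j = cnj (H $ j $ i))"

definition prop_op :: "complex^'n^'n \<Rightarrow> real \<Rightarrow> complex^'n^'n" where
  "prop_op H t = mexp (\<chi> i j. (- \<i> * complex_of_real t) * H $ i $ j)"

abbreviation unit_sphere :: "(complex^'n) set" where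
  "unit_sphere \<equiv> sphere 0 1"

text \<open>J_n(s_1,...,s_n) = U_{k_n}^{s_n} ... U_1^{s_1}; here s is 0-indexed: s j = s_{j+1};
  the (j+1)-th factor uses H1 if j+1 is odd (j even) and H2 otherwise.\<close>
primrec Jop :: "complex^'n^'n \<Rightarrow> complex^'n^'n \<Rightarrow> (nat \<Rightarrow> real) \<Rightarrow> nat \<Rightarrow> complex^'n^'n" where
  "Jop H1 H2 s 0 = mat 1"
| "Jop H1 H2 s (Suc n) = prop_op (if even n then H1 else H2) (s n) ** Jop H1 H2 s n"

definition pure_state_controllable :: "complex^'n^'n \<Rightarrow> complex^'n^'n \<Rightarrow> bool" where
  "pure_state_controllable H1 H2 \<longleftrightarrow>
     (\<exists>n. \<forall>\<psi>\<in>unit_sphere.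
        {Jop H1 H2 s n *v \<psi> | s. \<forall>j<n. s j \<ge> 0} = unit_sphere)"

text \<open>Uniform (normalized unitarily invariant) measure on S: push-forward of the uniform
  distribution on the unit ball under x \<mapsto> x/|x| (a Borel measure on C^N concentrated on S).\<close>
definition pi_star :: "(complex^'n) measure" where
  "pi_star = distr (uniform_measure lborel (ball 0 1)) borel sgn"

text \<open>Condition D. tau j (j = 0,1,...) plays the role of tau_{j+1}.\<close>
definition condition_D :: "'w measure \<Rightarrow> (nat \<Rightarrow> 'w \<Rightarrow> real) \<Rightarrow> bool" where
  "condition_D M \<tau> \<longleftrightarrow> prob_space M \<and>
     (\<forall>j. \<tau> j \<in> borel_measurable M) \<and>
     prob_space.indep_vars M (\<lambda>_. borel) \<tau> UNIV \<and>
     (\<forall>j. distr M borel (\<tau> j) = distr M borel (\<tau> 0)) \<and>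
     (\<forall>j. AE \<omega> in M. \<tau> j \<omega> > 0) \<and>
     integrable M (\<tau> 0) \<and>
     (\<exists>g. distributed M lborel (\<tau> 0) g \<and> (\<forall>x\<ge>0. g x > 0))"

definition tsum :: "(nat \<Rightarrow> 'w \<Rightarrow> real) \<Rightarrow> 'w \<Rightarrow> nat \<Rightarrow> real" where
  "tsum \<tau> \<omega> n = (\<Sum>j<n. \<tau> j \<omega>)"

definition Xn :: "complex^'n^'n \<Rightarrow> complex^'n^'n \<Rightarrow> (nat \<Rightarrow> 'w \<Rightarrow> real) \<Rightarrow> nat \<Rightarrow> 'w \<Rightarrow> complex^'n^'n" where
  "Xn H1 H2 \<tau> n \<omega> = Jop H1 H2 (\<lambda>j. \<tau> j \<omega>) n"

text \<open>X(t) = J_n(tau_1,...,tau_{n-1}, t - t_{n-1}) for t_{n-1} \<le> t < t_n, where n is the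
  least index with t < t_n (then n \<ge> 1 and t_{n-1} \<le> t for t \<ge> 0).\<close>
definition Xt :: "complex^'n^'n \<Rightarrow> complex^'n^'n \<Rightarrow> (nat \<Rightarrow> 'w \<Rightarrow> real) \<Rightarrow> 'w \<Rightarrow> real \<Rightarrow> complex^'n^'n" where
  "Xt H1 H2 \<tau> \<omega> t =
     (let n = (LEAST n. t < tsum \<tau> \<omega> n)
      in Jop H1 H2 (\<lambda>j. if j < n - 1 then \<tau> j \<omega> else t - tsum \<tau> \<omega> (n - 1)) n)"

definition Pn :: "'w measure \<Rightarrow> complex^'n^'n \<Rightarrow> complex^'n^'n \<Rightarrow> (nat \<Rightarrow> 'w \<Rightarrow> real) \<Rightarrow> nat
    \<Rightarrow> complex^'n \<Rightarrow> (complex^'n) set \<Rightarrow> real" where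
  "Pn M H1 H2 \<tau> n \<psi> A = measure M {\<omega> \<in> space M. Xn H1 H2 \<tau> n \<omega> *v \<psi> \<in> A}"

end

theory Submission
  imports Defs
begin

text \<open>Let \<open>G\<close> be the real span of all generators transported along paths. A path whose
  transported generators have maximal rank spans \<open>G\<close>, and \<open>G\<close> is invariant under conjugation by
  the evolution. Integrating by parts in the durations of such a path shows that its law, smeared
  over a small box of durations, moves by \<open>O(\<delta>)\<close> in total variation when the initial state is moved
  by \<open>\<delta>\<close> along a direction of \<open>G\<close>. No full-rank condition on the sphere is needed: by
  controllability two arbitrary states can be steered to the same point, by Baire with bounded
  durations for all states of an open set, and small changes of the durations move the end point along
  \<open>G\<close>. Hence the laws started at any two states overlap uniformly, a Doeblin contraction, and the
  limit is the unitarily invariant measure. For the time averages, the integrals of \<open>f\<close> over the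
  successive cycles have geometrically decaying covariances after truncation, so Etemadi's proof of
  the strong law of large numbers applies.\<close>

section \<open>The unitary evolution\<close>

text \<open>Controllability is a statement about end points: it gives no rank for the map from
  durations to states. The density of the durations is only known to be positive, without continuity
  or a lower bound. Both facts shape the proof. Directions of \<open>G\<close> are expressed through
  derivatives in the durations, which trades the derivative of a test function for its supremum, and
  only displacements caused by changed durations ever have to be smoothed. The smearing uses
  explicit Lipschitz weights instead of the unknown density; absolute continuity in epsilon-delta
  form carries the overlap back to the true law. Although only nonnegative durations are admissible,
  \<open>G\<close> is stable under conjugation in both directions, because an injective linear map
  of a finite-dimensional space into itself is onto. The two generators alternate, so paths are
  joined only after an even number of legs; this is why parities recur. As the durations have just a
  first moment, the strong law works with truncated second moments.\<close>

lemma bounded_bilinear_matrix_mult: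
  "bounded_bilinear ((**) :: complex^'n^'n \<Rightarrow> complex^'n^'n \<Rightarrow> complex^'n^'n)"
  unfolding bilinear_conv_bounded_bilinear [symmetric] bilinear_def
  by (auto intro!: linearI simp: matrix_matrix_mult_def vec_eq_iff algebra_simps sum.distrib
      scaleR_sum_right)

lemma bounded_bilinear_matrix_vector_mult:
  "bounded_bilinear ((*v) :: complex^'n^'n \<Rightarrow> complex^'n \<Rightarrow> complex^'n)"
  unfolding bilinear_conv_bounded_bilinear [symmetric] bilinear_def
  by (auto intro!: linearI simp: matrix_vector_mult_def vec_eq_iff algebra_simps sum.distrib
      scaleR_sum_right)

text \<open>Unitary conjugation preserves operator bounds, while the norm of the matrix space is
  Euclidean. Each entry is a component of the image of a basis vector; summing over rows and columns
  costs two factors of the dimension.\<close>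

lemma norm_matrix_le_op:
  fixes X :: "complex^'n^'n"
  assumes "\<And>x. norm (X *v x) \<le> K * norm x"
  shows "norm X \<le> K * real CARD('n) * real CARD('n)"
proof -
  have 1: "norm (X $ i $ j) \<le> K" for i j
  proof -
    have "X $ i $ j = (X *v axis j 1) $ i"
      by (simp add: matrix_vector_mult_def axis_def if_distrib[of "\<lambda>x. _ * x"] cong: if_cong)
    then have "norm (X $ i $ j) \<le> norm (X *v axis j 1)"
      by (metis Finite_Cartesian_Product.norm_nth_le)
    also have "\<dots> \<le> K * norm (axis j (1::complex) :: complex^'n)" by (rule assms)
    finally show ?thesis by (simp add: norm_axis_1)
  qed
  have "norm X \<le> (\<Sum>i\<in>UNIV. norm (X $ i))"
    unfolding norm_vec_def[of X] by (rule L2_set_le_sum) auto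
  also have "\<dots> \<le> (\<Sum>i\<in>UNIV. (\<Sum>j\<in>UNIV. norm (X $ i $ j)))"
    unfolding norm_vec_def[of "X $ _"] by (intro sum_mono L2_set_le_sum) auto
  also have "\<dots> \<le> (\<Sum>i\<in>(UNIV::'n set). (\<Sum>j\<in>(UNIV::'n set). K))"
    by (intro sum_mono 1)
  finally show ?thesis by (simp add: mult_ac)
qed

lemma has_vector_derivative_matrix:
  fixes F :: "real \<Rightarrow> complex^'n^'n"
  assumes "\<And>i j. ((\<lambda>t. F t $ i $ j) has_vector_derivative D $ i $ j) (at t)"
  shows "(F has_vector_derivative D) (at t)"
proof -
  \<comment> \<open>Expansion in matrix units, which reduces the derivative of a matrix to those of
    its scalar entries.\<close>
  have eq: "M = (\<Sum>i\<in>UNIV. \<Sum>j\<in>UNIV. axis i (axis j (M $ i $ j)))" for M :: "complex^'n^'n"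
  proof -
    have "(\<Sum>x\<in>UNIV. \<Sum>y\<in>UNIV. if i = x then if j = y then M $ x $ y else 0 else 0) = M $ i $ j" for i j
    proof -
      have "(\<Sum>x\<in>UNIV. \<Sum>y\<in>UNIV. if i = x then if j = y then M $ x $ y else 0 else 0)
        = (\<Sum>x\<in>UNIV. if i = x then M $ x $ j else 0)"
        by (intro sum.cong refl) simp
      then show ?thesis by simp
    qed
    then show ?thesis
      by (simp add: vec_eq_iff axis_def if_distrib[of "\<lambda>x. x $ _"] eq_commute[of _ "_::'n"] cong: if_cong)
  qed
  have bl: "bounded_linear (\<lambda>z::complex. axis i (axis j z) :: complex^'n^'n)" for i j
    unfolding linear_conv_bounded_linear[symmetric]
    by (auto intro!: linearI simp: axis_def vec_eq_iff)
  have "((\<lambda>t. \<Sum>i\<in>UNIV. \<Sum>j\<in>UNIV. axis i (axis j (F t $ i $ j))) has_vector_derivative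
        (\<Sum>i\<in>UNIV. \<Sum>j\<in>UNIV. axis i (axis j (D $ i $ j)))) (at t)"
    by (intro has_vector_derivative_sum bounded_linear.has_vector_derivative[OF bl] assms)
  then show ?thesis using eq by simp
qed

text \<open>The generator \<open>-iH\<close>, anti-Hermitian when \<open>H\<close> is Hermitian;
  \<open>prop_op H t\<close> is the exponential of \<open>t *\<^sub>R gen H\<close>.\<close>

definition gen :: "complex^'n^'n \<Rightarrow> complex^'n^'n" where
  "gen H = (\<chi> i j. - \<i> * H $ i $ j)"

lemma mpow_bound:
  fixes X :: "complex^'n^'n"
  assumes "\<And>i j. norm (X $ i $ j) \<le> B"
  shows "norm (mpow X k $ i $ j) \<le> (real CARD('n) * B) ^ k"
proof (induction k arbitrary: i j)
  case 0
  then show ?case by (simp add: mat_def)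
next
  case (Suc k)
  have B: "0 \<le> B" using assms[of i i] norm_ge_zero order_trans by blast
  have "norm (mpow X (Suc k) $ i $ j) \<le> (\<Sum>l\<in>UNIV. norm (X $ i $ l * mpow X k $ l $ j))"
    unfolding mpow.simps matrix_matrix_mult_def by (simp add: norm_sum)
  also have "\<dots> \<le> (\<Sum>l\<in>(UNIV::'n set). B * (real CARD('n) * B) ^ k)"
    unfolding norm_mult by (intro sum_mono mult_mono Suc assms B) auto
  finally show ?case by (simp add: mult_ac)
qed

lemma mpow_scaleR: "mpow (t *\<^sub>R X) k = t ^ k *\<^sub>R mpow X k"
  by (induction k) (simp_all add: matrix_matrix_mult_def vec_eq_iff scaleR_sum_right algebra_simps)

lemma mpow_commute: "mpow X k ** X = X ** mpow X k"
  by (induction k) (simp_all add: matrix_mul_assoc[symmetric])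

text \<open>The argument is complex, although times are real, because termwise differentiation is
  applied to a power series in a complex variable. The majorant is an exponential series, by the
  entrywise bound on powers.\<close>

lemma mpow_summable:
  fixes X :: "complex^'n^'n" and z :: complex
  shows "summable (\<lambda>k. (mpow X k $ i $ j / fact k) * z ^ k)"
proof -
  define B where "B = (\<Sum>i\<in>UNIV. \<Sum>j\<in>UNIV. norm (X $ i $ j))"
  have B: "norm (X $ i $ j) \<le> B" for i j
  proof -
    have "norm (X $ i $ j) \<le> (\<Sum>j\<in>UNIV. norm (X $ i $ j))"
      by (rule member_le_sum) auto
    also have "\<dots> \<le> B" unfolding B_def
      by (rule member_le_sum[of i UNIV "\<lambda>i. \<Sum>j\<in>UNIV. norm (X $ i $ j)"]) (auto simp: sum_nonneg)
    finally show ?thesis .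
  qed
  define c where "c = real CARD('n) * B"
  show ?thesis
  proof (rule summable_comparison_test'[where N=0 and g="\<lambda>k. inverse (fact k) * (c * norm z) ^ k"])
    show "summable (\<lambda>k. inverse (fact k) * (c * norm z) ^ k)" by (rule summable_exp)
    fix k
    have "norm ((mpow X k $ i $ j / fact k) * z ^ k)
        = norm (mpow X k $ i $ j) * (inverse (fact k) * norm z ^ k)"
      by (simp add: norm_mult norm_divide norm_power norm_inverse divide_inverse mult_ac)
    also have "\<dots> \<le> c ^ k * (inverse (fact k) * norm z ^ k)"
      unfolding c_def by (intro mult_right_mono mpow_bound B) auto
    finally show "norm ((mpow X k $ i $ j / fact k) * z ^ k) \<le> inverse (fact k) * (c * norm z) ^ k"
      by (simp add: power_mult_distrib mult_ac)
  qed
qed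

text \<open>Passing to entries turns the matrix series into scalar power series in \<open>t\<close>,
  where convergence and differentiation are classical.\<close>

lemma prop_op_nth:
  fixes H :: "complex^'n^'n"
  shows "prop_op H t $ i $ j = (\<Sum>k. (mpow (gen H) k $ i $ j / fact k) * of_real t ^ k)"
proof -
  have e: "(\<chi> i j. (- \<i> * complex_of_real t) * H $ i $ j) = t *\<^sub>R gen H"
    by (simp add: gen_def vec_eq_iff scaleR_conv_of_real[where 'a=complex])
  have s: "(\<lambda>k. (1 / fact k) *\<^sub>R mpow (t *\<^sub>R gen H) k) sums
      (\<chi> i j. \<Sum>k. (mpow (gen H) k $ i $ j / fact k) * of_real t ^ k)"
    unfolding sums_def
  proof (intro vec_tendstoI, goal_cases)
    case (1 i j)
    have "(\<lambda>k. (mpow (gen H) k $ i $ j / fact k) * of_real t ^ k) sums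
       (\<Sum>k. (mpow (gen H) k $ i $ j / fact k) * of_real t ^ k)"
      using mpow_summable by (rule summable_sums)
    then show ?case
      unfolding sums_def
      by (simp add: mpow_scaleR scaleR_conv_of_real[where 'a=complex] field_simps)
  qed
  show ?thesis unfolding prop_op_def mexp_def e using sums_unique[OF s, symmetric] by simp
qed

lemma prop_op_0 [simp]:
  fixes H :: "complex^'n^'n"
  shows "prop_op H 0 = mat 1"
proof -
  have "(\<Sum>k. (mpow (gen H) k $ i $ j / fact k) * 0 ^ k) = mat 1 $ i $ j" for i j :: 'n
    using powser_zero[of "\<lambda>k. mpow (gen H) k $ i $ j / fact k"] by simp
  then show ?thesis by (simp add: vec_eq_iff prop_op_nth)
qed

lemma prop_op_deriv_nth:
  "((\<lambda>t. prop_op H t $ i $ j) has_vector_derivative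
     (\<Sum>k. (mpow (gen H) (Suc k) $ i $ j / fact k) * of_real t ^ k)) (at t)"
proof -
  let ?c = "\<lambda>k. mpow (gen H) k $ i $ j / fact k"
  have d: "diffs ?c k = mpow (gen H) (Suc k) $ i $ j / fact k" for k
    unfolding diffs_def using of_nat_neq_0[of k, where 'a=complex]
    by (simp add: field_simps del: mpow.simps of_nat_Suc)
  have "((\<lambda>z. \<Sum>k. ?c k * z ^ k) has_field_derivative (\<Sum>k. diffs ?c k * of_real t ^ k)) (at (of_real t))"
    by (rule termdiffs_strong_converges_everywhere) (rule mpow_summable)
  then have "((\<lambda>z. \<Sum>k. ?c k * z ^ k) \<circ> of_real has_vector_derivative
        1 * (\<Sum>k. diffs ?c k * of_real t ^ k)) (at t)"
    by (intro field_vector_diff_chain_at) (auto intro!: derivative_eq_intros simp: has_vector_derivative_def of_real_def)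
  then show ?thesis by (simp add: o_def prop_op_nth d)
qed

text \<open>The powers of \<open>gen H\<close> commute with \<open>gen H\<close>, so both products
  have the same entrywise series, which is also that of the derivative. The differential equation
  and the commutation of generator and propagator follow together.\<close>

lemma gen_prop_op_nth:
  fixes H :: "complex^'n^'n"
  shows "(gen H ** prop_op H t) $ i $ j = (\<Sum>k. (mpow (gen H) (Suc k) $ i $ j / fact k) * of_real t ^ k)"
    and "(prop_op H t ** gen H) $ i $ j = (\<Sum>k. (mpow (gen H) (Suc k) $ i $ j / fact k) * of_real t ^ k)"
proof -
  have sm: "summable (\<lambda>k. c * (mpow (gen H) k $ a $ b / fact k * of_real t ^ k))" for a b and c :: complex
    by (intro summable_mult mpow_summable)
  have "(gen H ** prop_op H t) $ i $ j
      = (\<Sum>l\<in>UNIV. \<Sum>k. gen H $ i $ l * (mpow (gen H) k $ l $ j / fact k * of_real t ^ k))"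
    unfolding matrix_matrix_mult_def prop_op_nth vec_lambda_beta
    by (intro sum.cong refl suminf_mult[symmetric] mpow_summable)
  also have "\<dots> = (\<Sum>k. \<Sum>l\<in>UNIV. gen H $ i $ l * (mpow (gen H) k $ l $ j / fact k * of_real t ^ k))"
    by (intro suminf_sum[symmetric] sm)
  also have "\<dots> = (\<Sum>k. (mpow (gen H) (Suc k) $ i $ j / fact k) * of_real t ^ k)"
    by (simp add: matrix_matrix_mult_def sum_divide_distrib sum_distrib_right mult.assoc)
  finally show "(gen H ** prop_op H t) $ i $ j = (\<Sum>k. (mpow (gen H) (Suc k) $ i $ j / fact k) * of_real t ^ k)" .
  have "(prop_op H t ** gen H) $ i $ j
      = (\<Sum>l\<in>UNIV. \<Sum>k. gen H $ l $ j * (mpow (gen H) k $ i $ l / fact k * of_real t ^ k))"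
    unfolding matrix_matrix_mult_def prop_op_nth vec_lambda_beta
    by (subst mult.commute) (intro sum.cong refl suminf_mult[symmetric] mpow_summable)
  also have "\<dots> = (\<Sum>k. \<Sum>l\<in>UNIV. gen H $ l $ j * (mpow (gen H) k $ i $ l / fact k * of_real t ^ k))"
    by (intro suminf_sum[symmetric] sm)
  also have "\<dots> = (\<Sum>k. (mpow (gen H) (Suc k) $ i $ j / fact k) * of_real t ^ k)"
    unfolding mpow.simps mpow_commute[symmetric]
    by (simp add: matrix_matrix_mult_def[of _ "gen H"] sum_divide_distrib sum_distrib_right mult.assoc mult.left_commute)
  finally show "(prop_op H t ** gen H) $ i $ j = (\<Sum>k. (mpow (gen H) (Suc k) $ i $ j / fact k) * of_real t ^ k)" .
qed

lemma prop_op_gen_commute: "prop_op H t ** gen H = gen H ** prop_op H t"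
  by (simp add: vec_eq_iff gen_prop_op_nth)

lemma prop_op_deriv: "(prop_op H has_vector_derivative gen H ** prop_op H t) (at t)"
  by (rule has_vector_derivative_matrix) (simp only: gen_prop_op_nth prop_op_deriv_nth)

lemma prop_op_vec_deriv:
  "((\<lambda>t. prop_op H t *v x) has_vector_derivative gen H *v (prop_op H t *v x)) (at t)"
  using bounded_bilinear.has_vector_derivative[OF bounded_bilinear_matrix_vector_mult
      prop_op_deriv has_vector_derivative_const]
  by (simp add: matrix_vector_mul_assoc)

lemma continuous_prop_op: "continuous_on A (prop_op H)"
  using prop_op_deriv has_vector_derivative_continuous
  by (metis continuous_at_imp_continuous_on)

lemma vector_derivative_zero_const:
  fixes F :: "real \<Rightarrow> 'a::real_normed_vector"
  assumes "\<And>t. (F has_vector_derivative 0) (at t)"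
  shows "F t = F 0"
  using has_vector_derivative_zero_constant[of UNIV F] assms by (metis UNIV_I convex_UNIV)

lemma prop_op_reflect_deriv:
  "((\<lambda>t. prop_op H (- t)) has_vector_derivative - (gen H ** prop_op H (- t))) (at t)"
  using vector_diff_chain_at[of uminus "-1" t "prop_op H" "gen H ** prop_op H (- t)"]
    prop_op_deriv[of H "- t"] by (simp add: o_def has_vector_derivative_minus)

lemma matrix_mult_uminus_left: "(- X) ** Y = - (X ** Y)" for X Y :: "complex^'n^'n"
  by (simp add: matrix_matrix_mult_def vec_eq_iff sum_negf)

text \<open>In the derivative with respect to \<open>t\<close> the contributions of the two factors
  cancel after commutation, so the product keeps its value at \<open>t = 0\<close>. The case
  \<open>s = 0\<close> yields the inverse.\<close>

lemma prop_op_cancel_aux: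
  "prop_op H (- t) ** prop_op H (s + t) = prop_op H s"
proof -
  have a: "((\<lambda>t. prop_op H (s + t)) has_vector_derivative (gen H ** prop_op H (s + t))) (at t)" for t
  proof -
    have "((\<lambda>t. s + t) has_vector_derivative 1) (at t)"
      by (auto intro!: derivative_eq_intros simp flip: has_real_derivative_iff_has_vector_derivative)
    from vector_diff_chain_at[OF this prop_op_deriv] show ?thesis by (simp add: o_def)
  qed
  have "((\<lambda>t. prop_op H (- t) ** prop_op H (s + t)) has_vector_derivative 0) (at t)" for t
    using bounded_bilinear.has_vector_derivative[OF bounded_bilinear_matrix_mult prop_op_reflect_deriv[of H t] a[of t]]
    by (simp add: matrix_mult_uminus_left matrix_mul_assoc prop_op_gen_commute)
  from vector_derivative_zero_const[of "\<lambda>t. prop_op H (- t) ** prop_op H (s + t)", OF this]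
  show ?thesis by simp
qed

lemma prop_op_inverse [simp]:
  "prop_op H (- t) ** prop_op H t = mat 1" "prop_op H t ** prop_op H (- t) = mat 1"
  using prop_op_cancel_aux[of H t 0] prop_op_cancel_aux[of H "- t" 0] by simp_all

text \<open>The inner product of the real space \<open>complex^'n\<close> is the real part of the
  Hermitian form. The quadratic form \<open>?h\<close> of a Hermitian matrix is real, so
  multiplication by \<open>- \<i>\<close> leaves no real part.\<close>

lemma inner_gen_zero:
  assumes "hermitian H" shows "(gen H *v x) \<bullet> x = 0"
proof -
  let ?h = "\<Sum>i\<in>UNIV. \<Sum>j\<in>UNIV. cnj (x $ i) * (H $ i $ j * x $ j)"
  have cnj_H: "cnj (H $ i $ j) = H $ j $ i" for i j
    using assms unfolding hermitian_def by (metis complex_cnj_cnj)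
  have "cnj ?h = (\<Sum>i\<in>UNIV. \<Sum>j\<in>UNIV. cnj (x $ j) * (H $ j $ i * x $ i))"
    by (simp add: cnj_H mult_ac)
  also have "\<dots> = ?h" by (rule sum.swap)
  finally have "cnj ?h = ?h" .
  moreover have "cnj z = z \<Longrightarrow> Im z = 0" for z by (simp add: complex_eq_iff)
  ultimately have "Im ?h = 0" by blast
  have *: "a \<bullet> b = Re (cnj b * a)" for a b :: complex
    by (simp add: inner_complex_def)
  have e: "(gen H *v x) $ i = - \<i> * (\<Sum>j\<in>UNIV. H $ i $ j * x $ j)" for i
    unfolding gen_def matrix_vector_mult_def vec_lambda_beta sum_distrib_left mult.assoc ..
  have "(gen H *v x) \<bullet> x = (\<Sum>i\<in>UNIV. Re (- \<i> * (\<Sum>j\<in>UNIV. cnj (x $ i) * (H $ i $ j * x $ j))))"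
    unfolding inner_vec_def e * sum_distrib_left[symmetric] by (simp only: mult.left_commute)
  also have "\<dots> = Re (- \<i> * ?h)"
    unfolding sum_distrib_left Re_sum ..
  also have "\<dots> = Im ?h" unfolding minus_mult_left[symmetric] uminus_complex.sel by simp
  finally show ?thesis using \<open>Im ?h = 0\<close> by simp
qed

lemma norm_prop_op [simp]:
  assumes "hermitian H" shows "norm (prop_op H t *v x) = norm x"
proof -
  let ?u = "\<lambda>t. prop_op H t *v x"
  have "((\<lambda>t. ?u t \<bullet> ?u t) has_vector_derivative 0) (at t)" for t
    using bounded_bilinear.has_vector_derivative[OF bounded_bilinear_inner prop_op_vec_deriv prop_op_vec_deriv, of H x H x t]
      inner_gen_zero[OF assms, of "?u t"] by (simp add: inner_commute)
  from vector_derivative_zero_const[of "\<lambda>t. ?u t \<bullet> ?u t", OF this, of t]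
  show ?thesis by (simp add: norm_eq)
qed

lemma mult_prop_op_cancel [simp]:
  "X ** prop_op H (- t) ** prop_op H t = X" "X ** prop_op H t ** prop_op H (- t) = X"
  "prop_op H (- t) *v (prop_op H t *v x) = x" "prop_op H t *v (prop_op H (- t) *v x) = x"
  by (simp_all add: matrix_mul_assoc[symmetric] matrix_vector_mul_assoc)

lemma matrix_vector_bound:
  obtains K where "K > 0" "\<And>(X :: complex^'n^'n) x. norm (X *v x) \<le> K * norm X * norm x"
  using bounded_bilinear.pos_bounded[OF bounded_bilinear_matrix_vector_mult] by (auto simp: mult_ac)

lemma prop_op_vec_lipschitz:
  fixes H :: "complex^'n^'n"
  assumes "hermitian H"
  obtains L where "L > 0" "\<And>s t x. norm (prop_op H s *v x - prop_op H t *v x) \<le> L * \<bar>s - t\<bar> * norm x"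
proof -
  obtain K where K: "K > 0" "\<And>(X :: complex^'n^'n) x. norm (X *v x) \<le> K * norm X * norm x"
    using matrix_vector_bound by metis
  define L where "L = K * norm (gen H) + 1"
  have "norm (prop_op H s *v x - prop_op H t *v x) \<le> L * \<bar>s - t\<bar> * norm x" for s t x
  proof -
    have "norm (prop_op H s *v x - prop_op H t *v x) \<le> (L * norm x) * norm (s - t)"
    proof (rule differentiable_bound[of UNIV])
      show "((\<lambda>t. prop_op H t *v x) has_derivative (\<lambda>h. h *\<^sub>R (gen H *v (prop_op H t *v x)))) (at t within UNIV)" for t
        using prop_op_vec_deriv[of H x t] by (simp add: has_vector_derivative_def)
      show "onorm (\<lambda>h. h *\<^sub>R (gen H *v (prop_op H t *v x))) \<le> L * norm x" for t
      proof (rule onorm_le)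
        fix h
        have "norm (gen H *v (prop_op H t *v x)) \<le> K * norm (gen H) * norm x"
          using K(2)[of "gen H" "prop_op H t *v x"] assms by simp
        also have "\<dots> \<le> L * norm x" unfolding L_def by (simp add: mult_right_mono)
        finally show "norm (h *\<^sub>R (gen H *v (prop_op H t *v x))) \<le> L * norm x * norm h"
          by (simp add: mult_left_mono mult.commute)
      qed
    qed auto
    then show ?thesis by (simp add: mult_ac)
  qed
  moreover have "L > 0" unfolding L_def using K by (simp add: add_nonneg_pos)
  ultimately show ?thesis using that by blast
qed

section \<open>Paths and transported generators\<close>

locale hermitian_pair =
  fixes H1 H2 :: "complex^'n^'n"
  assumes herm1: "hermitian H1" and herm2: "hermitian H2"
begin

definition U :: "nat \<Rightarrow> real \<Rightarrow> complex^'n^'n" where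
  "U j t = prop_op (if even j then H1 else H2) t"

definition A :: "nat \<Rightarrow> complex^'n^'n" where
  "A j = gen (if even j then H1 else H2)"

abbreviation J :: "(nat \<Rightarrow> real) \<Rightarrow> nat \<Rightarrow> complex^'n^'n" where
  "J \<equiv> Jop H1 H2"

primrec Jinv :: "(nat \<Rightarrow> real) \<Rightarrow> nat \<Rightarrow> complex^'n^'n" where
  "Jinv s 0 = mat 1"
| "Jinv s (Suc n) = Jinv s n ** U n (- s n)"

text \<open>The derivative of \<open>J s n x\<close> in the duration \<open>s j\<close> is \<open>J s n (w j s x)\<close>.\<close>
definition w :: "nat \<Rightarrow> (nat \<Rightarrow> real) \<Rightarrow> complex^'n^'n" where
  "w j s = Jinv s j ** A j ** J s j"

lemma J_Suc: "J s (Suc n) = U n (s n) ** J s n"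
  by (simp add: U_def)

lemma norm_U [simp]: "norm (U j t *v x) = norm x"
  by (simp add: U_def herm1 herm2)

lemma U_0 [simp]: "U j 0 = mat 1"
  by (simp add: U_def)

lemma U_inverse [simp]: "U j (- t) ** U j t = mat 1" "U j t ** U j (- t) = mat 1"
  by (simp_all add: U_def)

lemma U_cancel [simp]:
  "X ** U j (- t) ** U j t = X" "X ** U j t ** U j (- t) = X"
  "U j (- t) *v (U j t *v x) = x" "U j t *v (U j (- t) *v x) = x"
  by (simp_all add: U_def)

lemma U_parity: "even n \<Longrightarrow> U (n + j) = U j" "even n \<Longrightarrow> A (n + j) = A j"
  by (auto simp: U_def A_def fun_eq_iff)

lemma U_deriv: "((\<lambda>t. U j t *v x) has_vector_derivative U j t *v (A j *v x)) (at t)"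
  using prop_op_vec_deriv[of _ x t] unfolding U_def A_def
  by (simp add: matrix_vector_mul_assoc prop_op_gen_commute)

lemma U_A_commute: "U j t ** A j = A j ** U j t"
  by (simp add: U_def A_def prop_op_gen_commute)

lemma continuous_U: "continuous_on S (U j)"
  unfolding U_def by (rule continuous_prop_op)

lemma J_cong: "(\<And>j. j < n \<Longrightarrow> s j = s' j) \<Longrightarrow> J s n = J s' n"
  by (induction n) (auto simp: J_Suc simp del: Jop.simps(2))

lemma Jinv_cong: "(\<And>j. j < n \<Longrightarrow> s j = s' j) \<Longrightarrow> Jinv s n = Jinv s' n"
  by (induction n) auto

lemma w_cong: "(\<And>i. i < j \<Longrightarrow> s i = s' i) \<Longrightarrow> w j s = w j s'"
  unfolding w_def using J_cong[of j s s'] Jinv_cong[of j s s'] by simp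

lemma Jinv_J [simp]: "Jinv s n ** J s n = mat 1"
proof (induction n)
  case (Suc n)
  have "Jinv s (Suc n) ** J s (Suc n) = Jinv s n ** (U n (- s n) ** U n (s n)) ** J s n"
    unfolding J_Suc Jinv.simps by (simp only: matrix_mul_assoc)
  then show ?case using Suc by simp
qed simp

lemma J_Jinv [simp]: "J s n ** Jinv s n = mat 1"
proof (induction n)
  case (Suc n)
  have "J s (Suc n) ** Jinv s (Suc n) = U n (s n) ** (J s n ** Jinv s n) ** U n (- s n)"
    unfolding J_Suc Jinv.simps by (simp only: matrix_mul_assoc)
  then show ?case using Suc by simp
qed simp

lemma norm_J [simp]: "norm (J s n *v x) = norm x"
  by (induction n) (simp_all add: J_Suc matrix_vector_mul_assoc[symmetric] del: Jop.simps(2))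

lemma norm_Jinv [simp]: "norm (Jinv s n *v x) = norm x"
proof -
  have "norm (Jinv s n *v x) = norm (J s n *v (Jinv s n *v x))" by simp
  also have "\<dots> = norm x" by (simp only: matrix_vector_mul_assoc J_Jinv matrix_vector_mul_lid)
  finally show ?thesis .
qed

text \<open>The generator acting in leg \<open>j\<close> is pulled back to the start of the path, so
  the derivative is the image of a tangent vector at the initial state. Since \<open>w j s\<close>
  involves only durations before \<open>j\<close>, it is constant in the variable
  \<open>t\<close>.\<close>

lemma J_deriv:
  assumes "j < n"
  shows "((\<lambda>t. J (s(j := t)) n *v x) has_vector_derivative J (s(j := t)) n *v (w j s *v x)) (at t)"
  using assms
proof (induction n)
  case (Suc n)
  show ?case
  proof (cases "j = n")
    case True
    have c: "J (s(j := t)) n = J s n" for t using True by (intro J_cong) auto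
    have "((\<lambda>t. U n t *v (J s n *v x)) has_vector_derivative U n t *v (A n *v (J s n *v x))) (at t)"
      by (rule U_deriv)
    moreover have "J s n ** w n s = A n ** J s n"
      by (simp add: w_def matrix_mul_assoc)
    ultimately show ?thesis
      using True c unfolding J_Suc by (simp add: matrix_vector_mul_assoc matrix_mul_assoc[symmetric])
  next
    case False
    then have "j < n" using Suc by simp
    have "((\<lambda>t. U n (s n) *v (J (s(j := t)) n *v x)) has_vector_derivative
        U n (s n) *v (J (s(j := t)) n *v (w j s *v x))) (at t)"
      by (intro bounded_linear.has_vector_derivative[OF bounded_bilinear.bounded_linear_right[OF
            bounded_bilinear_matrix_vector_mult]] Suc \<open>j < n\<close>)
    then show ?thesis using False unfolding J_Suc by (simp add: matrix_vector_mul_assoc matrix_mul_assoc)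
  qed
qed simp

text \<open>The second path is reindexed from 0, so its legs keep their generators only if
  \<open>n\<close> is even; hence the parity assumptions on concatenations.\<close>

definition concat_path :: "nat \<Rightarrow> (nat \<Rightarrow> real) \<Rightarrow> (nat \<Rightarrow> real) \<Rightarrow> nat \<Rightarrow> real" where
  "concat_path n s c = (\<lambda>j. if j < n then s j else c (j - n))"

lemma J_concat: "even n \<Longrightarrow> J (concat_path n s c) (n + m) = J c m ** J s n"
proof (induction m)
  case 0
  have "J (concat_path n s c) n = J s n" by (rule J_cong) (simp add: concat_path_def)
  then show ?case by simp
next
  case (Suc m)
  then show ?case
    by (simp add: J_Suc U_parity matrix_mul_assoc concat_path_def del: Jop.simps(2))
qed

lemma Jinv_concat: "even n \<Longrightarrow> Jinv (concat_path n s c) (n + m) = Jinv s n ** Jinv c m"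
proof (induction m)
  case 0
  have "Jinv (concat_path n s c) n = Jinv s n" by (rule Jinv_cong) (simp add: concat_path_def)
  then show ?case by simp
next
  case (Suc m)
  then show ?case
    by (simp add: U_parity matrix_mul_assoc concat_path_def)
qed

lemma w_concat: "even n \<Longrightarrow> w (n + j) (concat_path n s c) = Jinv s n ** w j c ** J s n"
  by (simp add: w_def J_concat Jinv_concat U_parity matrix_mul_assoc)

lemma norm_conj_le:
  fixes T X T' :: "complex^'n^'n"
  assumes T: "\<And>x. norm (T *v x) = norm x" "\<And>x. norm (T' *v x) = norm x"
    and K: "\<And>x. norm (X *v x) \<le> K * norm x"
  shows "norm (T ** X ** T') \<le> K * real CARD('n) * real CARD('n)"
proof (rule norm_matrix_le_op)
  show "norm ((T ** X ** T') *v x) \<le> K * norm x" for x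
    using K[of "T' *v x"] by (simp add: matrix_vector_mul_assoc[symmetric] T)
qed

definition G :: "(complex^'n^'n) set" where
  "G = span {w j c | j c. \<forall>i. c i \<ge> 0}"

text \<open>Directions obtained by varying the first \<open>n\<close> durations of \<open>s\<close>,
  all pulled back to the initial state so that they live in one fixed space.\<close>

definition W :: "nat \<Rightarrow> (nat \<Rightarrow> real) \<Rightarrow> (complex^'n^'n) set" where
  "W n s = span ((\<lambda>j. w j s) ` {..<n})"

lemma linear_conj:
  fixes P Q :: "complex^'n^'n"
  shows "linear (\<lambda>X. P ** X ** Q :: complex^'n^'n)"
  using bounded_linear_compose[OF
      bounded_bilinear.bounded_linear_left[OF bounded_bilinear_matrix_mult, of Q]
      bounded_bilinear.bounded_linear_right[OF bounded_bilinear_matrix_mult, of P]]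
  by (rule bounded_linear.linear)

lemma inj_conj:
  fixes P P' Q Q' :: "complex^'n^'n"
  assumes "P' ** P = mat 1" "Q ** Q' = mat 1"
  shows "inj (\<lambda>X. P ** X ** Q :: complex^'n^'n)"
proof (rule inj_on_inverseI)
  fix X
  have "P' ** (P ** X ** Q) ** Q' = (P' ** P) ** X ** (Q ** Q')"
    by (simp only: matrix_mul_assoc)
  then show "P' ** (P ** X ** Q) ** Q' = X" using assms by simp
qed

lemma subspace_G: "subspace G" unfolding G_def by (rule subspace_span)

lemma w_in_G: "(\<And>i. c i \<ge> 0) \<Longrightarrow> w j c \<in> G"
  unfolding G_def by (intro span_base) auto

text \<open>Pulling a direction back along an even path gives a direction of the concatenated path,
  so \<open>G\<close> is mapped into itself. The map is linear and injective, and equality of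
  dimensions makes it onto.\<close>

lemma conj_image_G:
  assumes "even n" "\<And>i. s i \<ge> 0"
  shows "(\<lambda>X. Jinv s n ** X ** J s n) ` G = G"
proof -
  let ?f = "\<lambda>X. Jinv s n ** X ** J s n"
  have sub: "?f ` G \<subseteq> G"
  proof -
    have "?f ` G = span (?f ` {w j c | j c. \<forall>i. c i \<ge> 0})"
      unfolding G_def by (rule linear_span_image[OF linear_conj, symmetric])
    also have "\<dots> \<subseteq> G"
    proof (rule span_minimal[OF _ subspace_G], clarsimp)
      fix j and c :: "nat \<Rightarrow> real" assume c: "\<forall>i. 0 \<le> c i"
      have "?f (w j c) = w (n + j) (concat_path n s c)" using w_concat[OF assms(1)] by simp
      also have "\<dots> \<in> G" using c assms(2) by (intro w_in_G) (simp add: concat_path_def)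
      finally show "?f (w j c) \<in> G" .
    qed
    finally show ?thesis .
  qed
  show ?thesis
  proof (rule subspace_dim_equal)
    show "subspace (?f ` G)" by (rule linear_subspace_image[OF linear_conj subspace_G])
    show "dim (?f ` G) \<ge> dim G"
      using dim_image_eq[OF linear_conj, of "Jinv s n" "J s n" G]
        inj_conj[of "J s n" "Jinv s n" "J s n" "Jinv s n"] inj_on_subset by fastforce
  qed (use sub subspace_G in auto)
qed

text \<open>Surjectivity of the pull-back makes the opposite conjugation available, which is not
  itself a pull-back along a path with nonnegative durations.\<close>

lemma conj_J_G:
  assumes "even n" "\<And>i. s i \<ge> 0" "Z \<in> G"
  shows "J s n ** Z ** Jinv s n \<in> G"
proof -
  obtain Y where Y: "Y \<in> G" "Z = Jinv s n ** Y ** J s n"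
    using conj_image_G[of n s] assms by blast
  have "J s n ** Z ** Jinv s n = (J s n ** Jinv s n) ** Y ** (J s n ** Jinv s n)"
    unfolding Y(2) by (simp only: matrix_mul_assoc)
  then show ?thesis using Y(1) by simp
qed

lemma conj_U_G:
  assumes "t \<ge> 0" "Z \<in> G"
  shows "U k t ** Z ** U k (- t) \<in> G"
proof (cases "even k")
  case True
  then have e: "U k = U 0" by (simp add: U_def fun_eq_iff)
  \<comment> \<open>A single leg is completed to an even path by a leg of duration zero, placed
    after it for \<open>H1\<close> and before it for \<open>H2\<close>.\<close>
  have "J ((\<lambda>_. 0)(0 := t)) 2 = U 0 t" "Jinv ((\<lambda>_. 0)(0 := t)) 2 = U 0 (-t)"
    by (simp_all add: numeral_2_eq_2 U_def[symmetric] J_Suc del: Jop.simps(2))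
  then show ?thesis using conj_J_G[of 2 "(\<lambda>_. 0)(0 := t)" Z] assms by (simp add: e)
next
  case False
  then have e: "U k = U 1" by (simp add: U_def fun_eq_iff)
  have "J ((\<lambda>_. 0)(1 := t)) 2 = U 1 t" "Jinv ((\<lambda>_. 0)(1 := t)) 2 = U 1 (-t)"
    by (simp_all add: numeral_2_eq_2 U_def[symmetric] J_Suc del: Jop.simps(2))
  then show ?thesis using conj_J_G[of 2 "(\<lambda>_. 0)(1 := t)" Z] assms by (simp add: e)
qed

lemma A_in_G: "A k \<in> G"
proof (cases "even k")
  case True
  then show ?thesis using w_in_G[of "\<lambda>_. 0" 0] by (simp add: w_def A_def)
next
  case False
  then show ?thesis using w_in_G[of "\<lambda>_. 0" 1] by (simp add: w_def A_def)
qed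

lemma W_mono: "n \<le> m \<Longrightarrow> W n s \<subseteq> W m s"
  unfolding W_def by (intro span_mono image_mono) auto

lemma spanning_path:
  obtains n s where "even n" "\<And>i. s i \<ge> 0" "W n s = G"
proof -
  define P where "P d \<longleftrightarrow> (\<exists>n s. (\<forall>i. s i \<ge> 0) \<and> dim (W n s) = d)" for d
  have P0: "P (dim (W 0 (\<lambda>_. 0)))" unfolding P_def by (intro exI[of _ 0] exI[of _ "\<lambda>_. 0"]) auto
  have bd: "\<forall>y. P y \<longrightarrow> y \<le> DIM(complex^'n^'n)"
    unfolding P_def using dim_subset_UNIV by blast
  obtain d where d: "P d" "\<And>e. P e \<Longrightarrow> e \<le> d"
    using Greatest_le_nat[of P, OF _ bd[rule_format]] GreatestI_nat[of P, OF P0 bd[rule_format]] by blast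
  then obtain m s where ms: "\<And>i. s i \<ge> 0" "dim (W m s) = d" unfolding P_def by blast
  \<comment> \<open>An even length is needed for concatenation. A longer path has at least as many
    directions, so the maximal dimension is kept.\<close>
  define n where "n = 2 * m"
  have sub: "subspace (W k s)" for k s unfolding W_def by (rule subspace_span)
  have n: "dim (W n s) = d" "even n"
  proof -
    have "d \<le> dim (W n s)" using dim_subset[OF W_mono[of m n s]] ms by (simp add: n_def)
    moreover have "P (dim (W n s))" unfolding P_def using ms by auto
    ultimately show "dim (W n s) = d" using d by (simp add: eq_iff)
  qed (simp add: n_def)
  let ?f = "\<lambda>X. Jinv s n ** X ** J s n"
  \<comment> \<open>Appending a path \<open>c\<close> leaves the first \<open>n\<close> directions
    unchanged and cannot raise the maximal dimension, so the pull-back of \<open>w j c\<close>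
    already lies in \<open>W n s\<close>. Together with surjectivity of the pull-back this gives all
    of \<open>G\<close>.\<close>
  have in_W: "?f (w j c) \<in> W n s" if c: "\<And>i. c i \<ge> 0" for j c
  proof -
    let ?c = "concat_path n s c"
    have "w i ?c = w i s" if "i < n" for i
      using that by (intro w_cong) (simp add: concat_path_def)
    then have e: "W n ?c = W n s" unfolding W_def by (intro arg_cong[of _ _ span] image_cong) auto
    have "P (dim (W (n + Suc j) ?c))" unfolding P_def using ms c
      by (intro exI[of _ "n + Suc j"] exI[of _ ?c]) (auto simp: concat_path_def)
    then have "W n s = W (n + Suc j) ?c"
      using e d(2) n W_mono[of n "n + Suc j" ?c] by (intro subspace_dim_equal sub) auto
    moreover have "w (n + j) ?c \<in> W (n + Suc j) ?c" unfolding W_def by (intro span_base) auto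
    ultimately show ?thesis using w_concat[OF n(2)] by simp
  qed
  have "G = ?f ` G" using conj_image_G[OF n(2) ms(1)] by simp
  also have "\<dots> = span (?f ` {w j c | j c. \<forall>i. c i \<ge> 0})"
    unfolding G_def by (rule linear_span_image[OF linear_conj, symmetric])
  also have "\<dots> \<subseteq> W n s" using in_W by (intro span_minimal sub) auto
  finally have "G \<subseteq> W n s" .
  moreover have "W n s \<subseteq> G" unfolding W_def using ms by (intro span_minimal subspace_G) (auto intro: w_in_G)
  ultimately show ?thesis using that n ms by blast
qed

end

section \<open>Smoothing along the transported generators\<close>

text \<open>The weight \<open>a\<close> is merely Lipschitz, so integration by parts is done for
  difference quotients: a translation moves the increment from \<open>F\<close> to \<open>a\<close>.
  The bound involves the supremum of \<open>F\<close>; the bound \<open>L\<close> of its derivative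
  serves only to pass to the limit.\<close>

lemma integral_lipschitz_deriv:
  fixes a F F' :: "real \<Rightarrow> real"
  assumes K: "K \<ge> 0" and a: "\<And>s t. \<bar>a s - a t\<bar> \<le> K * \<bar>s - t\<bar>"
    and supp: "\<And>t. t \<notin> {\<alpha>..\<beta>} \<Longrightarrow> a t = 0" and ab: "\<alpha> \<le> \<beta>"
    and F: "\<And>t. (F has_real_derivative F' t) (at t)" and L: "\<And>t. \<bar>F' t\<bar> \<le> L"
    and F1: "\<And>t. \<bar>F t\<bar> \<le> 1"
  shows "\<bar>\<integral>t. a t * F' t \<partial>lborel\<bar> \<le> K * (\<beta> - \<alpha>)"
proof -
  define h where "h n = 1 / real (Suc n)" for n
  have h: "h n > 0" for n by (simp add: h_def)
  have h0: "h \<longlonglongrightarrow> 0" unfolding h_def using LIMSEQ_inverse_real_of_nat by (simp add: inverse_eq_divide)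
  have cont_a: "continuous_on UNIV a"
    using lipschitz_onI[of UNIV a K] a K by (auto simp: dist_real_def intro: lipschitz_on_continuous_on)
  have [measurable]: "a \<in> borel_measurable borel" using cont_a by (rule borel_measurable_continuous_onI)
  have cont_F: "continuous_on UNIV F" using F by (intro continuous_at_imp_continuous_on) (auto intro: DERIV_isCont)
  have [measurable]: "F \<in> borel_measurable borel" using cont_F by (rule borel_measurable_continuous_onI)
  have quot: "(\<lambda>n. (F (t + h n) - F t) / h n) \<longlonglongrightarrow> F' t" for t
  proof -
    have "((\<lambda>h. (F (t + h) - F t) / h) \<longlongrightarrow> F' t) (at 0)" using F by (simp add: DERIV_def)
    moreover have "\<forall>n. h n \<in> UNIV - {0}" by (simp add: h_def)
    ultimately show ?thesis using h0 unfolding tendsto_at_iff_sequentially o_def by blast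
  qed
  have [measurable]: "F' \<in> borel_measurable borel"
    by (rule borel_measurable_LIMSEQ_metric[OF _ quot]) measurable
  \<comment> \<open>\<open>a\<close> vanishes at \<open>\<beta> + 1\<close>, and no point of the
    support is farther from there than \<open>\<beta> + 1 - \<alpha>\<close>.\<close>
  define B where "B = K * (\<beta> + 1 - \<alpha>)"
  have aB: "\<bar>a t\<bar> \<le> B * indicator {\<alpha>..\<beta>} t" for t
  proof (cases "t \<in> {\<alpha>..\<beta>}")
    case True
    have "\<bar>a t\<bar> \<le> K * \<bar>t - (\<beta> + 1)\<bar>" using a[of t "\<beta> + 1"] supp[of "\<beta> + 1"] by simp
    also have "\<dots> \<le> B" unfolding B_def using True K by (intro mult_left_mono) auto
    finally show ?thesis using True by simp
  qed (simp add: supp)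
  have intI: "integrable lborel g" if "g \<in> borel_measurable borel" "\<And>t. \<bar>g t\<bar> \<le> M * indicator {c..d} t" for g :: "real \<Rightarrow> real" and M c d
  proof (rule Bochner_Integration.integrable_bound[of _ "\<lambda>t. M * indicator {c..d} t"])
    show "integrable lborel (\<lambda>t. M * indicator {c..d} t)" by (intro integrable_mult_right integrable_real_indicator) (auto simp: emeasure_lborel_Icc_eq)
    show "AE x in lborel. norm (g x) \<le> norm (M * indicator {c..d} x)"
      unfolding real_norm_def by (intro AE_I2 order_trans[OF that(2) abs_ge_self])
  qed (use that in simp)
  have lim: "(\<lambda>n. \<integral>t. a t * ((F (t + h n) - F t) / h n) \<partial>lborel) \<longlonglongrightarrow> (\<integral>t. a t * F' t \<partial>lborel)"
  proof (rule integral_dominated_convergence[where w="\<lambda>t. (B * L) * indicator {\<alpha>..\<beta>} t"])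
    show "integrable lborel (\<lambda>t. (B * L) * indicator {\<alpha>..\<beta>} t)" by (intro integrable_mult_right integrable_real_indicator) (auto simp: emeasure_lborel_Icc_eq)
    show "AE t in lborel. (\<lambda>n. a t * ((F (t + h n) - F t) / h n)) \<longlonglongrightarrow> a t * F' t"
      by (intro AE_I2 tendsto_mult quot tendsto_const)
    fix n
    show "AE t in lborel. norm (a t * ((F (t + h n) - F t) / h n)) \<le> (B * L) * indicator {\<alpha>..\<beta>} t"
    proof (intro AE_I2)
      fix t
      have "\<exists>z. F (t + h n) - F t = (t + h n - t) * F' z"
        using MVT2[of t "t + h n" F F'] F h[of n] by (metis less_add_same_cancel1)
      then have "\<bar>(F (t + h n) - F t) / h n\<bar> \<le> L" using h[of n] L by (auto simp: abs_mult)
      then have "norm (a t * ((F (t + h n) - F t) / h n)) \<le> (B * indicator {\<alpha>..\<beta>} t) * L"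
        unfolding real_norm_def abs_mult using aB[of t] by (intro mult_mono) auto
      then show "norm (a t * ((F (t + h n) - F t) / h n)) \<le> (B * L) * indicator {\<alpha>..\<beta>} t" by (simp add: mult_ac)
    qed
  qed measurable
  have bnd: "\<bar>\<integral>t. a t * ((F (t + h n) - F t) / h n) \<partial>lborel\<bar> \<le> K * (\<beta> - \<alpha> + h n)" for n
  proof -
    have [measurable]: "(\<lambda>t. a (t - h n)) \<in> borel_measurable borel" by measurable
    have "\<bar>a t * F (t + h n)\<bar> \<le> B * indicator {\<alpha>..\<beta>} t" for t
      using mult_mono[OF aB F1, of t "t + h n"] order_trans[OF abs_ge_zero aB] by (simp add: abs_mult)
    then have i1: "integrable lborel (\<lambda>t. a t * F (t + h n))" by (intro intI) auto
    have "\<bar>a t * F t\<bar> \<le> B * indicator {\<alpha>..\<beta>} t" for t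
      using mult_mono[OF aB F1, of t "t"] order_trans[OF abs_ge_zero aB] by (simp add: abs_mult)
    then have i2: "integrable lborel (\<lambda>t. a t * F t)" by (intro intI) auto
    have sh: "(\<integral>t. a t * F (t + h n) \<partial>lborel) = (\<integral>t. a (t - h n) * F t \<partial>lborel)"
      using lborel_integral_real_affine[of 1 "\<lambda>t. a t * F (t + h n)" "- h n"] by simp
    have i3: "integrable lborel (\<lambda>t. a (t - h n) * F t)"
      using lborel_integrable_real_affine[OF i1, of 1 "- h n"] by simp
    have "(\<integral>t. a t * ((F (t + h n) - F t) / h n) \<partial>lborel) = (\<integral>t. (a t * F (t + h n) - a t * F t) / h n \<partial>lborel)"
      by (intro Bochner_Integration.integral_cong refl) (simp add: algebra_simps)
    also have "\<dots> = ((\<integral>t. a t * F (t + h n) \<partial>lborel) - (\<integral>t. a t * F t \<partial>lborel)) / h n"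
      using i1 i2 by simp
    also have "\<dots> = (\<integral>t. (a (t - h n) * F t - a t * F t) / h n \<partial>lborel)"
      unfolding sh using i3 i2 by simp
    finally have eq: "(\<integral>t. a t * ((F (t + h n) - F t) / h n) \<partial>lborel) = (\<integral>t. (a (t - h n) * F t - a t * F t) / h n \<partial>lborel)" .
    \<comment> \<open>The increment of the weight lives on the interval enlarged by
      \<open>h n\<close>; the surplus disappears in the limit.\<close>
    have le: "\<bar>(a (t - h n) * F t - a t * F t) / h n\<bar> \<le> K * indicator {\<alpha>..\<beta> + h n} t" for t
    proof (cases "t \<in> {\<alpha>..\<beta> + h n}")
      case True
      have "\<bar>(a (t - h n) - a t) * F t\<bar> \<le> (K * h n) * 1"
        unfolding abs_mult using a[of "t - h n" t] F1[of t] h[of n] K by (intro mult_mono) auto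
      then show ?thesis using True h[of n] by (simp add: algebra_simps pos_divide_le_eq)
    next
      case False
      then have "a (t - h n) = 0" "a t = 0" using h[of n] by (auto intro!: supp)
      then show ?thesis using K by simp
    qed
    have "\<bar>\<integral>t. (a (t - h n) * F t - a t * F t) / h n \<partial>lborel\<bar> \<le> (\<integral>t. K * indicator {\<alpha>..\<beta> + h n} t \<partial>lborel)"
    proof (rule order_trans[OF integral_abs_bound integral_mono])
      show "integrable lborel (\<lambda>t. \<bar>(a (t - h n) * F t - a t * F t) / h n\<bar>)"
        using i2 i3 by (intro integrable_abs integrable_divide Bochner_Integration.integrable_diff)
      show "integrable lborel (\<lambda>t. K * indicator {\<alpha>..\<beta> + h n} t)"
        by (intro integrable_mult_right integrable_real_indicator) (auto simp: emeasure_lborel_Icc_eq)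
    qed (rule le)
    also have "\<dots> = K * (\<beta> - \<alpha> + h n)" using ab h[of n] by simp
    finally show ?thesis unfolding eq .
  qed
  have "(\<lambda>n. K * (\<beta> - \<alpha> + h n)) \<longlonglongrightarrow> K * (\<beta> - \<alpha> + 0)"
    by (intro tendsto_intros h0)
  then have "(\<lambda>n. K * (\<beta> - \<alpha> + h n)) \<longlonglongrightarrow> K * (\<beta> - \<alpha>)" by simp
  from LIMSEQ_le[OF tendsto_rabs[OF lim] this] bnd show ?thesis by blast
qed

text \<open>Differentiation under the integral is dominated by \<open>L\<close>, but the mean value
  inequality is applied to the integrated function. The Lipschitz constant is therefore the bound
  \<open>C\<close> on the integral of the derivative, which profits from cancellation.\<close>

lemma integral_parameter_lipschitz:
  fixes F F' :: "'b \<Rightarrow> real \<Rightarrow> real"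
  assumes "finite_measure N"
    and F: "\<And>b t. (F b has_real_derivative F' b t) (at t)" and L: "\<And>b t. \<bar>F' b t\<bar> \<le> L"
    and F1: "\<And>b t. \<bar>F b t\<bar> \<le> 1" and meas: "\<And>t. (\<lambda>b. F b t) \<in> borel_measurable N"
    and C: "\<And>t. \<bar>\<integral>b. F' b t \<partial>N\<bar> \<le> C"
  shows "\<bar>(\<integral>b. F b s \<partial>N) - (\<integral>b. F b t \<partial>N)\<bar> \<le> C * \<bar>s - t\<bar>"
proof -
  interpret finite_measure N by fact
  have int: "integrable N (\<lambda>b. F b t)" for t
    by (rule integrable_const_bound[of _ 1]) (use F1 meas in auto)
  have der: "((\<lambda>t. \<integral>b. F b t \<partial>N) has_real_derivative (\<integral>b. F' b t \<partial>N)) (at t)" for t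
    unfolding DERIV_def tendsto_at_iff_sequentially o_def
  proof (intro allI impI)
    fix X :: "nat \<Rightarrow> real" assume X: "\<forall>i. X i \<in> UNIV - {0}" "X \<longlonglongrightarrow> 0"
    have quot: "(\<lambda>n. (F b (t + X n) - F b t) / X n) \<longlonglongrightarrow> F' b t" for b
    proof -
      have "((\<lambda>h. (F b (t + h) - F b t) / h) \<longlongrightarrow> F' b t) (at 0)" using F by (simp add: DERIV_def)
      then show ?thesis using X unfolding tendsto_at_iff_sequentially o_def by auto
    qed
    have m: "(\<lambda>b. (F b (t + X n) - F b t) / X n) \<in> borel_measurable N" for n
      using meas by measurable
    have "(\<lambda>n. \<integral>b. (F b (t + X n) - F b t) / X n \<partial>N) \<longlonglongrightarrow> (\<integral>b. F' b t \<partial>N)"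
    proof (rule integral_dominated_convergence[where w="\<lambda>_. L"])
      show "(\<lambda>b. F' b t) \<in> borel_measurable N"
        by (rule borel_measurable_LIMSEQ_metric[OF m quot])
      fix n
      show "AE b in N. norm ((F b (t + X n) - F b t) / X n) \<le> L"
      proof (intro AE_I2)
        fix b
        have "norm (F b (t + X n) - F b t) \<le> L * norm (t + X n - t)"
          using F L by (intro field_differentiable_bound[of UNIV "F b" "F' b"]) (auto intro: has_field_derivative_at_within)
        then show "norm ((F b (t + X n) - F b t) / X n) \<le> L"
          using X(1) by (auto simp: divide_le_eq mult.commute)
      qed
    qed (use m quot in auto)
    then show "(\<lambda>n. ((\<integral>b. F b (t + X n) \<partial>N) - (\<integral>b. F b t \<partial>N)) / X n) \<longlonglongrightarrow> (\<integral>b. F' b t \<partial>N)"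
      by (simp add: int)
  qed
  have "norm ((\<integral>b. F b s \<partial>N) - (\<integral>b. F b t \<partial>N)) \<le> C * norm (s - t)"
    using der C by (intro field_differentiable_bound[of UNIV _ "\<lambda>t. \<integral>b. F' b t \<partial>N"]) (auto intro: has_field_derivative_at_within)
  then show ?thesis by simp
qed

section \<open>Differentiable test functions and Lipschitz bounds for paths\<close>

definition smooth1 :: "('a::euclidean_space \<Rightarrow> real) \<Rightarrow> ('a \<Rightarrow> 'a \<Rightarrow> real) \<Rightarrow> bool" where
  "smooth1 f Df \<longleftrightarrow> (\<forall>x. (f has_derivative Df x) (at x)) \<and> continuous_on UNIV (\<lambda>(x, v). Df x v)"

text \<open>Polynomials serve as test functions: they are differentiable and dense among the
  continuous functions on the sphere. Joint continuity of the derivative in point and direction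
  gives bounds over compact sets of both.\<close>

lemma polynomial_smooth1:
  "real_polynomial_function f \<Longrightarrow> \<exists>Df. smooth1 f Df"
proof (induction rule: real_polynomial_function.induct)
  case (linear f)
  then show ?case unfolding smooth1_def
    by (intro exI[of _ "\<lambda>x. f"])
      (auto intro: bounded_linear_imp_has_derivative simp: case_prod_unfold
        intro!: continuous_intros bounded_linear.continuous_on[OF linear])
next
  case (const c)
  then show ?case unfolding smooth1_def by (intro exI[of _ "\<lambda>x v. 0"]) auto
next
  case (add f g)
  then obtain Df Dg where "smooth1 f Df" "smooth1 g Dg" by blast
  then show ?case unfolding smooth1_def case_prod_unfold
    by (intro exI[of _ "\<lambda>x v. Df x v + Dg x v"]) (auto intro!: derivative_intros continuous_intros)
next
  case (mult f g)
  then obtain Df Dg where *: "smooth1 f Df" "smooth1 g Dg" by blast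
  have c: "continuous_on UNIV f" "continuous_on UNIV g"
    using * unfolding smooth1_def
    by (auto intro!: continuous_at_imp_continuous_on has_derivative_continuous)
  have "continuous_on UNIV (\<lambda>p::'a\<times>'a. f (fst p))" "continuous_on UNIV (\<lambda>p::'a\<times>'a. g (fst p))"
    by (auto intro!: continuous_on_compose2[OF c(1)] continuous_on_compose2[OF c(2)] continuous_intros)
  then show ?case using * unfolding smooth1_def case_prod_unfold
    by (intro exI[of _ "\<lambda>x v. f x * Dg x v + Df x v * g x"]) (auto intro!: derivative_intros continuous_intros)
qed

context hermitian_pair begin

lemma U_lipschitz:
  obtains L where "L > 0" "\<And>j s t x. norm (U j s *v x - U j t *v x) \<le> L * \<bar>s - t\<bar> * norm x"
proof -
  obtain L1 where L1: "L1 > 0" "\<And>s t x. norm (prop_op H1 s *v x - prop_op H1 t *v x) \<le> L1 * \<bar>s - t\<bar> * norm x"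
    using prop_op_vec_lipschitz[OF herm1] by metis
  obtain L2 where L2: "L2 > 0" "\<And>s t x. norm (prop_op H2 s *v x - prop_op H2 t *v x) \<le> L2 * \<bar>s - t\<bar> * norm x"
    using prop_op_vec_lipschitz[OF herm2] by metis
  show ?thesis
  proof (rule that[of "max L1 L2"])
    show "max L1 L2 > 0" using L1 by simp
    have "L1 * \<bar>s - t\<bar> * norm x \<le> max L1 L2 * \<bar>s - t\<bar> * norm x"
      "L2 * \<bar>s - t\<bar> * norm x \<le> max L1 L2 * \<bar>s - t\<bar> * norm x" for s t and x :: "complex^'n"
      by (auto intro!: mult_right_mono)
    then show "norm (U j s *v x - U j t *v x) \<le> max L1 L2 * \<bar>s - t\<bar> * norm x" for j s t x
      unfolding U_def using L1(2)[of s x t] L2(2)[of s x t] by (auto intro: order_trans)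
  qed
qed

text \<open>All legs are isometries, so their errors add up without amplification and the constant
  does not depend on the number of legs.\<close>

lemma J_lipschitz:
  obtains L where "L > 0"
    "\<And>s s' n x. norm (J s n *v x - J s' n *v x) \<le> L * (\<Sum>j<n. \<bar>s j - s' j\<bar>) * norm x"
    "\<And>s s' n x. norm (Jinv s n *v x - Jinv s' n *v x) \<le> L * (\<Sum>j<n. \<bar>s j - s' j\<bar>) * norm x"
proof -
  obtain L where L: "L > 0" "\<And>j s t x. norm (U j s *v x - U j t *v x) \<le> L * \<bar>s - t\<bar> * norm x"
    using U_lipschitz by metis
  have 1: "norm (J s n *v x - J s' n *v x) \<le> L * (\<Sum>j<n. \<bar>s j - s' j\<bar>) * norm x" for s s' n x
  proof (induction n)
    case (Suc n)
    have "J s (Suc n) *v x - J s' (Suc n) *v x = U n (s n) *v (J s n *v x - J s' n *v x)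
       + (U n (s n) *v (J s' n *v x) - U n (s' n) *v (J s' n *v x))"
      unfolding J_Suc by (simp add: matrix_vector_mul_assoc matrix_vector_mult_diff_distrib)
    also have "norm \<dots> \<le> norm (J s n *v x - J s' n *v x) + L * \<bar>s n - s' n\<bar> * norm x"
      using L(2)[of n "s n" "J s' n *v x" "s' n"] by (intro order_trans[OF norm_triangle_ineq]) simp
    finally show ?case using Suc by (simp add: algebra_simps)
  qed simp
  have 2: "norm (Jinv s n *v x - Jinv s' n *v x) \<le> L * (\<Sum>j<n. \<bar>s j - s' j\<bar>) * norm x" for s s' n x
  proof (induction n arbitrary: x)
    case (Suc n)
    have "Jinv s (Suc n) *v x - Jinv s' (Suc n) *v x = Jinv s n *v (U n (- s n) *v x - U n (- s' n) *v x)
       + (Jinv s n *v (U n (- s' n) *v x) - Jinv s' n *v (U n (- s' n) *v x))"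
      by (simp add: matrix_vector_mul_assoc matrix_vector_mult_diff_distrib)
    also have "norm \<dots> \<le> L * \<bar>s n - s' n\<bar> * norm x + L * (\<Sum>j<n. \<bar>s j - s' j\<bar>) * norm x"
      using L(2)[of n "- s n" x "- s' n"] Suc[of "U n (- s' n) *v x"]
      by (intro order_trans[OF norm_triangle_ineq]) (simp add: abs_minus_commute)
    finally show ?case by (simp add: algebra_simps)
  qed simp
  show ?thesis using that L(1) 1 2 by blast
qed

lemma A_bound:
  obtains a where "a > 0" "\<And>k x. norm (A k *v x) \<le> a * norm x"
proof -
  obtain K where K: "K > 0" "\<And>(X :: complex^'n^'n) x. norm (X *v x) \<le> K * norm X * norm x"
    using matrix_vector_bound by metis
  let ?a = "K * (norm (gen H1) + norm (gen H2)) + 1"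
  have "norm (A k *v x) \<le> ?a * norm x" for k x
  proof -
    have "norm (A k *v x) \<le> K * norm (A k) * norm x" by (rule K)
    also have "\<dots> \<le> ?a * norm x"
      using K(1) by (intro mult_right_mono) (auto simp: A_def distrib_left add_increasing add_increasing2)
    finally show ?thesis .
  qed
  moreover have "?a > 0" using K(1) by (simp add: add_nonneg_pos)
  ultimately show ?thesis using that by blast
qed

lemma w_lipschitz:
  obtains L where "L > 0" "\<And>j s s'. norm (w j s - w j s') \<le> L * (\<Sum>i<j. \<bar>s i - s' i\<bar>)"
proof -
  obtain L where L: "L > 0"
    "\<And>s s' n x. norm (J s n *v x - J s' n *v x) \<le> L * (\<Sum>j<n. \<bar>s j - s' j\<bar>) * norm x"
    "\<And>s s' n x. norm (Jinv s n *v x - Jinv s' n *v x) \<le> L * (\<Sum>j<n. \<bar>s j - s' j\<bar>) * norm x"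
    by (rule J_lipschitz) blast
  obtain a where a: "a > 0" "\<And>k x. norm (A k *v x) \<le> a * norm x" using A_bound by metis
  let ?L = "2 * L * a * real CARD('n) * real CARD('n)"
  have "norm (w j s - w j s') \<le> ?L * (\<Sum>i<j. \<bar>s i - s' i\<bar>)" for j s s'
  proof -
    let ?d = "\<Sum>i<j. \<bar>s i - s' i\<bar>"
    have "norm ((w j s - w j s') *v x) \<le> (2 * L * a * ?d) * norm x" for x
    proof -
      have "(w j s - w j s') *v x = Jinv s j *v (A j *v (J s j *v x - J s' j *v x))
         + (Jinv s j *v (A j *v (J s' j *v x)) - Jinv s' j *v (A j *v (J s' j *v x)))"
        unfolding w_def by (simp add: matrix_vector_mul_assoc matrix_mul_assoc matrix_vector_mult_diff_distrib
            matrix_vector_mult_diff_rdistrib)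
      also have "norm \<dots> \<le> a * norm (J s j *v x - J s' j *v x) + L * ?d * norm (A j *v (J s' j *v x))"
        using a(2)[of j "J s j *v x - J s' j *v x"] L(3)
        by (intro order_trans[OF norm_triangle_ineq] add_mono) simp_all
      also have "\<dots> \<le> a * (L * ?d * norm x) + L * ?d * (a * norm x)"
        using a(2)[of j "J s' j *v x"] a(1) L by (intro add_mono mult_left_mono) (auto simp: sum_nonneg)
      finally show ?thesis by (simp add: algebra_simps)
    qed
    from norm_matrix_le_op[OF this] show ?thesis by (simp add: mult_ac)
  qed
  moreover have "?L > 0" using L a by simp
  ultimately show ?thesis using that by blast
qed

lemma measurable_matrix_mult [measurable (raw)]:
  fixes f g :: "'b \<Rightarrow> complex^'n^'n"
  assumes "f \<in> borel_measurable N" "g \<in> borel_measurable N"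
  shows "(\<lambda>x. f x ** g x) \<in> borel_measurable N"
  by (rule borel_measurable_continuous_Pair[OF assms])
    (intro bounded_bilinear.continuous_on[OF bounded_bilinear_matrix_mult] continuous_intros)

lemma measurable_matrix_vector_mult [measurable (raw)]:
  fixes f :: "'b \<Rightarrow> complex^'n^'n"
  assumes "f \<in> borel_measurable N" "g \<in> borel_measurable N"
  shows "(\<lambda>x. f x *v g x) \<in> borel_measurable N"
  by (rule borel_measurable_continuous_Pair[OF assms])
    (intro bounded_bilinear.continuous_on[OF bounded_bilinear_matrix_vector_mult] continuous_intros)

lemma measurable_U [measurable]: "U j \<in> borel_measurable borel"
  by (rule borel_measurable_continuous_onI[OF continuous_U])

lemma measurable_J:
  assumes "\<And>j. j < n \<Longrightarrow> (\<lambda>b. s b j) \<in> borel_measurable N"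
  shows "(\<lambda>b. J (s b) n) \<in> borel_measurable N" "(\<lambda>b. Jinv (s b) n) \<in> borel_measurable N"
proof -
  have "(\<lambda>b. J (s b) n) \<in> borel_measurable N \<and> (\<lambda>b. Jinv (s b) n) \<in> borel_measurable N"
    using assms
  proof (induction n)
    case (Suc n)
    then have [measurable]: "(\<lambda>b. J (s b) n) \<in> borel_measurable N" "(\<lambda>b. Jinv (s b) n) \<in> borel_measurable N"
      "(\<lambda>b. s b n) \<in> borel_measurable N" by auto
    show ?case unfolding J_Suc Jinv.simps by measurable
  qed simp
  then show "(\<lambda>b. J (s b) n) \<in> borel_measurable N" "(\<lambda>b. Jinv (s b) n) \<in> borel_measurable N" by blast+
qed

lemma measurable_w:
  assumes "\<And>i. i < j \<Longrightarrow> (\<lambda>b. s b i) \<in> borel_measurable N"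
  shows "(\<lambda>b. w j (s b)) \<in> borel_measurable N"
proof -
  note [measurable] = measurable_J[of j s N, OF assms]
  show ?thesis unfolding w_def by measurable
qed

end

text \<open>The box extends only to the right of \<open>s\<close>, so all durations in it stay
  nonnegative when those of \<open>s\<close> are.\<close>

definition in_box :: "nat \<Rightarrow> (nat \<Rightarrow> real) \<Rightarrow> real \<Rightarrow> (nat \<Rightarrow> real) \<Rightarrow> bool" where
  "in_box n s \<rho> b \<longleftrightarrow> (\<forall>j<n. s j \<le> b j \<and> b j \<le> s j + \<rho>)"

section \<open>Coordinates of \<open>G\<close> along nearby paths\<close>

context hermitian_pair begin

text \<open>The directions \<open>w j s\<close> may be dependent. A basis is selected among them,
  each basis vector receives one index, and the remaining functionals are zero. This makes the
  coordinates linear on the whole matrix space.\<close>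

lemma spanning_coordinates:
  assumes "W n s = G"
  obtains \<phi> :: "nat \<Rightarrow> complex^'n^'n \<Rightarrow> real"
  where "\<And>j. linear (\<phi> j)" "\<And>v. v \<in> G \<Longrightarrow> v = (\<Sum>j<n. \<phi> j v *\<^sub>R w j s)"
proof -
  let ?S = "(\<lambda>j. w j s) ` {..<n}"
  obtain B where B: "B \<subseteq> ?S" "independent B" "?S \<subseteq> span B"
    using maximal_independent_subset by blast
  have spanB: "span B = G"
    using B(1,3) assms unfolding W_def by (metis span_mono span_minimal subspace_span subset_antisym)
  have finB: "finite B" using B(1) finite_surj by blast
  have "\<exists>g. linear g \<and> (\<forall>x\<in>B. g x = (if x = b then 1 else (0::real)))" for b
    using linear_independent_extend[OF B(2), of "\<lambda>x. if x = b then 1 else (0::real)"] by blast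
  then obtain g :: "complex^'n^'n \<Rightarrow> complex^'n^'n \<Rightarrow> real" where
    g: "\<And>b. linear (g b)" "\<And>b x. x \<in> B \<Longrightarrow> g b x = (if x = b then 1 else 0)" by metis
  obtain idx where idx: "\<And>b. b \<in> B \<Longrightarrow> idx b < n \<and> w (idx b) s = b"
    using B(1) by (metis (no_types, lifting) image_iff lessThan_iff subsetD)
  have inj: "inj_on idx B" using idx by (metis inj_onI)
  define \<phi> where "\<phi> j = (if w j s \<in> B \<and> idx (w j s) = j then g (w j s) else (\<lambda>_. 0))" for j
  have lin: "linear (\<phi> j)" for j
    unfolding \<phi>_def using g(1) by (auto intro: module_hom_zero)
  have e1: "(\<Sum>j<n. \<phi> j v *\<^sub>R w j s) = (\<Sum>b\<in>B. g b v *\<^sub>R b)" for v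
  proof -
    have "(\<Sum>j<n. \<phi> j v *\<^sub>R w j s) = (\<Sum>j\<in>idx ` B. \<phi> j v *\<^sub>R w j s)"
      using idx by (intro sum.mono_neutral_right) (auto simp: \<phi>_def, metis imageI)
    also have "\<dots> = (\<Sum>b\<in>B. \<phi> (idx b) v *\<^sub>R w (idx b) s)"
      using sum.reindex[OF inj, of "\<lambda>j. \<phi> j v *\<^sub>R w j s"] by (simp add: o_def)
    also have "\<dots> = (\<Sum>b\<in>B. g b v *\<^sub>R b)"
      using idx by (intro sum.cong) (auto simp: \<phi>_def)
    finally show ?thesis .
  qed
  have "v = (\<Sum>b\<in>B. g b v *\<^sub>R b)" if "v \<in> G" for v
  proof (rule linear_eq_on_span[where f="\<lambda>v. v" and g="\<lambda>v. \<Sum>b\<in>B. g b v *\<^sub>R b" and B=B])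
    show "linear (\<lambda>v. \<Sum>b\<in>B. g b v *\<^sub>R b)"
      using g(1) by (intro linear_compose_sum) (auto intro!: linearI simp: linear_add linear_scale scaleR_left_distrib)
    show "x = (\<Sum>b\<in>B. g b x *\<^sub>R b)" if "x \<in> B" for x
    proof -
      have "(\<Sum>b\<in>B. g b x *\<^sub>R b) = (\<Sum>b\<in>B. if x = b then b else 0)"
        using that g(2) by (intro sum.cong) auto
      then show ?thesis using that finB by simp
    qed
  qed (use that spanB linear_id in \<open>auto simp: id_def\<close>)
  with e1 have "v = (\<Sum>j<n. \<phi> j v *\<^sub>R w j s)" if "v \<in> G" for v using that by simp
  with lin show ?thesis by (rule that)
qed

lemma w_in_G': "(\<And>i. i < j \<Longrightarrow> c i \<ge> 0) \<Longrightarrow> w j c \<in> G"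
proof -
  assume c: "\<And>i. i < j \<Longrightarrow> c i \<ge> 0"
  have "w j c = w j (\<lambda>i. if i < j then c i else 0)" by (rule w_cong) simp
  also have "\<dots> \<in> G" by (rule w_in_G) (simp add: c)
  finally show ?thesis .
qed

text \<open>Near the spanning path every direction of \<open>G\<close> is a combination of the \<open>w j b\<close>. The
  coefficients come from the fixed point \<open>v = Z - \<Sum>j. \<phi> j v (w j b - w j s)\<close>, whose iteration
  is a contraction on a small box.\<close>
lemma coefficients:
  assumes WG: "W n s = G" and s: "\<And>i. s i \<ge> 0"
  obtains \<rho> K and c :: "complex^'n^'n \<Rightarrow> nat \<Rightarrow> (nat \<Rightarrow> real) \<Rightarrow> real"
  where "\<rho> > 0" "K \<ge> 0"
    "\<And>Z b. Z \<in> G \<Longrightarrow> in_box n s \<rho> b \<Longrightarrow> Z = (\<Sum>j<n. c Z j b *\<^sub>R w j b)"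
    "\<And>Z j b t t'. Z \<in> G \<Longrightarrow> j < n \<Longrightarrow> in_box n s \<rho> (b(j := t)) \<Longrightarrow> in_box n s \<rho> (b(j := t')) \<Longrightarrow>
       \<bar>c Z j (b(j := t)) - c Z j (b(j := t'))\<bar> \<le> K * norm Z * \<bar>t - t'\<bar>"
    "\<And>Z j b. Z \<in> G \<Longrightarrow> j < n \<Longrightarrow> \<bar>c Z j b\<bar> \<le> K * norm Z"
    "\<And>Z j b. \<not> in_box n s \<rho> b \<Longrightarrow> c Z j b = 0"
    "\<And>Z j. Z \<in> G \<Longrightarrow> c Z j \<in> borel_measurable (Pi\<^sub>M {..<n} (\<lambda>_. borel))"
proof -
  obtain \<phi> :: "nat \<Rightarrow> complex^'n^'n \<Rightarrow> real" where \<phi>: "\<And>j. linear (\<phi> j)"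
    "\<And>v. v \<in> G \<Longrightarrow> v = (\<Sum>j<n. \<phi> j v *\<^sub>R w j s)"
    using spanning_coordinates[OF WG] by blast
  obtain L where L: "L > 0" "\<And>j s s'. norm (w j s - w j s') \<le> L * (\<Sum>i<j. \<bar>s i - s' i\<bar>)"
    by (rule w_lipschitz) blast
  have "\<exists>P. 0 < P \<and> (\<forall>v. norm (\<phi> j v) \<le> P * norm v)" for j
    using linear_bounded_pos[OF \<phi>(1)] by metis
  then obtain P where P: "\<And>j. 0 < P j" "\<And>j v. norm (\<phi> j v) \<le> P j * norm v" by metis
  define Q where "Q = (\<Sum>j<n. P j) + 1"
  have Q: "Q \<ge> 1" "\<And>j v. j < n \<Longrightarrow> norm (\<phi> j v) \<le> Q * norm v"
  proof -
    show "Q \<ge> 1" unfolding Q_def using P(1) by (simp add: sum_nonneg less_imp_le)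
    fix j v assume "j < n"
    then have "P j \<le> Q" unfolding Q_def using P(1) member_le_sum[of j "{..<n}" P] by (auto simp: less_imp_le)
    then show "norm (\<phi> j v) \<le> Q * norm v" by (intro order_trans[OF P(2) mult_right_mono]) auto
  qed
  \<comment> \<open>\<open>\<rho>\<close> is the side of a box on which the perturbation
    \<open>D b\<close> at least halves norms: there are \<open>n\<close> summands, each affected by
    fewer than \<open>n\<close> changed durations. The added ones keep \<open>E\<close> positive
    when \<open>n = 0\<close>.\<close>
  define E where "E = (real n + 1) * (real n + 1) * Q * L"
  have E: "E > 0" unfolding E_def using Q(1) L(1) by (intro mult_pos_pos) auto
  define \<rho> where "\<rho> = 1 / (2 * E)"
  have \<rho>: "\<rho> > 0" unfolding \<rho>_def using E by simp
  define D where "D b v = (\<Sum>j<n. \<phi> j v *\<^sub>R (w j b - w j s))" for b v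
  have linD: "linear (D b)" for b
    unfolding D_def using \<phi>(1)
    by (intro linear_compose_sum) (auto intro!: linearI simp: linear_add linear_scale scaleR_left_distrib)
  have small: "norm (D b v) \<le> norm v / 2" if b: "in_box n s \<rho> b" for b v
  proof -
    have "norm (\<phi> j v *\<^sub>R (w j b - w j s)) \<le> (Q * norm v) * (L * (real n * \<rho>))" if "j < n" for j
    proof -
      have "(\<Sum>i<j. \<bar>b i - s i\<bar>) \<le> (\<Sum>i<j. \<rho>)"
      proof (rule sum_mono)
        fix i assume "i \<in> {..<j}"
        then have "s i \<le> b i" "b i \<le> s i + \<rho>" using b that unfolding in_box_def by auto
        then show "\<bar>b i - s i\<bar> \<le> \<rho>" by simp
      qed
      also have "\<dots> \<le> real n * \<rho>" using that \<rho> by simp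
      finally have "norm (w j b - w j s) \<le> L * (real n * \<rho>)"
        using L(1) by (intro order_trans[OF L(2)] mult_left_mono) auto
      then show ?thesis unfolding norm_scaleR real_norm_def[symmetric] using Q(2)[OF that, of v] Q(1) by (intro mult_mono) auto
    qed
    then have "norm (D b v) \<le> (\<Sum>j<n. (Q * norm v) * (L * (real n * \<rho>)))"
      unfolding D_def by (intro sum_norm_le) auto
    also have "\<dots> = norm v * (real n * real n * Q * L * \<rho>)" by simp
    also have "real n * real n * Q * L * \<rho> \<le> (real n + 1) * (real n + 1) * Q * L * \<rho>"
      using Q(1) L(1) \<rho> by (intro mult_right_mono mult_mono) auto
    also have "\<dots> = 1/2" unfolding \<rho>_def E_def[symmetric] using E by simp
    finally show ?thesis by (simp add: mult_left_mono)
  qed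
  have D_G: "D b v \<in> G" if b: "in_box n s \<rho> b" for b v
  proof -
    have "w j b - w j s \<in> G" if "j < n" for j
    proof (intro subspace_diff[OF subspace_G] w_in_G')
      show "0 \<le> b i" if "i < j" for i
        using b s[of i] that \<open>j < n\<close> unfolding in_box_def by (meson less_trans order_trans)
    qed (rule s)
    then show ?thesis unfolding D_def
      by (intro subspace_sum[OF subspace_G] subspace_scale[OF subspace_G]) auto
  qed
  \<comment> \<open>Besides converging to the solution, the iterates are explicitly measurable in
    \<open>b\<close>; the measurability of the coefficients is obtained from them in the
    limit.\<close>
  define it where "it Z b m = ((\<lambda>v. Z - D b v) ^^ m) 0" for Z b m
  have it_Suc: "it Z b (Suc m) = Z - D b (it Z b m)" "it Z b 0 = 0" for Z b m by (simp_all add: it_def)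
  have fixpoint: "\<exists>v. v = Z - D b v \<and> (\<lambda>m. it Z b m) \<longlonglongrightarrow> v" if b: "in_box n s \<rho> b" for Z b
  proof -
    \<comment> \<open>The identity plus a map of norm at most one half is injective, hence onto in
      finite dimension. This provides the fixed point with which the iterates are compared.\<close>
    have "inj (\<lambda>v. v + D b v)"
    proof (rule linear_injective_0[THEN iffD2, rule_format])
      show "linear (\<lambda>v. v + D b v)" using linD by (intro linear_compose_add) (auto intro: linear_id[unfolded id_def])
      fix v assume "v + D b v = 0"
      then have "norm v = norm (D b v)" by (metis add_eq_0_iff norm_minus_cancel)
      then show "v = 0" using small[OF b, of v] by simp
    qed
    then have "surj (\<lambda>v. v + D b v)"
      using linD by (intro linear_injective_imp_surjective linear_compose_add) (auto intro: linear_id[unfolded id_def])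
    then obtain v where v: "Z = v + D b v" by (metis surjD)
    have "norm (it Z b m - v) \<le> (1/2) ^ m * norm v" for m
    proof (induction m)
      case (Suc m)
      have "it Z b (Suc m) - v = D b (v - it Z b m)" using v by (simp add: it_Suc linear_diff[OF linD])
      then have "norm (it Z b (Suc m) - v) \<le> norm (it Z b m - v) / 2"
        using small[OF b, of "v - it Z b m"] by (simp add: norm_minus_commute)
      then show ?case using Suc by simp
    qed (simp add: it_Suc)
    moreover have "(\<lambda>m. (1/2) ^ m * norm v) \<longlonglongrightarrow> 0"
      by (intro tendsto_mult_left_zero LIMSEQ_power_zero) simp
    ultimately have "(\<lambda>m. it Z b m - v) \<longlonglongrightarrow> 0"
      by (rule Lim_null_comparison[OF always_eventually[OF allI]])
    then have "(\<lambda>m. it Z b m) \<longlonglongrightarrow> v" by (rule LIM_zero_cancel)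
    moreover have "v = Z - D b v" using v by simp
    ultimately show ?thesis by blast
  qed
  define vv where "vv Z b = lim (\<lambda>m. it Z b m)" for Z b
  have vv: "vv Z b = Z - D b (vv Z b)" "(\<lambda>m. it Z b m) \<longlonglongrightarrow> vv Z b" if b: "in_box n s \<rho> b" for Z b
  proof -
    obtain v where v: "v = Z - D b v" "(\<lambda>m. it Z b m) \<longlonglongrightarrow> v" using fixpoint[OF b, of Z] by blast
    then have "vv Z b = v" unfolding vv_def by (intro limI)
    then show "vv Z b = Z - D b (vv Z b)" "(\<lambda>m. it Z b m) \<longlonglongrightarrow> vv Z b" using v by auto
  qed
  \<comment> \<open>The expansion by \<open>\<phi>\<close> is valid on \<open>G\<close> only, so the
    solution must not leave it. Here the nonnegativity of the durations in the box enters, through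
    \<open>D_G\<close>.\<close>
  have vv_G: "vv Z b \<in> G" if b: "in_box n s \<rho> b" and Z: "Z \<in> G" for Z b
    by (subst vv(1)[OF b, of Z]) (intro subspace_diff[OF subspace_G] D_G[OF b] Z)
  have vv_norm: "norm (vv Z b) \<le> 2 * norm Z" if b: "in_box n s \<rho> b" for Z b
  proof -
    have "norm (vv Z b) \<le> norm Z + norm (D b (vv Z b))"
      by (subst vv(1)[OF b, of Z]) (rule norm_triangle_ineq4)
    then show ?thesis using small[OF b, of "vv Z b"] by simp
  qed
  define c where "c Z j b = (if in_box n s \<rho> b then \<phi> j (vv Z b) else 0)" for Z j b
  \<comment> \<open>The first summand is the Lipschitz constant in a single duration, the second
    bounds the size of the coefficients.\<close>
  define K where "K = Q * (4 * (real n * Q * L)) + 2 * Q"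
  show ?thesis
  proof (rule that[of \<rho> K c])
    show "\<rho> > 0" by fact
    show "K \<ge> 0" unfolding K_def using Q(1) L(1) by simp
    show "Z = (\<Sum>j<n. c Z j b *\<^sub>R w j b)" if "Z \<in> G" "in_box n s \<rho> b" for Z b
    proof -
      have "Z = vv Z b + D b (vv Z b)" using vv(1)[OF that(2), of Z] by (simp add: algebra_simps)
      also have "\<dots> = (\<Sum>j<n. \<phi> j (vv Z b) *\<^sub>R w j s) + D b (vv Z b)" using \<phi>(2)[OF vv_G[OF that(2,1)]] by simp
      also have "\<dots> = (\<Sum>j<n. c Z j b *\<^sub>R w j b)"
        unfolding D_def sum.distrib[symmetric] using that(2) by (simp add: c_def scaleR_diff_right)
      finally show ?thesis .
    qed
    show "\<bar>c Z j b\<bar> \<le> K * norm Z" if "Z \<in> G" "j < n" for Z j b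
    proof (cases "in_box n s \<rho> b")
      case True
      have "\<bar>c Z j b\<bar> \<le> Q * (2 * norm Z)"
        using Q(2)[OF that(2), of "vv Z b"] order_trans[OF _ mult_left_mono[OF vv_norm[OF True, of Z], of Q]] Q(1) True
        by (simp add: c_def)
      also have "\<dots> \<le> K * norm Z" unfolding K_def using Q(1) L(1) by (simp add: algebra_simps)
      finally show ?thesis .
    next
      case False
      then show ?thesis unfolding c_def K_def using Q(1) L(1) by simp
    qed
    show "c Z j b = 0" if "\<not> in_box n s \<rho> b" for Z j b using that by (simp add: c_def)
    show "\<bar>c Z j (b(j := t)) - c Z j (b(j := t'))\<bar> \<le> K * norm Z * \<bar>t - t'\<bar>"
      if Z: "Z \<in> G" "j < n" "in_box n s \<rho> (b(j := t))" "in_box n s \<rho> (b(j := t'))" for Z j b t t'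
    proof -
      let ?b = "b(j := t)" and ?b' = "b(j := t')"
      let ?v = "vv Z ?b" and ?v' = "vv Z ?b'"
      have "norm (\<phi> i ?v' *\<^sub>R (w i ?b - w i ?b')) \<le> (Q * (2 * norm Z)) * (L * \<bar>t - t'\<bar>)" if "i < n" for i
      proof -
        \<comment> \<open>The two points differ in the coordinate \<open>j\<close> only, so at most
          one summand survives.\<close>
        have "(\<Sum>k<i. \<bar>?b k - ?b' k\<bar>) \<le> (\<Sum>k\<in>{j}. \<bar>?b k - ?b' k\<bar>)"
        proof (cases "j < i")
          case True
          then show ?thesis by - (rule eq_refl, intro sum.mono_neutral_right, auto)
        next
          case False
          then have "(\<Sum>k<i. \<bar>?b k - ?b' k\<bar>) = 0" by (intro sum.neutral) auto
          then show ?thesis by simp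
        qed
        then have "norm (w i ?b - w i ?b') \<le> L * \<bar>t - t'\<bar>"
          using L(1) by (intro order_trans[OF L(2)] mult_left_mono) auto
        moreover have "norm (\<phi> i ?v') \<le> Q * (2 * norm Z)"
          using Q(1) by (intro order_trans[OF Q(2)[OF that] mult_left_mono] vv_norm Z) auto
        ultimately show ?thesis unfolding norm_scaleR real_norm_def[symmetric] using Q(1) by (intro mult_mono) auto
      qed
      then have d: "norm (\<Sum>i<n. \<phi> i ?v' *\<^sub>R (w i ?b - w i ?b')) \<le> (\<Sum>i<n. (Q * (2 * norm Z)) * (L * \<bar>t - t'\<bar>))"
        by (intro sum_norm_le) auto
      have "(\<Sum>i<n. \<phi> i ?v' *\<^sub>R (w i ?b - w i ?b')) = D ?b ?v' - D ?b' ?v'"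
        unfolding D_def sum_subtractf[symmetric] by (simp add: scaleR_diff_right)
      \<comment> \<open>Subtracting the fixed point equations separates the contraction acting on
        the difference from the change of the operator. Absorbing the former on the left doubles the
        constant.\<close>
      moreover have "?v - ?v' = - D ?b (?v - ?v') - (D ?b ?v' - D ?b' ?v')"
        unfolding linear_diff[OF linD] using vv(1)[OF Z(3), of Z] vv(1)[OF Z(4), of Z] by (simp add: algebra_simps)
      then have "norm (?v - ?v') \<le> norm (D ?b (?v - ?v')) + norm (D ?b ?v' - D ?b' ?v')"
        by (metis norm_minus_cancel norm_triangle_ineq4)
      ultimately have "norm (?v - ?v') \<le> norm (?v - ?v') / 2 + real n * ((Q * (2 * norm Z)) * (L * \<bar>t - t'\<bar>))"
        using small[OF Z(3), of "?v - ?v'"] d by simp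
      then have nv: "norm (?v - ?v') \<le> (4 * (real n * Q * L)) * norm Z * \<bar>t - t'\<bar>" by (simp add: algebra_simps)
      have "\<bar>c Z j ?b - c Z j ?b'\<bar> = norm (\<phi> j (?v - ?v'))"
        using Z by (simp add: c_def linear_diff[OF \<phi>(1)])
      also have "\<dots> \<le> Q * norm (?v - ?v')" using Q(2) Z by blast
      also have "\<dots> \<le> Q * ((4 * (real n * Q * L)) * norm Z * \<bar>t - t'\<bar>)" using nv Q(1) by (intro mult_left_mono) auto
      also have "\<dots> \<le> K * norm Z * \<bar>t - t'\<bar>" unfolding K_def using Q(1) L(1) by (simp add: algebra_simps)
      finally show ?thesis .
    qed
    show "c Z j \<in> borel_measurable (Pi\<^sub>M {..<n} (\<lambda>_. borel))" if "Z \<in> G" for Z j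
    proof -
      let ?N = "Pi\<^sub>M {..<n} (\<lambda>_. borel :: real measure)"
      have mphi[measurable]: "\<phi> k \<in> borel_measurable borel" for k
        using \<phi>(1) linear_conv_bounded_linear linear_continuous_on borel_measurable_continuous_onI by blast
      have mw: "(\<lambda>b. w k b) \<in> borel_measurable ?N" if "k < n" for k
        using that by (intro measurable_w[where s="\<lambda>b. b"] measurable_component_singleton) auto
      have mit: "(\<lambda>b. it Z b m) \<in> borel_measurable ?N" for m
      proof (induction m)
        case (Suc m)
        note [measurable] = Suc
        have "(\<lambda>b. \<phi> k (it Z b m) *\<^sub>R (w k b - w k s)) \<in> borel_measurable ?N" if "k < n" for k
        proof -
          note [measurable] = mw[OF that]
          show ?thesis by measurable
        qed
        then show ?case unfolding it_Suc D_def by (intro borel_measurable_diff borel_measurable_sum) auto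
      qed (simp add: it_Suc)
      have [measurable]: "(\<lambda>b. \<phi> j (it Z b m)) \<in> borel_measurable ?N" for m
        using measurable_compose[OF mit mphi] .
      have [measurable]: "Measurable.pred ?N (in_box n s \<rho>)"
      proof -
        have "in_box n s \<rho> = (\<lambda>b. \<forall>j\<in>{..<n}. s j \<le> b j \<and> b j \<le> s j + \<rho>)"
          by (auto simp: in_box_def fun_eq_iff)
        moreover have "Measurable.pred ?N (\<lambda>b. \<forall>j\<in>{..<n}. s j \<le> b j \<and> b j \<le> s j + \<rho>)"
        proof (rule pred_intros_finite(3)[rotated])
          fix j assume "j \<in> {..<n}"
          then have [measurable]: "(\<lambda>b. b j) \<in> borel_measurable ?N" by (rule measurable_component_singleton)
          show "Measurable.pred ?N (\<lambda>b. s j \<le> b j \<and> b j \<le> s j + \<rho>)" by measurable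
        qed simp
        ultimately show ?thesis by simp
      qed
      have "(\<lambda>b. if in_box n s \<rho> b then \<phi> j (it Z b m) else 0) \<in> borel_measurable ?N" for m
        by measurable
      then show ?thesis
      proof (rule borel_measurable_LIMSEQ_metric)
        fix b
        have "isCont (\<phi> j) (vv Z b)" using \<phi>(1) linear_continuous_at linear_conv_bounded_linear by blast
        then show "(\<lambda>m. if in_box n s \<rho> b then \<phi> j (it Z b m) else 0) \<longlonglongrightarrow> c Z j b"
          unfolding c_def using isCont_tendsto_compose[OF _ vv(2)] by auto
      qed
    qed
  qed
qed

end

section \<open>Tent-weighted measures on durations\<close>

lemma finite_measure_PiM:
  assumes "finite I" "\<And>i. finite_measure (M i)"
  shows "finite_measure (Pi\<^sub>M I M)"
proof -
  interpret product_sigma_finite M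
    using assms(2) by (intro product_sigma_finite.intro finite_measure.axioms(1))
  have "emeasure (Pi\<^sub>M I M) (\<Pi>\<^sub>E i\<in>I. space (M i)) = (\<Prod>i\<in>I. emeasure (M i) (space (M i)))"
    by (intro emeasure_PiM assms(1)) auto
  also have "\<dots> < \<top>"
    using assms(1)
  proof (induction I)
    case (insert i I)
    then show ?case
      using finite_measure.emeasure_finite[OF assms(2)[of i], of "space (M i)"]
      by (simp add: ennreal_mult_less_top less_top)
  qed simp
  finally show ?thesis by (intro finite_measureI) (simp add: space_PiM less_top)
qed

lemma (in finite_measure) abs_integral_le:
  fixes g :: "'a \<Rightarrow> real"
  assumes "\<And>x. x \<in> space M \<Longrightarrow> \<bar>g x\<bar> \<le> C" "C \<ge> 0"
  shows "\<bar>\<integral>x. g x \<partial>M\<bar> \<le> C * measure M (space M)"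
proof (cases "integrable M g")
  case True
  have "\<bar>\<integral>x. g x \<partial>M\<bar> \<le> (\<integral>x. \<bar>g x\<bar> \<partial>M)" by (rule integral_abs_bound)
  also have "\<dots> \<le> (\<integral>x. C \<partial>M)" using True assms(1) by (intro integral_mono) auto
  finally show ?thesis by (simp add: mult.commute)
next
  case False
  then show ?thesis using assms(2) by (simp add: not_integrable_integral_eq)
qed

lemma smooth1_chain:
  assumes "smooth1 f Df" "(g has_vector_derivative g') (at t)"
  shows "((\<lambda>t. f (g t)) has_real_derivative Df (g t) g') (at t)"
proof -
  have f: "(f has_derivative Df (g t)) (at (g t))" using assms(1) by (auto simp: smooth1_def)
  then interpret bounded_linear "Df (g t)" by (rule has_derivative_bounded_linear)
  have "((\<lambda>t. f (g t)) has_derivative (\<lambda>h. Df (g t) (h *\<^sub>R g'))) (at t)"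
    using assms(2) f unfolding has_vector_derivative_def by (rule has_derivative_compose)
  then show ?thesis unfolding has_field_derivative_def by (simp add: scaleR mult.commute[of _ "Df (g t) g'"])
qed

lemma smooth1_bound:
  assumes "smooth1 f Df" "compact X" "compact Y"
  obtains L where "L > 0" "\<And>x v. x \<in> X \<Longrightarrow> v \<in> Y \<Longrightarrow> \<bar>Df x v\<bar> \<le> L"
proof -
  have "compact ((\<lambda>(x, v). Df x v) ` (X \<times> Y))"
    using assms by (intro compact_continuous_image compact_Times) (auto simp: smooth1_def intro: continuous_on_subset)
  then have "bounded ((\<lambda>(x, v). Df x v) ` (X \<times> Y))" by (rule compact_imp_bounded)
  then obtain L where "L > 0" "\<forall>y\<in>(\<lambda>(x, v). Df x v) ` (X \<times> Y). norm y \<le> L" unfolding bounded_pos by blast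
  then show ?thesis using that[of L] by auto
qed

text \<open>Slope at most one and zeros at both ends are what integration by parts asks for. No
  normalization is imposed, so the measures built from it are finite but in general not probability
  measures.\<close>

definition tent :: "real \<Rightarrow> real \<Rightarrow> real \<Rightarrow> real" where
  "tent a \<rho> t = max 0 (min (t - a) (a + \<rho> - t))"

lemma tent_simps:
  "tent a \<rho> t \<ge> 0" "\<rho> \<ge> 0 \<Longrightarrow> tent a \<rho> t \<le> \<rho>" "\<bar>tent a \<rho> s - tent a \<rho> t\<bar> \<le> \<bar>s - t\<bar>"
  "t \<notin> {a..a + \<rho>} \<Longrightarrow> tent a \<rho> t = 0" "t \<in> {a<..<a + \<rho>} \<Longrightarrow> tent a \<rho> t > 0"
  by (auto simp: tent_def max_def min_def)

lemma tent_measurable [measurable]: "tent a \<rho> \<in> borel_measurable borel"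
  unfolding tent_def by measurable

definition tent_density :: "real \<Rightarrow> real \<Rightarrow> real measure" where
  "tent_density a \<rho> = density lborel (\<lambda>t. ennreal (tent a \<rho> t))"

lemma sets_tent_density [measurable_cong, simp]: "sets (tent_density a \<rho>) = sets borel"
  by (simp add: tent_density_def)

lemma space_tent_density [simp]: "space (tent_density a \<rho>) = UNIV"
  by (simp add: tent_density_def)

lemma finite_tent_density: "\<rho> \<ge> 0 \<Longrightarrow> finite_measure (tent_density a \<rho>)"
proof (intro finite_measureI)
  assume r: "\<rho> \<ge> 0"
  have "emeasure (tent_density a \<rho>) (space (tent_density a \<rho>)) = (\<integral>\<^sup>+ t. ennreal (tent a \<rho> t) \<partial>lborel)"
    by (simp add: tent_density_def emeasure_density)
  also have "\<dots> \<le> (\<integral>\<^sup>+ t. ennreal \<rho> * indicator {a..a + \<rho>} t \<partial>lborel)"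
    using tent_simps(2)[OF r, of a] tent_simps(4)[of _ a \<rho>]
    by (intro nn_integral_mono) (auto simp: indicator_def intro!: ennreal_leI)
  also have "\<dots> = ennreal \<rho> * ennreal \<rho>" using r by (subst nn_integral_cmult_indicator) auto
  also have "\<dots> < \<top>" by (simp add: ennreal_mult_less_top)
  finally show "emeasure (tent_density a \<rho>) (space (tent_density a \<rho>)) \<noteq> \<infinity>" by simp
qed

definition tent_measure :: "nat \<Rightarrow> (nat \<Rightarrow> real) \<Rightarrow> real \<Rightarrow> (nat \<Rightarrow> real) measure" where
  "tent_measure n s \<rho> = Pi\<^sub>M {..<n} (\<lambda>j. tent_density (s j) \<rho>)"

lemma sets_tent_measure [measurable_cong]: "sets (tent_measure n s \<rho>) = sets (Pi\<^sub>M {..<n} (\<lambda>_. borel))"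
  unfolding tent_measure_def by (intro sets_PiM_cong) auto

lemma finite_tent_measure: "\<rho> \<ge> 0 \<Longrightarrow> finite_measure (tent_measure n s \<rho>)"
  unfolding tent_measure_def by (intro finite_measure_PiM finite_tent_density) auto

lemma integral_tent_density:
  assumes "g \<in> borel_measurable borel"
  shows "(\<integral>t. g t \<partial>tent_density a \<rho>) = (\<integral>t. tent a \<rho> t * g t \<partial>lborel)"
  unfolding tent_density_def using assms tent_simps(1)
  by (subst integral_density) auto

lemma AE_tent_density: "AE t in tent_density a \<rho>. a \<le> t \<and> t \<le> a + \<rho>"
proof -
  have "0 < tent a \<rho> t \<Longrightarrow> a \<le> t \<and> t \<le> a + \<rho>" for t by (auto simp: tent_def max_def min_def split: if_splits)
  then show ?thesis unfolding tent_density_def by (subst AE_density) auto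
qed

text \<open>Composition with the projection \<open>p\<close> onto the interval changes no value,
  since \<open>g\<close> vanishes at the end points as well as outside, and the projection does not
  increase distances.\<close>

lemma lipschitz_clamp:
  fixes g :: "real \<Rightarrow> real"
  assumes "\<alpha> \<le> \<beta>" "\<And>s t. s \<in> {\<alpha>..\<beta>} \<Longrightarrow> t \<in> {\<alpha>..\<beta>} \<Longrightarrow> \<bar>g s - g t\<bar> \<le> K * \<bar>s - t\<bar>"
    "\<And>t. t \<notin> {\<alpha><..<\<beta>} \<Longrightarrow> g t = 0" "K \<ge> 0"
  shows "\<bar>g s - g t\<bar> \<le> K * \<bar>s - t\<bar>"
proof -
  define p where "p t = max \<alpha> (min \<beta> t)" for t
  have p: "p t \<in> {\<alpha>..\<beta>}" "g t = g (p t)" for t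
  proof -
    show "p t \<in> {\<alpha>..\<beta>}" using assms(1) by (simp add: p_def)
    show "g t = g (p t)"
    proof (cases "t \<in> {\<alpha><..<\<beta>}")
      case True
      then show ?thesis by (simp add: p_def)
    next
      case False
      then have "p t \<notin> {\<alpha><..<\<beta>}" using assms(1) by (auto simp: p_def max_def min_def)
      then show ?thesis using assms(3) False by metis
    qed
  qed
  have "\<bar>g s - g t\<bar> \<le> K * \<bar>p s - p t\<bar>" using p assms(2) by metis
  also have "\<dots> \<le> K * \<bar>s - t\<bar>" using assms(4) by (intro mult_left_mono) (auto simp: p_def max_def min_def)
  finally show ?thesis .
qed

context hermitian_pair begin

lemma measurable_J_PiM [measurable]:
  "{..<n} \<subseteq> I \<Longrightarrow> (\<lambda>b. J b n) \<in> borel_measurable (Pi\<^sub>M I (\<lambda>_. borel))"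
  by (rule measurable_J(1)[where s="\<lambda>b. b"]) (auto intro: measurable_component_singleton)

lemma measurable_w_PiM [measurable]:
  "{..<n} \<subseteq> I \<Longrightarrow> (\<lambda>b. w n b) \<in> borel_measurable (Pi\<^sub>M I (\<lambda>_. borel))"
  by (rule measurable_w[where s="\<lambda>b. b"]) (auto intro: measurable_component_singleton)

text \<open>With the other durations frozen, \<open>w j b\<close> is constant in the duration
  \<open>j\<close>, and the integrand is a weight times a total derivative. The tent removes the
  boundary terms of a coefficient that is cut off at the edge of the box. The test function enters
  the bound only through its supremum on the sphere.\<close>

lemma integration_by_parts_bound:
  assumes j: "j < n" and \<rho>: "\<rho> > 0" and K: "K \<ge> 0"
    and c_meas: "c \<in> borel_measurable (Pi\<^sub>M {..<n} (\<lambda>_. borel))"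
    and c_bound: "\<And>b. \<bar>c b\<bar> \<le> K"
    and c_zero: "\<And>b. \<not> in_box n s \<rho> b \<Longrightarrow> c b = 0"
    and c_lip: "\<And>b t t'. in_box n s \<rho> (b(j := t)) \<Longrightarrow> in_box n s \<rho> (b(j := t')) \<Longrightarrow>
       \<bar>c (b(j := t)) - c (b(j := t'))\<bar> \<le> K * \<bar>t - t'\<bar>"
    and f: "smooth1 f Df" and f1: "\<And>x. norm x = 1 \<Longrightarrow> \<bar>f x\<bar> \<le> 1" and x: "norm x = 1"
  shows "\<bar>\<integral>b. c b * Df (J b n *v x) (J b n *v (w j b *v x)) \<partial>tent_measure n s \<rho>\<bar>
      \<le> (K + \<rho> * K) * \<rho> * measure (Pi\<^sub>M ({..<n} - {j}) (\<lambda>j. tent_density (s j) \<rho>))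
            (space (Pi\<^sub>M ({..<n} - {j}) (\<lambda>j. tent_density (s j) \<rho>)))"
    and "integrable (tent_measure n s \<rho>) (\<lambda>b. c b * Df (J b n *v x) (J b n *v (w j b *v x)))"
proof -
  let ?I = "{..<n} - {j}"
  let ?g = "\<lambda>b. c b * Df (J b n *v x) (J b n *v (w j b *v x))"
  interpret product_sigma_finite "\<lambda>j. tent_density (s j) \<rho>"
    using finite_tent_density \<rho> by (intro product_sigma_finite.intro finite_measure.axioms(1)) auto
  interpret N: finite_measure "tent_measure n s \<rho>" using finite_tent_measure \<rho> by simp
  interpret N': finite_measure "Pi\<^sub>M ?I (\<lambda>j. tent_density (s j) \<rho>)"
    using finite_tent_density \<rho> by (intro finite_measure_PiM) auto
  obtain a where a: "a > 0" "\<And>k x. norm (A k *v x) \<le> a * norm x" by (rule A_bound) blast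
  have wb: "norm (w j b *v x) \<le> a" for b
    using a(2)[of j "J b j *v x"] x unfolding w_def by (simp add: matrix_vector_mul_assoc[symmetric])
  obtain L where L: "L > 0" "\<And>x v. x \<in> sphere 0 1 \<Longrightarrow> v \<in> cball 0 a \<Longrightarrow> \<bar>Df x v\<bar> \<le> L"
    using smooth1_bound[OF f, of "sphere 0 1" "cball 0 a"] by auto
  have Db: "\<bar>Df (J b n *v x) (J b n *v (w j b' *v x))\<bar> \<le> L" for b b'
    using wb x by (intro L(2)) auto
  have [measurable]: "c \<in> borel_measurable (Pi\<^sub>M {..<n} (\<lambda>_. borel))" by (rule c_meas)
  have mw[measurable]: "(\<lambda>b. w j b) \<in> borel_measurable (Pi\<^sub>M {..<n} (\<lambda>_. borel))"
    using j by (intro measurable_w_PiM) auto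
  have mD: "(\<lambda>b. Df (J b n *v x) (J b n *v (w j b *v x))) \<in> borel_measurable (Pi\<^sub>M {..<n} (\<lambda>_. borel))"
  proof (rule borel_measurable_continuous_Pair[where H=Df])
    show "continuous_on UNIV (\<lambda>p. Df (fst p) (snd p))" using f by (simp add: smooth1_def case_prod_unfold)
    show "(\<lambda>b. J b n *v x) \<in> borel_measurable (Pi\<^sub>M {..<n} (\<lambda>_. borel))" by measurable
    show "(\<lambda>b. J b n *v (w j b *v x)) \<in> borel_measurable (Pi\<^sub>M {..<n} (\<lambda>_. borel))" by measurable
  qed
  then have mg: "?g \<in> borel_measurable (Pi\<^sub>M {..<n} (\<lambda>_. borel))" by measurable
  then have mg': "?g \<in> borel_measurable (tent_measure n s \<rho>)" by (simp cong: measurable_cong_sets add: sets_tent_measure)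
  have gb: "\<bar>?g b\<bar> \<le> K * L" for b
    unfolding abs_mult using Db c_bound K by (intro mult_mono) auto
  show int: "integrable (tent_measure n s \<rho>) ?g"
    by (rule N.integrable_const_bound[of _ "K * L"]) (use gb mg' in auto)
  have ins: "insert j ?I = {..<n}" using j by auto
  have "(\<integral>b. ?g b \<partial>tent_measure n s \<rho>)
     = (\<integral>b. (\<integral>t. ?g (b(j := t)) \<partial>tent_density (s j) \<rho>) \<partial>Pi\<^sub>M ?I (\<lambda>j. tent_density (s j) \<rho>))"
    using product_integral_insert[of ?I j ?g] int unfolding tent_measure_def ins by simp
  also have "\<bar>\<dots>\<bar> \<le> ((K + \<rho> * K) * \<rho>) * measure (Pi\<^sub>M ?I (\<lambda>j. tent_density (s j) \<rho>))
            (space (Pi\<^sub>M ?I (\<lambda>j. tent_density (s j) \<rho>)))"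
  proof (rule N'.abs_integral_le)
    show "0 \<le> (K + \<rho> * K) * \<rho>" using K \<rho> by simp
    fix b assume b: "b \<in> space (Pi\<^sub>M ?I (\<lambda>j. tent_density (s j) \<rho>))"
    have "(\<lambda>t. b(j := t)) \<in> measurable borel (Pi\<^sub>M (insert j ?I) (\<lambda>_. borel))"
      using b by (intro measurable_component_update) (auto simp: space_PiM)
    then have upd: "(\<lambda>t. b(j := t)) \<in> measurable borel (Pi\<^sub>M {..<n} (\<lambda>_. borel))" by (simp only: ins)
    have "(\<integral>t. ?g (b(j := t)) \<partial>tent_density (s j) \<rho>) = (\<integral>t. tent (s j) \<rho> t * ?g (b(j := t)) \<partial>lborel)"
      using measurable_compose[OF upd mg] by (intro integral_tent_density) simp
    also have "\<dots> = (\<integral>t. (tent (s j) \<rho> t * c (b(j := t))) * Df (J (b(j := t)) n *v x) (J (b(j := t)) n *v (w j b *v x)) \<partial>lborel)"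
      using w_cong[of j "b(j := _)" b] by (simp add: mult.assoc)
    \<comment> \<open>Product rule for the weight: \<open>K\<close> comes from the tent of slope one
      times the coefficient, \<open>\<rho> * K\<close> from the tent times the variation of the
      coefficient.\<close>
    also have "\<bar>\<dots>\<bar> \<le> (K + \<rho> * K) * ((s j + \<rho>) - s j)"
    proof (rule integral_lipschitz_deriv[where F="\<lambda>t. f (J (b(j := t)) n *v x)" and L=L])
      show "\<bar>f (J (b(j := t)) n *v x)\<bar> \<le> 1" for t using f1 x by simp
      show "\<bar>Df (J (b(j := t)) n *v x) (J (b(j := t)) n *v (w j b *v x))\<bar> \<le> L" for t by (rule Db)
      show "((\<lambda>t. f (J (b(j := t)) n *v x)) has_real_derivative Df (J (b(j := t)) n *v x) (J (b(j := t)) n *v (w j b *v x))) (at t)" for t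
        by (intro smooth1_chain[OF f] J_deriv j)
      show "tent (s j) \<rho> t * c (b(j := t)) = 0" if "t \<notin> {s j..s j + \<rho>}" for t
        using that by (simp add: tent_simps)
      show "\<bar>tent (s j) \<rho> t * c (b(j := t)) - tent (s j) \<rho> t' * c (b(j := t'))\<bar> \<le> (K + \<rho> * K) * \<bar>t - t'\<bar>" for t t'
      proof (rule lipschitz_clamp[of "s j" "s j + \<rho>"])
        fix t t' assume t: "t \<in> {s j..s j + \<rho>}" "t' \<in> {s j..s j + \<rho>}"
        show "\<bar>tent (s j) \<rho> t * c (b(j := t)) - tent (s j) \<rho> t' * c (b(j := t'))\<bar> \<le> (K + \<rho> * K) * \<bar>t - t'\<bar>"
        proof (cases "\<forall>i<n. i \<noteq> j \<longrightarrow> s i \<le> b i \<and> b i \<le> s i + \<rho>")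
          case True
          then have box: "in_box n s \<rho> (b(j := t))" "in_box n s \<rho> (b(j := t'))"
            using t by (auto simp: in_box_def)
          have "tent (s j) \<rho> t * c (b(j := t)) - tent (s j) \<rho> t' * c (b(j := t'))
             = (tent (s j) \<rho> t - tent (s j) \<rho> t') * c (b(j := t)) + tent (s j) \<rho> t' * (c (b(j := t)) - c (b(j := t')))"
            by (simp add: algebra_simps)
          also have "\<bar>\<dots>\<bar> \<le> \<bar>t - t'\<bar> * K + \<rho> * (K * \<bar>t - t'\<bar>)"
          proof (rule order_trans[OF abs_triangle_ineq add_mono])
            show "\<bar>(tent (s j) \<rho> t - tent (s j) \<rho> t') * c (b(j := t))\<bar> \<le> \<bar>t - t'\<bar> * K"
              unfolding abs_mult by (intro mult_mono tent_simps c_bound) auto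
            show "\<bar>tent (s j) \<rho> t' * (c (b(j := t)) - c (b(j := t')))\<bar> \<le> \<rho> * (K * \<bar>t - t'\<bar>)"
              unfolding abs_mult using tent_simps(1)[of "s j" \<rho> t'] tent_simps(2)[of "\<rho>" "s j" t'] \<rho> K
              by (intro mult_mono c_lip box) auto
          qed
          finally show ?thesis by (simp add: algebra_simps)
        next
          case False
          then have "\<not> in_box n s \<rho> (b(j := u))" for u unfolding in_box_def by (metis fun_upd_other)
          then have "c (b(j := t)) = 0" "c (b(j := t')) = 0" by (auto intro: c_zero)
          then show ?thesis using K \<rho> by simp
        qed
      qed (use \<rho> K in \<open>auto simp: tent_def max_def min_def\<close>)
    qed (use \<rho> K in auto)
    finally show "\<bar>\<integral>t. ?g (b(j := t)) \<partial>tent_density (s j) \<rho>\<bar> \<le> (K + \<rho> * K) * \<rho>" by simp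
  qed
  finally show "\<bar>\<integral>b. ?g b \<partial>tent_measure n s \<rho>\<bar>
      \<le> (K + \<rho> * K) * \<rho> * measure (Pi\<^sub>M ({..<n} - {j}) (\<lambda>j. tent_density (s j) \<rho>))
            (space (Pi\<^sub>M ({..<n} - {j}) (\<lambda>j. tent_density (s j) \<rho>)))" by simp
qed

end

lemma AE_tent_measure:
  assumes \<rho>: "\<rho> > 0"
  shows "AE b in tent_measure n s \<rho>. in_box n s \<rho> b"
proof -
  interpret product_sigma_finite "\<lambda>j. tent_density (s j) \<rho>"
    using finite_tent_density \<rho> by (intro product_sigma_finite.intro finite_measure.axioms(1)) auto
  have "AE b in tent_measure n s \<rho>. s j \<le> b j \<and> b j \<le> s j + \<rho>" if "j < n" for j
  proof -
    let ?B = "{t. \<not> (s j \<le> t \<and> t \<le> s j + \<rho>)}"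
    have B: "?B \<in> sets borel" by measurable
    have B0: "emeasure (tent_density (s j) \<rho>) ?B = 0"
      using AE_iff_measurable[of ?B "tent_density (s j) \<rho>" "\<lambda>t. s j \<le> t \<and> t \<le> s j + \<rho>"] AE_tent_density[of "s j" \<rho>] B
      by simp
    let ?P = "\<Pi>\<^sub>E i\<in>{..<n}. if i = j then ?B else UNIV"
    have "emeasure (tent_measure n s \<rho>) ?P = (\<Prod>i<n. emeasure (tent_density (s i) \<rho>) (if i = j then ?B else UNIV))"
      unfolding tent_measure_def using B by (intro emeasure_PiM) auto
    also have "\<dots> = 0" using that B0 by (intro prod_zero) auto
    finally have "?P \<in> null_sets (tent_measure n s \<rho>)"
      unfolding tent_measure_def using B by (intro null_setsI sets_PiM_I_finite) auto
    moreover have "{b \<in> space (tent_measure n s \<rho>). \<not> (s j \<le> b j \<and> b j \<le> s j + \<rho>)} \<subseteq> ?P"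
      by (auto simp: tent_measure_def space_PiM PiE_iff extensional_def)
    ultimately show ?thesis by (rule AE_I')
  qed
  then have "AE b in tent_measure n s \<rho>. \<forall>j\<in>{..<n}. s j \<le> b j \<and> b j \<le> s j + \<rho>"
    by (intro AE_finite_allI) auto
  then show ?thesis by (simp only: in_box_def Ball_def lessThan_iff)
qed

section \<open>Total variation bounds for smeared laws\<close>

context hermitian_pair begin

text \<open>Almost everywhere \<open>Z\<close> is a combination of the directions
  \<open>w j b\<close>, so its action is a sum of weighted derivatives in the durations, each
  integrated by parts. Since \<open>C\<close> does not depend on \<open>f\<close>, it bounds the
  speed in total variation at which the smeared law reacts to a motion along
  \<open>G\<close>.\<close>

lemma directional_bound:
  assumes WG: "W n s = G" and s: "\<And>i. s i \<ge> 0"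
  obtains \<rho> C where "\<rho> > 0" "C \<ge> 0"
    "\<And>f Df Z x. smooth1 f Df \<Longrightarrow> (\<And>x. norm x = 1 \<Longrightarrow> \<bar>f x\<bar> \<le> 1) \<Longrightarrow> Z \<in> G \<Longrightarrow> norm x = 1 \<Longrightarrow>
       \<bar>\<integral>b. Df (J b n *v x) (J b n *v (Z *v x)) \<partial>tent_measure n s \<rho>\<bar> \<le> C * norm Z"
proof -
  obtain \<rho> K and c :: "complex^'n^'n \<Rightarrow> nat \<Rightarrow> (nat \<Rightarrow> real) \<Rightarrow> real" where
    \<rho>: "\<rho> > 0" and K: "K \<ge> 0" and
    c: "\<And>Z b. Z \<in> G \<Longrightarrow> in_box n s \<rho> b \<Longrightarrow> Z = (\<Sum>j<n. c Z j b *\<^sub>R w j b)"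
    "\<And>Z j b t t'. Z \<in> G \<Longrightarrow> j < n \<Longrightarrow> in_box n s \<rho> (b(j := t)) \<Longrightarrow> in_box n s \<rho> (b(j := t')) \<Longrightarrow>
       \<bar>c Z j (b(j := t)) - c Z j (b(j := t'))\<bar> \<le> K * norm Z * \<bar>t - t'\<bar>"
    "\<And>Z j b. Z \<in> G \<Longrightarrow> j < n \<Longrightarrow> \<bar>c Z j b\<bar> \<le> K * norm Z"
    "\<And>Z j b. \<not> in_box n s \<rho> b \<Longrightarrow> c Z j b = 0"
    "\<And>Z j. Z \<in> G \<Longrightarrow> c Z j \<in> borel_measurable (Pi\<^sub>M {..<n} (\<lambda>_. borel))"
    by (rule coefficients[OF WG s]) blast
  define m where "m j = measure (Pi\<^sub>M ({..<n} - {j}) (\<lambda>j. tent_density (s j) \<rho>))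
            (space (Pi\<^sub>M ({..<n} - {j}) (\<lambda>j. tent_density (s j) \<rho>)))" for j
  define C where "C = (\<Sum>j<n. (K + \<rho> * K) * \<rho> * m j)"
  show ?thesis
  proof (rule that[of \<rho> C])
    show "\<rho> > 0" by fact
    show "C \<ge> 0" unfolding C_def m_def using K \<rho> by (intro sum_nonneg mult_nonneg_nonneg add_nonneg_nonneg) auto
    fix f :: "complex^'n \<Rightarrow> real" and Df Z and x :: "complex^'n"
    assume f: "smooth1 f Df" "\<And>x. norm x = 1 \<Longrightarrow> \<bar>f x\<bar> \<le> 1" and Z: "Z \<in> G" and x: "norm x = 1"
    let ?N = "tent_measure n s \<rho>"
    let ?g = "\<lambda>j b. c Z j b * Df (J b n *v x) (J b n *v (w j b *v x))"
    have KZ: "K * norm Z \<ge> 0" using K by simp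
    have ibp: "\<bar>\<integral>b. ?g j b \<partial>?N\<bar> \<le> (K * norm Z + \<rho> * (K * norm Z)) * \<rho> * m j" "integrable ?N (?g j)" if "j < n" for j
      unfolding m_def
      using integration_by_parts_bound[OF that \<rho> KZ c(5)[OF Z] c(3)[OF Z that] c(4) c(2)[OF Z that] f x] by blast+
    have "AE b in ?N. Df (J b n *v x) (J b n *v (Z *v x)) = (\<Sum>j<n. ?g j b)"
      using AE_tent_measure[OF \<rho>]
    proof eventually_elim
      case (elim b)
      have "(f has_derivative Df (J b n *v x)) (at (J b n *v x))" using f(1) by (auto simp: smooth1_def)
      then interpret D: bounded_linear "Df (J b n *v x)" by (rule has_derivative_bounded_linear)
      interpret M: bounded_linear "\<lambda>X :: complex^'n^'n. X *v x"
        by (rule bounded_bilinear.bounded_linear_left[OF bounded_bilinear_matrix_vector_mult])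
      interpret M': bounded_linear "\<lambda>y. J b n *v y"
        by (rule bounded_bilinear.bounded_linear_right[OF bounded_bilinear_matrix_vector_mult])
      show ?case
        by (subst c(1)[OF Z elim]) (simp add: M.sum M.scaleR M'.sum M'.scaleR D.sum D.scaleR)
    qed
    then have "(\<integral>b. Df (J b n *v x) (J b n *v (Z *v x)) \<partial>?N) = (\<integral>b. (\<Sum>j<n. ?g j b) \<partial>?N)"
    proof (rule integral_cong_AE[rotated 2])
      show "(\<lambda>b. Df (J b n *v x) (J b n *v (Z *v x))) \<in> borel_measurable ?N"
      proof (rule borel_measurable_continuous_Pair[where H=Df])
        have [measurable]: "(\<lambda>b. J b n) \<in> borel_measurable (tent_measure n s \<rho>)"
          by (subst measurable_cong_sets[OF sets_tent_measure refl]) simp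
        show "continuous_on UNIV (\<lambda>p. Df (fst p) (snd p))" using f(1) by (simp add: smooth1_def case_prod_unfold)
        show "(\<lambda>b. J b n *v x) \<in> borel_measurable ?N" "(\<lambda>b. J b n *v (Z *v x)) \<in> borel_measurable ?N" by measurable
      qed
      show "(\<lambda>b. \<Sum>j<n. ?g j b) \<in> borel_measurable ?N" using ibp(2) by (intro borel_measurable_sum) auto
    qed
    also have "\<dots> = (\<Sum>j<n. \<integral>b. ?g j b \<partial>?N)" using ibp(2) by (intro Bochner_Integration.integral_sum) auto
    also have "\<bar>\<dots>\<bar> \<le> (\<Sum>j<n. (K * norm Z + \<rho> * (K * norm Z)) * \<rho> * m j)"
      using ibp(1) by (intro order_trans[OF sum_abs sum_mono]) auto
    also have "\<dots> = C * norm Z" unfolding C_def sum_distrib_right by (simp add: algebra_simps)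
    finally show "\<bar>\<integral>b. Df (J b n *v x) (J b n *v (Z *v x)) \<partial>?N\<bar> \<le> C * norm Z" .
  qed
qed

text \<open>The isometries occurring here are the final legs of a path, held fixed while an earlier
  duration varies; conjugation by them must not lead out of \<open>G\<close>. The witness
  \<open>T'\<close> is the inverse.\<close>

definition transports :: "(complex^'n^'n) set" where
  "transports = {T. \<exists>T'. T' ** T = mat 1 \<and> (\<forall>x. norm (T *v x) = norm x) \<and>
      (\<forall>x. norm (T' *v x) = norm x) \<and> (\<forall>Z\<in>G. T ** Z ** T' \<in> G)}"

lemma transports_id: "mat 1 \<in> transports"
  unfolding transports_def by (auto intro!: exI[of _ "mat 1"])

lemma transports_mult_U:
  assumes "T \<in> transports" "t \<ge> 0" shows "T ** U k t \<in> transports"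
proof -
  obtain T' where T': "T' ** T = mat 1" "\<forall>x. norm (T *v x) = norm x"
      "\<forall>x. norm (T' *v x) = norm x" "\<forall>Z\<in>G. T ** Z ** T' \<in> G"
    using assms(1) unfolding transports_def by blast
  have "U k (- t) ** T' ** (T ** U k t) = U k (-t) ** (T' ** T) ** U k t"
    by (simp only: matrix_mul_assoc)
  moreover have "T ** U k t ** Z ** (U k (- t) ** T') \<in> G" if "Z \<in> G" for Z
    using T'(4)[rule_format, OF conj_U_G[OF assms(2) that, of k]] by (simp add: matrix_mul_assoc)
  ultimately show ?thesis unfolding transports_def using T'
    by (intro CollectI exI[of _ "U k (- t) ** T'"]) (simp add: matrix_vector_mul_assoc[symmetric])
qed

text \<open>The paths are exchanged one leg at a time, the last one first, while the outer legs are
  collected in \<open>T\<close>. Varying a leg moves the state along \<open>T ** A k ** T'\<close>,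
  an element of \<open>G\<close> of bounded norm. Thus the change of durations alone controls the
  law, with a constant independent of \<open>f\<close> and of the number of legs.\<close>

lemma smoothing:
  obtains n s \<rho> C where "even n" "\<And>i. s i \<ge> 0" "\<rho> > 0" "C > 0"
    "\<And>f Df k a a' x. smooth1 f Df \<Longrightarrow> (\<And>x. norm x = 1 \<Longrightarrow> \<bar>f x\<bar> \<le> 1) \<Longrightarrow> norm x = 1 \<Longrightarrow>
       (\<And>i. a i \<ge> 0) \<Longrightarrow> (\<And>i. a' i \<ge> 0) \<Longrightarrow>
       \<bar>(\<integral>b. f (J b n *v (J a k *v x)) \<partial>tent_measure n s \<rho>) - (\<integral>b. f (J b n *v (J a' k *v x)) \<partial>tent_measure n s \<rho>)\<bar>
          \<le> C * (\<Sum>j<k. \<bar>a j - a' j\<bar>)"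
proof -
  obtain n s where n: "even n" and s: "\<And>i. s i \<ge> 0" and WG: "W n s = G"
    by (rule spanning_path) blast
  obtain \<rho> C where \<rho>: "\<rho> > 0" and C: "C \<ge> 0" and dir:
    "\<And>f Df Z x. smooth1 f Df \<Longrightarrow> (\<And>x. norm x = 1 \<Longrightarrow> \<bar>f x\<bar> \<le> 1) \<Longrightarrow> Z \<in> G \<Longrightarrow> norm x = 1 \<Longrightarrow>
       \<bar>\<integral>b. Df (J b n *v x) (J b n *v (Z *v x)) \<partial>tent_measure n s \<rho>\<bar> \<le> C * norm Z"
    by (rule directional_bound[OF WG s]) blast
  obtain \<alpha> where \<alpha>: "\<alpha> > 0" "\<And>k x. norm (A k *v x) \<le> \<alpha> * norm x" by (rule A_bound) blast
  let ?N = "tent_measure n s \<rho>"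
  let ?d = "real CARD('n)"
  define C' where "C' = C * (\<alpha> * ?d * ?d) + 1"
  have C': "C' > 0" unfolding C'_def using C \<alpha>(1) by (intro add_nonneg_pos) auto
  have mJ[measurable]: "(\<lambda>b. J b n) \<in> borel_measurable ?N"
    by (subst measurable_cong_sets[OF sets_tent_measure refl]) simp
  show ?thesis
  proof (rule that[of n s \<rho> C'])
    fix f :: "complex^'n \<Rightarrow> real" and Df k and a a' :: "nat \<Rightarrow> real" and x :: "complex^'n"
    assume f: "smooth1 f Df" "\<And>x. norm x = 1 \<Longrightarrow> \<bar>f x\<bar> \<le> 1" and x: "norm x = 1"
      and a: "\<And>i. a i \<ge> 0" "\<And>i. a' i \<ge> 0"
    obtain L where L: "L > 0" "\<And>x v. x \<in> sphere 0 1 \<Longrightarrow> v \<in> cball 0 \<alpha> \<Longrightarrow> \<bar>Df x v\<bar> \<le> L"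
      using smooth1_bound[OF f(1), of "sphere 0 1" "cball 0 \<alpha>"] by auto
    have contf: "continuous_on UNIV f"
      using f(1) unfolding smooth1_def by (auto intro!: continuous_at_imp_continuous_on has_derivative_continuous)
    then have [measurable]: "f \<in> borel_measurable borel" by (rule borel_measurable_continuous_onI)
    have one: "\<bar>(\<integral>b. f (J b n *v (T *v (U k t *v y))) \<partial>?N) - (\<integral>b. f (J b n *v (T *v (U k t' *v y))) \<partial>?N)\<bar>
        \<le> C' * \<bar>t - t'\<bar>" if T: "T \<in> transports" and y: "norm y = 1" for T k t t' y
    proof -
      obtain T' where T': "T' ** T = mat 1" "\<And>x. norm (T *v x) = norm x"
        "\<And>x. norm (T' *v x) = norm x" "\<And>Z. Z\<in>G \<Longrightarrow> T ** Z ** T' \<in> G"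
        using T unfolding transports_def by blast
      let ?Z = "T ** A k ** T'"
      have Z: "?Z \<in> G" using T'(4) A_in_G by blast
      have nZ: "norm ?Z \<le> \<alpha> * ?d * ?d" by (rule norm_conj_le[OF T'(2,3) \<alpha>(2)])
      \<comment> \<open>The generator is moved to the left of \<open>T\<close>, so that the velocity
        becomes an element of \<open>G\<close> applied to the current state.\<close>
      have Zeq: "T *v (U k t *v (A k *v y)) = ?Z *v (T *v (U k t *v y))" for t
      proof -
        have "?Z *v (T *v (U k t *v y)) = (T ** A k ** (T' ** T) ** U k t) *v y"
          by (simp only: matrix_vector_mul_assoc matrix_mul_assoc)
        also have "\<dots> = (T ** (A k ** U k t)) *v y" by (simp add: T'(1) matrix_mul_assoc)
        finally show ?thesis by (simp add: U_A_commute[symmetric] matrix_vector_mul_assoc matrix_mul_assoc)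
      qed
      show ?thesis
      proof (rule integral_parameter_lipschitz)
        show "finite_measure ?N" using finite_tent_measure \<rho> by simp
        show "((\<lambda>t. f (J b n *v (T *v (U k t *v y)))) has_real_derivative
            Df (J b n *v (T *v (U k t *v y))) (J b n *v (T *v (U k t *v (A k *v y))))) (at t)" for b t
          by (intro smooth1_chain[OF f(1)] U_deriv
              bounded_linear.has_vector_derivative[OF bounded_bilinear.bounded_linear_right[OF bounded_bilinear_matrix_vector_mult]])
        show "\<bar>Df (J b n *v (T *v (U k t *v y))) (J b n *v (T *v (U k t *v (A k *v y))))\<bar> \<le> L" for b t
          using y \<alpha>(2)[of k y] by (intro L(2)) (simp_all add: T'(2))
        show "\<bar>f (J b n *v (T *v (U k t *v y)))\<bar> \<le> 1" for b t using y by (intro f(2)) (simp add: T'(2))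
        show "(\<lambda>b. f (J b n *v (T *v (U k t *v y)))) \<in> borel_measurable ?N" for t by measurable
        show "\<bar>\<integral>b. Df (J b n *v (T *v (U k t *v y))) (J b n *v (T *v (U k t *v (A k *v y)))) \<partial>?N\<bar> \<le> C'" for t
        proof -
          have "\<bar>\<integral>b. Df (J b n *v (T *v (U k t *v y))) (J b n *v (T *v (U k t *v (A k *v y)))) \<partial>?N\<bar> \<le> C * norm ?Z"
            unfolding Zeq using y by (intro dir[OF f Z]) (auto simp: T'(2))
          also have "\<dots> \<le> C * (\<alpha> * ?d * ?d)" using nZ C by (intro mult_left_mono)
          also have "\<dots> \<le> C'" by (simp add: C'_def)
          finally show ?thesis .
        qed
      qed
    qed
    have "\<bar>(\<integral>b. f (J b n *v (T *v (J a k *v x))) \<partial>?N) - (\<integral>b. f (J b n *v (T *v (J a' k *v x))) \<partial>?N)\<bar>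
          \<le> C' * (\<Sum>j<k. \<bar>a j - a' j\<bar>)" if "T \<in> transports" for T
      using that
    \<comment> \<open>\<open>T\<close> is generalized because the leg with duration
      \<open>a k\<close> is absorbed into it before the induction hypothesis is applied.\<close>
    proof (induction k arbitrary: T)
      case (Suc k)
      have "\<bar>(\<integral>b. f (J b n *v ((T ** U k (a k)) *v (J a k *v x))) \<partial>?N) - (\<integral>b. f (J b n *v ((T ** U k (a k)) *v (J a' k *v x))) \<partial>?N)\<bar>
          \<le> C' * (\<Sum>j<k. \<bar>a j - a' j\<bar>)"
        by (intro Suc.IH transports_mult_U Suc.prems a)
      moreover have "\<bar>(\<integral>b. f (J b n *v (T *v (U k (a k) *v (J a' k *v x)))) \<partial>?N)
          - (\<integral>b. f (J b n *v (T *v (U k (a' k) *v (J a' k *v x)))) \<partial>?N)\<bar> \<le> C' * \<bar>a k - a' k\<bar>"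
        using x by (intro one Suc.prems) simp
      ultimately show ?case unfolding J_Suc by (simp add: matrix_vector_mul_assoc matrix_mul_assoc distrib_left)
    qed simp
    from this[OF transports_id]
    show "\<bar>(\<integral>b. f (J b n *v (J a k *v x)) \<partial>?N) - (\<integral>b. f (J b n *v (J a' k *v x)) \<partial>?N)\<bar>
          \<le> C' * (\<Sum>j<k. \<bar>a j - a' j\<bar>)" by simp
  qed (use n s \<rho> C' in auto)
qed

end

section \<open>Overlap and contraction\<close>

text \<open>The test class grows from polynomials to continuous functions with values between 0 and
  1 by Weierstrass approximation, then to compact sets by pointwise limits, then to Borel sets by
  inner regularity. In the last step only \<open>\<mu>\<close> is approximated from inside; for
  \<open>\<nu>\<close> monotonicity suffices.\<close>

lemma measure_diff_le_of_polynomials: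
  fixes \<mu> \<nu> :: "'a::euclidean_space measure"
  assumes fin: "finite_measure \<mu>" "finite_measure \<nu>" and sets: "sets \<mu> = sets borel" "sets \<nu> = sets borel"
    and S: "compact S" "AE x in \<mu>. x \<in> S" "AE x in \<nu>. x \<in> S"
    and test: "\<And>f. real_polynomial_function f \<Longrightarrow> (\<And>x. x \<in> S \<Longrightarrow> \<bar>f x\<bar> \<le> 1) \<Longrightarrow>
        (\<integral>x. f x \<partial>\<mu>) - (\<integral>x. f x \<partial>\<nu>) \<le> \<eta>"
    and A: "A \<in> sets borel" and \<eta>: "0 \<le> \<eta>"
  shows "measure \<mu> A - measure \<nu> A \<le> \<eta>"
proof -
  interpret \<mu>: finite_measure \<mu> by fact
  interpret \<nu>: finite_measure \<nu> by fact
  note [measurable_cong] = sets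
  have int: "integrable \<mu> g" "integrable \<nu> g"
    if "continuous_on UNIV g" "\<And>x. x \<in> S \<Longrightarrow> \<bar>g x\<bar> \<le> B" for g :: "'a \<Rightarrow> real" and B
  proof -
    have [measurable]: "g \<in> borel_measurable borel" using that(1) by (rule borel_measurable_continuous_onI)
    show "integrable \<mu> g" using S(2) that(2) by (intro \<mu>.integrable_const_bound[of _ B]) auto
    show "integrable \<nu> g" using S(3) that(2) by (intro \<nu>.integrable_const_bound[of _ B]) auto
  qed
  have cont: "(\<integral>x. g x \<partial>\<mu>) - (\<integral>x. g x \<partial>\<nu>) \<le> \<eta>"
    if g: "continuous_on UNIV g" "\<And>x. 0 \<le> g x \<and> g x \<le> 1" for g :: "'a \<Rightarrow> real"
  proof (rule field_le_epsilon)
    fix e :: real assume e: "e > 0"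
    define m where "m = measure \<mu> (space \<mu>) + measure \<nu> (space \<nu>) + 1"
    have m: "m > 0" unfolding m_def by (simp add: add_nonneg_pos)
    define d where "d = e / (2 * m)"
    have d: "d > 0" using e m by (simp add: d_def)
    obtain p where p: "real_polynomial_function p" "\<And>x. x \<in> S \<Longrightarrow> \<bar>g x - p x\<bar> < d"
      using Stone_Weierstrass_real_polynomial_function[OF S(1) continuous_on_subset[OF g(1)], of d] d by auto
    \<comment> \<open>The approximating polynomial may exceed 1 by \<open>d\<close>. The division
      makes it an admissible test function at the price of a second error \<open>d\<close>.\<close>
    define q where "q x = p x / (1 + d)" for x
    have q: "real_polynomial_function q" unfolding q_def by (intro real_polynomial_function_divide p(1))
    have p1: "\<bar>p x\<bar> \<le> 1 + d" if "x \<in> S" for x using p(2)[OF that] g(2)[of x] by linarith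
    then have q1: "\<bar>q x\<bar> \<le> 1" if "x \<in> S" for x using d that by (simp add: q_def)
    have gq: "\<bar>g x - q x\<bar> \<le> 2 * d" if "x \<in> S" for x
    proof -
      have "p x - q x = d * q x" using d by (simp add: q_def field_simps)
      then have "\<bar>p x - q x\<bar> \<le> d * 1" using q1[OF that] d by (simp add: abs_mult)
      then show ?thesis using p(2)[OF that] by linarith
    qed
    have cq: "continuous_on UNIV q" using q by (intro continuous_on_polymonial_function) (simp add: real_polynomial_function_eq)
    have "\<bar>g x\<bar> \<le> 1" for x using g(2)[of x] by (simp add: abs_le_iff)
    then have ig: "integrable \<mu> g" "integrable \<nu> g" using int[OF g(1), of 1] by blast+
    have iq: "integrable \<mu> q" "integrable \<nu> q" using int[OF cq q1] by auto
    have "(\<integral>x. g x \<partial>\<mu>) \<le> (\<integral>x. q x + 2 * d \<partial>\<mu>)"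
    proof (rule integral_mono_AE)
      show "AE x in \<mu>. g x \<le> q x + 2 * d" using S(2) by eventually_elim (use gq in \<open>auto simp: abs_le_iff algebra_simps\<close>)
    qed (use ig iq in auto)
    moreover have "(\<integral>x. q x - 2 * d \<partial>\<nu>) \<le> (\<integral>x. g x \<partial>\<nu>)"
    proof (rule integral_mono_AE)
      show "AE x in \<nu>. q x - 2 * d \<le> g x" using S(3) by eventually_elim (use gq in \<open>auto simp: abs_le_iff algebra_simps\<close>)
    qed (use ig iq in auto)
    ultimately have "(\<integral>x. g x \<partial>\<mu>) - (\<integral>x. g x \<partial>\<nu>)
        \<le> (\<integral>x. q x \<partial>\<mu>) - (\<integral>x. q x \<partial>\<nu>) + 2 * d * (measure \<mu> (space \<mu>) + measure \<nu> (space \<nu>))"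
      using iq by (simp add: algebra_simps)
    also have "\<dots> \<le> \<eta> + 2 * d * m"
      using test[OF q q1] d by (intro add_mono mult_left_mono) (auto simp: m_def)
    also have "2 * d * m = e" using m by (simp add: d_def)
    finally show "(\<integral>x. g x \<partial>\<mu>) - (\<integral>x. g x \<partial>\<nu>) \<le> \<eta> + e" .
  qed
  have comp: "measure \<mu> K - measure \<nu> K \<le> \<eta>" if K: "compact K" for K
  proof (cases "K = {}")
    case False
    have clK: "closed K" using K by (rule compact_imp_closed)
    have [measurable]: "K \<in> sets borel" using clK by (rule borel_closed)
    define g where "g m x = max 0 (1 - real m * infdist x K)" for m x
    have gc: "continuous_on UNIV (g m)" for m unfolding g_def
      by (intro continuous_intros continuous_on_infdist continuous_on_id)
    have [measurable]: "g m \<in> borel_measurable borel" for m using gc by (rule borel_measurable_continuous_onI)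
    have g01: "0 \<le> g m x \<and> g m x \<le> 1" for m x unfolding g_def by (auto simp: infdist_nonneg)
    have glim: "(\<lambda>m. g m x) \<longlonglongrightarrow> indicator K x" for x
    proof (cases "x \<in> K")
      case True
      then show ?thesis by (simp add: g_def)
    next
      case nx: False
      then have pos: "infdist x K > 0"
        using clK False by (metis in_closed_iff_infdist_zero infdist_nonneg less_eq_real_def)
      obtain M where M: "1 < real M * infdist x K" using reals_Archimedean3[OF pos] by blast
      have "g m x = 0" if "m \<ge> M" for m
      proof -
        have "real M * infdist x K \<le> real m * infdist x K" using that pos by (intro mult_right_mono) auto
        then show ?thesis using M by (simp add: g_def)
      qed
      then show ?thesis using nx by (intro tendsto_eventually) (auto simp: eventually_sequentially)
    qed
    have "(\<lambda>m. \<integral>x. g m x \<partial>\<mu>) \<longlonglongrightarrow> (\<integral>x. indicator K x \<partial>\<mu>)"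
      by (rule integral_dominated_convergence[where w="\<lambda>_. 1"]) (use g01 glim in auto)
    moreover have "(\<lambda>m. \<integral>x. g m x \<partial>\<nu>) \<longlonglongrightarrow> (\<integral>x. indicator K x \<partial>\<nu>)"
      by (rule integral_dominated_convergence[where w="\<lambda>_. 1"]) (use g01 glim in auto)
    ultimately have "(\<lambda>m. (\<integral>x. g m x \<partial>\<mu>) - (\<integral>x. g m x \<partial>\<nu>)) \<longlonglongrightarrow>
        (\<integral>x. indicator K x \<partial>\<mu>) - (\<integral>x. indicator K x \<partial>\<nu>)" by (rule tendsto_diff)
    then have "(\<integral>x. indicator K x \<partial>\<mu>) - (\<integral>x. indicator K x \<partial>\<nu>) \<le> \<eta>"
      by (rule LIMSEQ_le_const2) (use cont[OF gc g01] in auto)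
    then show ?thesis by simp
  qed (simp add: \<eta>)
  show ?thesis
  proof (rule field_le_epsilon)
    fix e :: real assume e: "e > 0"
    have "\<exists>K. K \<subseteq> A \<and> compact K \<and> measure \<mu> A < measure \<mu> K + e"
    proof (rule ccontr)
      assume no: "\<not> ?thesis"
      have "emeasure \<mu> A = (SUP K\<in>{K. K \<subseteq> A \<and> compact K}. emeasure \<mu> K)"
        using A sets by (intro inner_regular) auto
      also have "\<dots> \<le> ennreal (measure \<mu> A - e)"
      proof (rule SUP_least)
        fix K assume "K \<in> {K. K \<subseteq> A \<and> compact K}"
        then have "measure \<mu> K \<le> measure \<mu> A - e" using no by (force simp: not_less)
        then show "emeasure \<mu> K \<le> ennreal (measure \<mu> A - e)"
          by (simp add: \<mu>.emeasure_eq_measure ennreal_leI)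
      qed
      finally have le: "ennreal (measure \<mu> A) \<le> ennreal (measure \<mu> A - e)" by (simp add: \<mu>.emeasure_eq_measure)
      have "measure \<mu> A - e \<ge> 0" using no[simplified, rule_format, of "{}"] by simp
      then show False using le e by (simp add: ennreal_le_iff)
    qed
    then obtain K where K: "K \<subseteq> A" "compact K" "measure \<mu> A < measure \<mu> K + e" by blast
    have "measure \<nu> K \<le> measure \<nu> A" using K(1) A sets by (intro \<nu>.finite_measure_mono) auto
    then show "measure \<mu> A - measure \<nu> A \<le> \<eta> + e" using comp[OF K(2)] K(3) by linarith
  qed
qed

text \<open>Otherwise there are sets of \<open>L\<close>-measure below \<open>(1/2) ^ i\<close>
  whose \<open>N\<close>-measure stays above \<open>e\<close>. By Borel-Cantelli their upper limit
  is null for \<open>L\<close>, hence for \<open>N\<close>, while continuity from above gives it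
  \<open>N\<close>-measure at least \<open>e\<close>.\<close>

lemma absolutely_continuous_epsilon_delta:
  assumes fin: "finite_measure L" "finite_measure N" and sets: "sets N = sets L"
    and ac: "absolutely_continuous L N" and e: "e > 0"
  obtains d where "d > 0" "\<And>B. B \<in> sets L \<Longrightarrow> measure L B < d \<Longrightarrow> measure N B < e"
proof -
  interpret L: finite_measure L by fact
  interpret N: finite_measure N by fact
  have "\<exists>d>0. \<forall>B\<in>sets L. measure L B < d \<longrightarrow> measure N B < e"
  proof (rule ccontr)
    assume no: "\<not> ?thesis"
    have "\<forall>i::nat. \<exists>B\<in>sets L. measure L B < (1/2) ^ i \<and> measure N B \<ge> e"
      using no by (metis not_less zero_less_power half_gt_zero_iff zero_less_one)
    then obtain B where B: "\<And>i. B i \<in> sets L" "\<And>i. measure L (B i) < (1/2) ^ i" "\<And>i. measure N (B i) \<ge> e" by metis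
    have "limsup B \<in> null_sets L"
    proof (rule borel_cantelli_limsup1)
      show "summable (\<lambda>i. measure L (B i))"
        by (rule summable_comparison_test'[where g="\<lambda>i. (1/2) ^ i" and N=0]) (use B(2) in \<open>auto intro: less_imp_le\<close>)
    qed (use B(1) L.emeasure_finite in \<open>auto simp: less_top[symmetric]\<close>)
    then have "limsup B \<in> null_sets N" using ac by (auto simp: absolutely_continuous_def)
    then have z: "measure N (limsup B) = 0" by (rule measure_eq_0_null_sets)
    have "(\<lambda>n. measure N (\<Union>m\<in>{n..}. B m)) \<longlonglongrightarrow> measure N (\<Inter>n. \<Union>m\<in>{n..}. B m)"
    proof (rule N.finite_Lim_measure_decseq)
      show "range (\<lambda>n. \<Union>m\<in>{n..}. B m) \<subseteq> sets N" using B(1) sets by auto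
      show "decseq (\<lambda>n. \<Union>m\<in>{n..}. B m)" by (intro decseq_SucI UN_mono) auto
    qed
    moreover have "e \<le> measure N (\<Union>m\<in>{n..}. B m)" for n
      by (rule order_trans[OF B(3)[of n] N.finite_measure_mono]) (use B(1) sets in auto)
    ultimately have "e \<le> measure N (\<Inter>n. \<Union>m\<in>{n..}. B m)" by (intro LIMSEQ_le_const) auto
    then show False using z e by (simp add: limsup_INF_SUP)
  qed
  then show ?thesis using that by blast
qed

text \<open>By Fubini, almost all slices of a null set in one coordinate are null for the factor of
  \<open>L\<close>. The induction hypothesis transfers "almost all" to the remaining factors of
  \<open>N\<close>, and the assumption on the single factor transfers nullity of the slices.\<close>

lemma absolutely_continuous_PiM:
  fixes L N :: "'i \<Rightarrow> 'a measure"
  assumes "finite I" and sf: "\<And>i. sigma_finite_measure (L i)" "\<And>i. sigma_finite_measure (N i)"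
    and sets: "\<And>i. sets (N i) = sets (L i)"
    and ac: "\<And>i. i \<in> I \<Longrightarrow> absolutely_continuous (L i) (N i)"
  shows "absolutely_continuous (Pi\<^sub>M I L) (Pi\<^sub>M I N)"
proof -
  interpret L: product_sigma_finite L using sf(1) by (rule product_sigma_finite.intro)
  interpret N: product_sigma_finite N using sf(2) by (rule product_sigma_finite.intro)
  have seq: "sets (Pi\<^sub>M I N) = sets (Pi\<^sub>M I L)" for I using sets by (intro sets_PiM_cong) auto
  from assms(1) ac show ?thesis
  proof (induction I)
    case empty
    show ?case by (simp only: PiM_empty absolutely_continuous_def order_refl)
  next
    case (insert i I)
    show ?case unfolding absolutely_continuous_def
    proof
      fix B assume B: "B \<in> null_sets (Pi\<^sub>M (insert i I) L)"
      then have Bs: "B \<in> sets (Pi\<^sub>M (insert i I) L)" by auto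
      have Bs': "B \<in> sets (Pi\<^sub>M (insert i I) N)" using Bs seq by auto
      have ind: "(indicator B :: _ \<Rightarrow> ennreal) \<in> borel_measurable (Pi\<^sub>M (insert i I) L)" using Bs by simp
      have ind': "(indicator B :: _ \<Rightarrow> ennreal) \<in> borel_measurable (Pi\<^sub>M (insert i I) N)" using Bs' by simp
      have add: "(\<lambda>(x, y). x(i := y)) \<in> measurable (Pi\<^sub>M I L \<Otimes>\<^sub>M L i) (Pi\<^sub>M (insert i I) L)"
        by (rule measurable_add_dim)
      have slice: "(\<lambda>y. indicator B (x(i := y)) :: ennreal) \<in> borel_measurable (L i)"
        if "x \<in> space (Pi\<^sub>M I L)" for x
        using that by (intro measurable_compose[OF _ ind] measurable_component_update insert)
      have meas: "(\<lambda>x. \<integral>\<^sup>+ y. indicator B (x(i := y)) \<partial>L i) \<in> borel_measurable (Pi\<^sub>M I L)"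
        using sigma_finite_measure.borel_measurable_nn_integral[OF sf(1)[of i], of "\<lambda>x y. indicator B (x(i := y))" "Pi\<^sub>M I L"]
          measurable_compose[OF add ind] by (simp add: case_prod_unfold)
      have "(\<integral>\<^sup>+ x. \<integral>\<^sup>+ y. indicator B (x(i := y)) \<partial>L i \<partial>Pi\<^sub>M I L) = 0"
        using L.product_nn_integral_insert[OF insert(1,2) ind] null_setsD1[OF B] by (simp add: Bs)
      then have "AE x in Pi\<^sub>M I L. (\<integral>\<^sup>+ y. indicator B (x(i := y)) \<partial>L i) = 0"
        using meas by (simp add: nn_integral_0_iff_AE)
      then have "AE x in Pi\<^sub>M I N. (\<integral>\<^sup>+ y. indicator B (x(i := y)) \<partial>L i) = 0"
        using insert.IH insert.prems seq by (auto intro: absolutely_continuous_AE[of "Pi\<^sub>M I N" "Pi\<^sub>M I L"])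
      then have "AE x in Pi\<^sub>M I N. (\<integral>\<^sup>+ y. indicator B (x(i := y)) \<partial>N i) = 0"
        using AE_space
      proof eventually_elim
        case (elim x)
        have x: "x \<in> space (Pi\<^sub>M I L)" using elim(2) sets_eq_imp_space_eq[OF seq] by auto
        then have "AE y in L i. indicator B (x(i := y)) = (0::ennreal)"
          using elim(1) slice by (subst (asm) nn_integral_0_iff_AE) auto
        then have "AE y in N i. indicator B (x(i := y)) = (0::ennreal)"
          using insert.prems sets by (auto intro: absolutely_continuous_AE[of "N i" "L i"])
        moreover have "(\<lambda>y. indicator B (x(i := y)) :: ennreal) \<in> borel_measurable (N i)"
          using slice[OF x] sets by (simp cong: measurable_cong_sets)
        ultimately show ?case by (subst nn_integral_0_iff_AE)
      qed
      then have "(\<integral>\<^sup>+ x. \<integral>\<^sup>+ y. indicator B (x(i := y)) \<partial>N i \<partial>Pi\<^sub>M I N) = (\<integral>\<^sup>+ x. 0 \<partial>Pi\<^sub>M I N)"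
        by (rule nn_integral_cong_AE)
      then have "emeasure (Pi\<^sub>M (insert i I) N) B = 0"
        using N.product_nn_integral_insert[OF insert(1,2) ind'] by (simp add: Bs')
      then show "B \<in> null_sets (Pi\<^sub>M (insert i I) N)" using Bs' by auto
    qed
  qed
qed

text \<open>Two independent copies are compared: the gap is at most 1 everywhere and at most
  \<open>1 - \<kappa>\<close> on the rectangle of \<open>E\<close> and \<open>E'\<close>, whose
  probability is at least \<open>p\<^sup>2\<close>.\<close>

lemma prob_integral_diff_le:
  fixes h :: "'a \<Rightarrow> real" and h' :: "'b \<Rightarrow> real"
  assumes P: "prob_space P" "prob_space P'"
    and h: "h \<in> borel_measurable P" "\<And>x. 0 \<le> h x \<and> h x \<le> 1"
    and h': "h' \<in> borel_measurable P'" "\<And>x. 0 \<le> h' x \<and> h' x \<le> 1"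
    and E: "E \<in> sets P" "E' \<in> sets P'"
    and le: "\<And>x y. x \<in> E \<Longrightarrow> y \<in> E' \<Longrightarrow> h x - h' y \<le> 1 - \<kappa>" and \<kappa>: "0 \<le> \<kappa>"
    and p: "p \<le> measure P E" "p \<le> measure P' E'" "0 \<le> p"
  shows "(\<integral>x. h x \<partial>P) - (\<integral>y. h' y \<partial>P') \<le> 1 - \<kappa> * p\<^sup>2"
proof -
  interpret P: prob_space P by fact
  interpret P': prob_space P' by fact
  have ih: "integrable P h" using h by (intro P.integrable_const_bound[of _ 1]) auto
  have ih': "integrable P' h'" using h' by (intro P'.integrable_const_bound[of _ 1]) auto
  have iE: "integrable P (\<lambda>x. c * indicator E x :: real)" "(\<integral>x. c * indicator E x \<partial>P) = c * measure P E" for c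
    using E P.emeasure_finite by (auto simp: less_top[symmetric])
  have iE': "integrable P' (\<lambda>x. c * indicator E' x :: real)" "(\<integral>x. c * indicator E' x \<partial>P') = c * measure P' E'" for c
    using E P'.emeasure_finite by (auto simp: less_top[symmetric])
  have pt: "h x - h' y \<le> 1 - \<kappa> * indicator E x * indicator E' y" for x y
    using le[of x y] h(2)[of x] h'(2)[of y] by (auto simp: indicator_def)
  have 1: "(\<integral>x. h x \<partial>P) - h' y \<le> 1 - \<kappa> * measure P E * indicator E' y" for y
  proof -
    have "(\<integral>x. h x - h' y \<partial>P) \<le> (\<integral>x. 1 - \<kappa> * indicator E' y * indicator E x \<partial>P)"
    proof (rule integral_mono)
      show "h x - h' y \<le> 1 - \<kappa> * indicator E' y * indicator E x" for x using pt[of x y] by (simp add: mult_ac)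
    qed (use ih iE(1) in auto)
    also have "\<dots> = 1 - \<kappa> * measure P E * indicator E' y"
      by (subst Bochner_Integration.integral_diff) (simp_all only: iE, simp_all add: P.prob_space mult_ac)
    finally show ?thesis using ih by (simp add: P.prob_space)
  qed
  have "(\<integral>y. (\<integral>x. h x \<partial>P) - h' y \<partial>P') \<le> (\<integral>y. 1 - \<kappa> * measure P E * indicator E' y \<partial>P')"
    by (rule integral_mono) (use 1 ih' iE'(1) in auto)
  also have "\<dots> = 1 - \<kappa> * (measure P E * measure P' E')"
    by (subst Bochner_Integration.integral_diff) (simp_all only: iE', simp_all add: P'.prob_space mult_ac)
  also have "\<dots> \<le> 1 - \<kappa> * (p * p)" using p \<kappa> by (simp add: mult_left_mono mult_mono)
  finally show ?thesis using ih' by (simp add: P'.prob_space power2_eq_square)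
qed

lemma emeasure_tent_density_pos:
  assumes "\<rho> > 0"
  shows "emeasure (tent_density a \<rho>) (space (tent_density a \<rho>)) > 0"
proof -
  have "tent a \<rho> t \<ge> \<rho> / 4" if "t \<in> {a + \<rho> / 4..a + 3 * \<rho> / 4}" for t
    using that assms by (auto simp: tent_def max_def min_def)
  then have "(\<integral>\<^sup>+ t. ennreal (\<rho> / 4) * indicator {a + \<rho> / 4..a + 3 * \<rho> / 4} t \<partial>lborel)
      \<le> (\<integral>\<^sup>+ t. ennreal (tent a \<rho> t) \<partial>lborel)"
    by (intro nn_integral_mono) (auto simp: indicator_def intro!: ennreal_leI)
  moreover have "(\<integral>\<^sup>+ t. ennreal (\<rho> / 4) * indicator {a + \<rho> / 4..a + 3 * \<rho> / 4} t \<partial>lborel) = ennreal (\<rho> / 4) * ennreal (\<rho> / 2)"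
    using assms by (subst nn_integral_cmult_indicator) (auto simp: field_simps)
  moreover have "0 < ennreal (\<rho> / 4) * ennreal (\<rho> / 2)" using assms by (simp add: ennreal_mult[symmetric])
  moreover have "emeasure (tent_density a \<rho>) (space (tent_density a \<rho>)) = (\<integral>\<^sup>+ t. ennreal (tent a \<rho> t) \<partial>lborel)"
    by (simp add: tent_density_def emeasure_density)
  ultimately show ?thesis by (metis order_less_le_trans)
qed

lemma measure_tent_measure_pos:
  assumes "\<rho> > 0"
  shows "measure (tent_measure n s \<rho>) (space (tent_measure n s \<rho>)) > 0"
proof -
  interpret product_sigma_finite "\<lambda>j. tent_density (s j) \<rho>"
    using finite_tent_density assms by (intro product_sigma_finite.intro finite_measure.axioms(1)) auto
  interpret N: finite_measure "tent_measure n s \<rho>" using finite_tent_measure assms by simp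
  have "emeasure (tent_measure n s \<rho>) (space (tent_measure n s \<rho>))
     = (\<Prod>j<n. emeasure (tent_density (s j) \<rho>) (space (tent_density (s j) \<rho>)))"
    unfolding tent_measure_def space_PiM by (intro emeasure_PiM) auto
  moreover have "\<dots> \<noteq> 0"
    using emeasure_tent_density_pos[OF assms] by (auto simp: prod_zero_iff less_le)
  ultimately have "ennreal (measure (tent_measure n s \<rho>) (space (tent_measure n s \<rho>))) \<noteq> 0"
    by (simp add: N.emeasure_eq_measure)
  then show ?thesis by (simp add: less_le)
qed

section \<open>Transition operators and their overlap\<close>

locale controlled_chain = hermitian_pair H1 H2 for H1 H2 :: "complex^'n^'n" +
  fixes D :: "real measure" and g :: "real \<Rightarrow> ennreal"
  assumes prob_D: "prob_space D"
    and g_meas: "g \<in> borel_measurable borel" and D_density: "D = density lborel g"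
    and g_pos: "\<And>x. x \<ge> 0 \<Longrightarrow> g x > 0"
    and controllable: "pure_state_controllable H1 H2"
begin

sublocale D: prob_space D by (rule prob_D)

lemma sets_D [measurable_cong, simp]: "sets D = sets borel" by (simp add: D_density)

lemma space_D [simp]: "space D = UNIV" by (simp add: D_density)

abbreviation L :: "nat \<Rightarrow> (nat \<Rightarrow> real) measure" where
  "L n \<equiv> Pi\<^sub>M {..<n} (\<lambda>_. D)"

sublocale PD: product_prob_space "\<lambda>_::nat. D" by unfold_locales

lemma prob_L: "prob_space (L n)" by (intro prob_space_PiM prob_D)

lemma sets_L: "sets (L n) = sets (Pi\<^sub>M {..<n} (\<lambda>_. borel))"
  by (intro sets_PiM_cong) auto

lemma measurable_J_L [measurable]: "(\<lambda>b. J b n) \<in> borel_measurable (L n)"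
  by (subst measurable_cong_sets[OF sets_L refl]) simp

definition T :: "nat \<Rightarrow> (complex^'n \<Rightarrow> real) \<Rightarrow> complex^'n \<Rightarrow> real" where
  "T k f x = (\<integral>t. f (U k t *v x) \<partial>D)"

text \<open>Transition operator over \<open>n\<close> steps when the first step has index \<open>a\<close>; only the parity of
  \<open>a\<close> matters.\<close>
primrec R :: "nat \<Rightarrow> nat \<Rightarrow> (complex^'n \<Rightarrow> real) \<Rightarrow> complex^'n \<Rightarrow> real" where
  "R a 0 f = f"
| "R a (Suc n) f = R a n (T (a + n) f)"

lemma T_measurable [measurable]:
  assumes [measurable]: "f \<in> borel_measurable borel" shows "T k f \<in> borel_measurable borel"
  unfolding T_def by measurable

lemma T_bounds:
  assumes "f \<in> borel_measurable borel" "\<And>x. lo \<le> f x \<and> f x \<le> hi"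
  shows "lo \<le> T k f x \<and> T k f x \<le> hi"
proof -
  have [measurable]: "f \<in> borel_measurable borel" by fact
  have "\<bar>f x\<bar> \<le> \<bar>lo\<bar> + \<bar>hi\<bar>" for x using assms(2)[of x] by linarith
  then have int: "integrable D (\<lambda>t. f (U k t *v x))"
    by (intro D.integrable_const_bound[of _ "\<bar>lo\<bar> + \<bar>hi\<bar>"]) auto
  show ?thesis unfolding T_def using int assms(2) by (auto intro!: D.integral_ge_const D.integral_le_const)
qed

lemma R_measurable [measurable]: "f \<in> borel_measurable borel \<Longrightarrow> R a n f \<in> borel_measurable borel"
  by (induction n arbitrary: f) auto

lemma R_bounds:
  "f \<in> borel_measurable borel \<Longrightarrow> (\<And>x. lo \<le> f x \<and> f x \<le> hi) \<Longrightarrow> lo \<le> R a n f x \<and> R a n f x \<le> hi"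
proof (induction n arbitrary: f)
  case (Suc n)
  have "lo \<le> T (a + n) f x \<and> T (a + n) f x \<le> hi" for x by (rule T_bounds[OF Suc.prems])
  with T_measurable[OF Suc.prems(1)] show ?case unfolding R.simps by (rule Suc.IH)
qed simp

lemma R_add: "R a (n + m) f = R a n (R (a + n) m f)"
  by (induction m arbitrary: f) (simp_all add: add.assoc)

lemma T_parity: "even n \<Longrightarrow> T (n + k) = T k"
  by (simp add: T_def U_parity fun_eq_iff)

lemma R_parity: "even m \<Longrightarrow> R (m + a) n = R a n"
proof (induction n)
  case (Suc n)
  have "R (m + a) n = R a n" using Suc by simp
  moreover have "T (m + a + n) = T (a + n)" using T_parity[of m "a + n"] Suc.prems by (simp add: add.assoc)
  ultimately show ?case by (intro ext) simp
qed (intro ext, simp)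

text \<open>\<open>R\<close> applies the step of highest index to the function first, which matches
  splitting off the last factor of the product measure; the earlier legs do not see that
  duration.\<close>

lemma R_integral:
  "f \<in> borel_measurable borel \<Longrightarrow> (\<And>x. lo \<le> f x \<and> f x \<le> hi) \<Longrightarrow> R 0 n f x = (\<integral>b. f (J b n *v x) \<partial>L n)"
proof (induction n arbitrary: f)
  case 0
  interpret P0: prob_space "L 0" by (rule prob_L)
  show ?case using P0.prob_space by simp
next
  case (Suc n)
  have [measurable]: "f \<in> borel_measurable borel" by fact
  have fin: "insert n {..<n} = {..<Suc n}" by auto
  have bd: "\<bar>f x\<bar> \<le> \<bar>lo\<bar> + \<bar>hi\<bar>" for x using Suc.prems(2)[of x] by linarith
  interpret PS: prob_space "L (Suc n)" by (rule prob_L)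
  have int: "integrable (L (Suc n)) (\<lambda>b. f (J b (Suc n) *v x))"
  proof (rule PS.integrable_const_bound)
    show "(\<lambda>b. f (J b (Suc n) *v x)) \<in> borel_measurable (L (Suc n))" by measurable
    show "AE b in L (Suc n). norm (f (J b (Suc n) *v x)) \<le> \<bar>lo\<bar> + \<bar>hi\<bar>"
      unfolding real_norm_def by (intro AE_I2 bd)
  qed
  have "(\<integral>b. f (J b (Suc n) *v x) \<partial>L (Suc n)) = (\<integral>b. (\<integral>t. f (J (b(n := t)) (Suc n) *v x) \<partial>D) \<partial>L n)"
    using PD.product_integral_insert[of "{..<n}" n "\<lambda>b. f (J b (Suc n) *v x)"] int unfolding fin by simp
  also have "\<dots> = (\<integral>b. T n f (J b n *v x) \<partial>L n)"
  proof (intro Bochner_Integration.integral_cong refl)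
    fix b
    have "J (b(n := t)) n = J b n" for t by (rule J_cong) simp
    then show "(\<integral>t. f (J (b(n := t)) (Suc n) *v x) \<partial>D) = T n f (J b n *v x)"
      by (simp add: T_def J_Suc matrix_vector_mul_assoc del: Jop.simps(2))
  qed
  also have "\<dots> = R 0 n (T n f) x"
    using Suc.prems T_bounds[OF Suc.prems] by (intro Suc.IH[symmetric]) auto
  finally show ?case by simp
qed

lemma even_controllable:
  obtains k where "even k"
    "\<And>x y. norm x = 1 \<Longrightarrow> norm y = 1 \<Longrightarrow> \<exists>s. (\<forall>j. s j \<ge> 0) \<and> J s k *v x = y"
proof -
  obtain n where n: "\<And>x. x \<in> sphere 0 1 \<Longrightarrow> {J s n *v x | s. \<forall>j<n. s j \<ge> 0} = sphere 0 1"
    using controllable unfolding pure_state_controllable_def by blast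
  have ex: "\<exists>s. (\<forall>j. s j \<ge> 0) \<and> (\<forall>j\<ge>n. s j = 0) \<and> J s n *v x = y" if "norm x = 1" "norm y = 1" for x y :: "complex^'n"
  proof -
    have "y \<in> {J s n *v x | s. \<forall>j<n. s j \<ge> 0}" using n[of x] that by simp
    then obtain s where s: "\<And>j. j < n \<Longrightarrow> s j \<ge> 0" "y = J s n *v x" by blast
    have "J (\<lambda>j. if j < n then s j else 0) n = J s n" by (rule J_cong) simp
    then show ?thesis using s by (intro exI[of _ "\<lambda>j. if j < n then s j else 0"]) auto
  qed
  show ?thesis
  proof (cases "even n")
    case True
    then show ?thesis using that[of n] ex by blast
  next
    case False
    show ?thesis
    proof (rule that[of "Suc n"])
      fix x y :: "complex^'n" assume "norm x = 1" "norm y = 1"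
      then obtain s where s: "\<forall>j. s j \<ge> 0" "\<forall>j\<ge>n. s j = 0" "J s n *v x = y" using ex by blast
      then have "J s (Suc n) *v x = y" by (simp add: J_Suc del: Jop.simps(2))
      then show "\<exists>s. (\<forall>j. s j \<ge> 0) \<and> J s (Suc n) *v x = y" using s(1) by blast
    qed (use False in simp)
  qed
qed

text \<open>As \<open>g\<close> is positive on the half-line, a null set of \<open>D\<close> is
  Lebesgue null there, and a tent starting at \<open>a \<ge> 0\<close> vanishes at negative
  durations. In the absence of a lower bound for \<open>g\<close>, this qualitative comparison is
  all that is available.\<close>

lemma tent_absolutely_continuous:
  assumes "a \<ge> 0" shows "absolutely_continuous D (tent_density a \<rho>)"
  unfolding absolutely_continuous_def
proof
  fix B assume B: "B \<in> null_sets D"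
  have Bs: "B \<in> sets borel" using B by auto
  have "AE x in lborel. x \<in> B \<longrightarrow> g x = 0"
    using B null_sets_density_iff[of g lborel B] g_meas by (simp add: D_density)
  then have "AE x in lborel. x \<in> B \<longrightarrow> ennreal (tent a \<rho> x) = 0"
  proof eventually_elim
    case (elim x)
    show ?case
    proof
      assume "x \<in> B"
      then have "x < 0" using elim g_pos[of x] by (cases "x < 0") auto
      then show "ennreal (tent a \<rho> x) = 0" using assms by (simp add: tent_simps)
    qed
  qed
  then show "B \<in> null_sets (tent_density a \<rho>)"
    using Bs by (simp add: tent_density_def null_sets_density_iff)
qed

text \<open>The two unperturbed paths end in one common state, to whose smeared law both perturbed
  laws are close. If the true laws were almost separated by \<open>f\<close>, absolute continuity
  would separate the smeared laws as well. The common end point replaces any knowledge of how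
  \<open>G\<close> acts on the sphere.\<close>

lemma overlap:
  obtains n r \<kappa> where "even n" "r > 0" "\<kappa> > 0"
    "\<And>f x x' a a' b b'. f \<in> borel_measurable borel \<Longrightarrow> (\<And>x. 0 \<le> f x \<and> f x \<le> 1) \<Longrightarrow> norm x = 1 \<Longrightarrow> norm x' = 1 \<Longrightarrow>
      (\<And>j. a j \<ge> 0) \<Longrightarrow> (\<And>j. a' j \<ge> 0) \<Longrightarrow> J a k *v x = J a' k *v x' \<Longrightarrow>
      (\<And>j. j < k \<Longrightarrow> a j \<le> b j \<and> b j \<le> a j + r) \<Longrightarrow> (\<And>j. j < k \<Longrightarrow> a' j \<le> b' j \<and> b' j \<le> a' j + r) \<Longrightarrow>
      R 0 n f (J b k *v x) - R 0 n f (J b' k *v x') \<le> 1 - \<kappa>"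
proof -
  obtain n s \<rho> C where n: "even n" and s: "\<And>i. s i \<ge> 0" and \<rho>: "\<rho> > 0" and C: "C > 0" and smooth:
    "\<And>f Df k a a' x. smooth1 f Df \<Longrightarrow> (\<And>x. norm x = 1 \<Longrightarrow> \<bar>f x\<bar> \<le> 1) \<Longrightarrow> norm x = 1 \<Longrightarrow>
       (\<And>i. a i \<ge> 0) \<Longrightarrow> (\<And>i. a' i \<ge> 0) \<Longrightarrow>
       \<bar>(\<integral>b. f (J b n *v (J a k *v x)) \<partial>tent_measure n s \<rho>) - (\<integral>b. f (J b n *v (J a' k *v x)) \<partial>tent_measure n s \<rho>)\<bar>
          \<le> C * (\<Sum>j<k. \<bar>a j - a' j\<bar>)"
    by (rule smoothing) blast
  let ?N = "tent_measure n s \<rho>"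
  interpret N: finite_measure ?N using finite_tent_measure \<rho> by simp
  interpret PL: prob_space "L n" by (rule prob_L)
  define m where "m = measure ?N (space ?N)"
  have m: "m > 0" unfolding m_def using \<rho> by (rule measure_tent_measure_pos)
  have setsN: "sets ?N = sets (L n)" by (simp only: sets_tent_measure sets_L)
  have mJN[measurable]: "(\<lambda>b. J b n) \<in> borel_measurable ?N"
    by (subst measurable_cong_sets[OF setsN refl]) measurable
  have ac: "absolutely_continuous (L n) ?N"
    unfolding tent_measure_def
  proof (rule absolutely_continuous_PiM)
    show "sigma_finite_measure (tent_density (s j) \<rho>)" for j
      using finite_tent_density \<rho> by (intro finite_measure.axioms(1)) auto
    show "absolutely_continuous D (tent_density (s j) \<rho>)" for j by (rule tent_absolutely_continuous[OF s])
  qed (auto intro: D.sigma_finite_measure_axioms)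
  obtain d where d: "d > 0" "\<And>B. B \<in> sets (L n) \<Longrightarrow> measure (L n) B < d \<Longrightarrow> measure ?N B < m / 4"
    using absolutely_continuous_epsilon_delta[OF PL.finite_measure_axioms N.finite_measure_axioms setsN ac, of "m / 4"] m
    by auto
  \<comment> \<open>\<open>r\<close> is chosen so that changing \<open>k\<close> durations by at
    most \<open>r\<close> moves the smeared law by at most \<open>m / 8\<close>. The added 1 avoids
    a division by zero when \<open>k = 0\<close>.\<close>
  define C8 where "C8 = C * (real k + 1)"
  have C8: "C8 > 0" unfolding C8_def using C by simp
  define r where "r = m / (8 * C8)"
  have r: "r > 0" unfolding r_def using m C8 by simp
  define Q where "Q z = distr ?N borel (\<lambda>b. J b n *v z)" for z
  have finQ: "finite_measure (Q z)" for z unfolding Q_def by (rule N.finite_measure_distr) measurable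
  have measQ: "measure (Q z) A = measure ?N {b \<in> space ?N. J b n *v z \<in> A}" if "A \<in> sets borel" for z A
    unfolding Q_def using that by (subst measure_distr) (auto intro!: arg_cong[of _ _ "measure ?N"])
  have close: "measure (Q (J b k *v x)) A - measure (Q (J b' k *v x)) A \<le> m / 8"
    if x: "norm x = 1" and b: "\<And>j. b j \<ge> 0" "\<And>j. b' j \<ge> 0" "\<And>j. j < k \<Longrightarrow> \<bar>b j - b' j\<bar> \<le> r" and A: "A \<in> sets borel" for x b b' A
  proof (rule measure_diff_le_of_polynomials[of _ _ "sphere 0 1"])
    show "AE y in Q (J b k *v x). y \<in> sphere 0 1" "AE y in Q (J b' k *v x). y \<in> sphere 0 1"
      unfolding Q_def using x by (subst AE_distr_iff; simp)+
    fix f :: "complex^'n \<Rightarrow> real" assume f: "real_polynomial_function f" "\<And>y. y \<in> sphere 0 1 \<Longrightarrow> \<bar>f y\<bar> \<le> 1"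
    obtain Df where Df: "smooth1 f Df" using polynomial_smooth1[OF f(1)] by blast
    have [measurable]: "f \<in> borel_measurable borel"
      using f(1) by (intro borel_measurable_continuous_onI continuous_on_polymonial_function) (simp add: real_polynomial_function_eq)
    have "(\<integral>y. f y \<partial>Q (J b k *v x)) - (\<integral>y. f y \<partial>Q (J b' k *v x)) \<le> C * (\<Sum>j<k. \<bar>b j - b' j\<bar>)"
      unfolding Q_def using smooth[of f Df x b b' k] Df f(2) x b by (simp add: integral_distr abs_le_iff)
    also have "\<dots> \<le> C * (\<Sum>j<k. r)" using b(3) C by (intro mult_left_mono sum_mono) auto
    also have "\<dots> \<le> C * ((real k + 1) * r)" using C r by (simp add: mult_right_mono)
    also have "\<dots> = m / 8" unfolding r_def mult.assoc[symmetric] C8_def[symmetric] using C8 by simp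
    finally show "(\<integral>y. f y \<partial>Q (J b k *v x)) - (\<integral>y. f y \<partial>Q (J b' k *v x)) \<le> m / 8" .
  qed (use finQ A m in \<open>auto simp: Q_def\<close>)
  show ?thesis
  proof (rule that[of n r "d / 2"])
    fix f :: "complex^'n \<Rightarrow> real" and x x' :: "complex^'n" and a a' b b' :: "nat \<Rightarrow> real"
    assume f: "f \<in> borel_measurable borel" "\<And>x. 0 \<le> f x \<and> f x \<le> 1" and x: "norm x = 1" "norm x' = 1"
      and a: "\<And>j. a j \<ge> 0" "\<And>j. a' j \<ge> 0" "J a k *v x = J a' k *v x'"
      and b: "\<And>j. j < k \<Longrightarrow> a j \<le> b j \<and> b j \<le> a j + r" "\<And>j. j < k \<Longrightarrow> a' j \<le> b' j \<and> b' j \<le> a' j + r"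
    have [measurable]: "f \<in> borel_measurable borel" by fact
    \<comment> \<open>\<open>smooth\<close> asks for nonnegative durations at every index, while
      \<open>b\<close> and \<open>b'\<close> are controlled below \<open>k\<close> only.\<close>
    let ?b = "\<lambda>j. if j < k then b j else 0" and ?b' = "\<lambda>j. if j < k then b' j else 0"
    have Jb: "J b k = J ?b k" "J b' k = J ?b' k" by (auto intro!: J_cong)
    have pos: "?b j \<ge> 0" "?b' j \<ge> 0" for j using b[of j] a(1,2)[of j] by auto
    define z where "z = J b k *v x"
    define z' where "z' = J b' k *v x'"
    have cl: "measure (Q z) A - measure (Q z') A \<le> m / 4" if A: "A \<in> sets borel" for A
    proof -
      have "measure (Q z) A - measure (Q (J a k *v x)) A \<le> m / 8"
        unfolding z_def Jb using b(1) by (intro close x a(1) pos A) force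
      moreover have "measure (Q (J a' k *v x')) A - measure (Q z') A \<le> m / 8"
        unfolding z'_def Jb using b(2) by (intro close x a(2) pos A) force
      ultimately show ?thesis using a(3) by simp
    qed
    show "R 0 n f (J b k *v x) - R 0 n f (J b' k *v x') \<le> 1 - d / 2"
    proof (rule ccontr)
      assume "\<not> ?thesis"
      then have big: "R 0 n f z - R 0 n f z' > 1 - d / 2" by (simp add: z_def z'_def)
      have int: "integrable (L n) (\<lambda>b. f (J b n *v y))" for y
        using f(2) by (intro PL.integrable_const_bound[of _ 1]) auto
      have Rz: "R 0 n f y = (\<integral>b. f (J b n *v y) \<partial>L n)" for y by (rule R_integral[OF f])
      \<comment> \<open>A gap above \<open>1 - d / 2\<close> puts the mean of \<open>f\<close>
        within \<open>d / 2\<close> of 1 from \<open>z\<close> and of 0 from \<open>z'\<close>. By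
        Markov's inequality at level 1/2, the bad events \<open>?B\<close> and \<open>?B'\<close>
        then have probability below \<open>d\<close>, hence small mass under the smearing
        measure.\<close>
      let ?A = "{y. f y \<ge> 1/2}"
      have A: "?A \<in> sets borel" by measurable
      let ?B = "{b \<in> space (L n). J b n *v z \<notin> ?A}" and ?B' = "{b \<in> space (L n). J b n *v z' \<in> ?A}"
      have Bs: "?B \<in> sets (L n)" "?B' \<in> sets (L n)" by measurable
      have iI: "integrable (L n) (\<lambda>b. (1/2) * indicator B b :: real)" if "B \<in> sets (L n)" for B
        using that PL.emeasure_finite by (auto simp: less_top[symmetric])
      have "(1/2) * measure (L n) ?B = (\<integral>b. (1/2) * indicator ?B b \<partial>L n)" using Bs by simp
      also have "\<dots> \<le> (\<integral>b. 1 - f (J b n *v z) \<partial>L n)"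
      proof (rule integral_mono[OF iI[OF Bs(1)]])
        show "(1/2) * indicator ?B b \<le> 1 - f (J b n *v z)" for b
          using f(2)[of "J b n *v z"] by (simp add: indicator_def)
      qed (use int in simp)
      also have "\<dots> = 1 - R 0 n f z" using int by (simp add: Rz PL.prob_space)
      finally have 1: "measure (L n) ?B < d"
        using big R_bounds[OF f, of 0 n z'] by (simp add: field_simps)
      have "(1/2) * measure (L n) ?B' = (\<integral>b. (1/2) * indicator ?B' b \<partial>L n)" using Bs by simp
      also have "\<dots> \<le> (\<integral>b. f (J b n *v z') \<partial>L n)"
      proof (rule integral_mono[OF iI[OF Bs(2)]])
        show "(1/2) * indicator ?B' b \<le> f (J b n *v z')" for b
          using f(2)[of "J b n *v z'"] by (simp add: indicator_def)
      qed (use int in simp)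
      finally have 2: "measure (L n) ?B' < d"
        using big R_bounds[OF f, of 0 n z] by (simp add: Rz field_simps)
      have sp: "space ?N = space (L n)" using setsN by (rule sets_eq_imp_space_eq)
      have "measure ?N ?B < m / 4" "measure ?N ?B' < m / 4" using d(2) Bs 1 2 by auto
      moreover have "measure (Q z') ?A = measure ?N ?B'" using measQ[OF A] by (simp add: sp)
      moreover have "measure (Q z) ?A = m - measure ?N ?B"
      proof -
        have "measure ?N (space ?N - ?B) = m - measure ?N ?B"
          unfolding m_def using Bs setsN by (intro N.finite_measure_compl) auto
        moreover have "space ?N - ?B = {b \<in> space ?N. J b n *v z \<in> ?A}" by (auto simp: sp)
        ultimately show ?thesis using measQ[OF A] by simp
      qed
      \<comment> \<open>From \<open>z\<close> the set \<open>?A\<close> carries more than three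
        quarters of \<open>m\<close>, from \<open>z'\<close> less than one quarter; this exceeds the
        admissible difference \<open>m / 4\<close>.\<close>
      ultimately show False using cl[OF A] m by linarith
    qed
  qed (use n r d in auto)
qed

end

section \<open>Uniform steering and the Doeblin condition\<close>

context controlled_chain begin

lemma measure_D_interval_pos:
  assumes "0 \<le> a" "a < b" shows "measure D {a..b} > 0"
proof -
  have "emeasure D {a..b} \<noteq> 0"
  proof
    assume "emeasure D {a..b} = 0"
    then have "{a..b} \<in> null_sets D" by (intro null_setsI) auto
    then have "AE x in lborel. x \<in> {a..b} \<longrightarrow> g x = 0"
      using null_sets_density_iff[of g lborel "{a..b}"] g_meas by (simp add: D_density)
    then have "AE x in lborel. x \<notin> {a..b}"
    proof eventually_elim
      case (elim x)
      then show ?case using g_pos[of x] assms(1) by (cases "x \<in> {a..b}") auto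
    qed
    then have "emeasure lborel {a..b} = 0"
      by (subst AE_iff_measurable[of "{a..b}" lborel "\<lambda>x. x \<notin> {a..b}", symmetric]) auto
    then show False using assms by simp
  qed
  then show ?thesis by (simp add: D.emeasure_eq_measure less_le)
qed

text \<open>Every window of length \<open>r\<close> starting between 0 and \<open>M\<close> contains
  a cell of a fixed grid of mesh \<open>r / 2\<close>. Only finitely many cells are concerned, and
  each has positive probability, so their minimum is a uniform bound.\<close>

lemma uniform_window_prob:
  assumes r: "r > 0" and M: "M \<ge> 0"
  obtains p where "p > 0" "p \<le> 1" "\<And>s. 0 \<le> s \<Longrightarrow> s \<le> M \<Longrightarrow> p \<le> measure D {s..s + r}"
proof -
  define N where "N = nat \<lceil>2 * M / r\<rceil>"
  define q where "q i = measure D {real i * (r / 2)..real (Suc i) * (r / 2)}" for i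
  have q: "q i > 0" for i unfolding q_def using r by (intro measure_D_interval_pos) auto
  define p where "p = Min (q ` {..N})"
  have p: "p > 0" unfolding p_def using q by (subst Min_gr_iff) auto
  have pq: "p \<le> q i" if "i \<le> N" for i unfolding p_def using that by (intro Min_le) auto
  have "p \<le> measure D {s..s + r}" if s: "0 \<le> s" "s \<le> M" for s
  proof -
    define i where "i = nat \<lceil>2 * s / r\<rceil>"
    have "2 * s / r \<le> 2 * M / r" using s r by (simp add: divide_right_mono)
    then have iN: "i \<le> N" unfolding i_def N_def by (intro nat_mono ceiling_mono)
    have i1: "2 * s / r \<le> real i" unfolding i_def using s r by (simp add: of_nat_ceiling)
    have i2: "real i < 2 * s / r + 1" unfolding i_def using s r by (simp add: of_nat_nat ceiling_less_iff) linarith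
    have "s \<le> real i * (r / 2)" using i1 r by (simp add: field_simps)
    moreover have "real (Suc i) * (r / 2) \<le> s + r" using i2 r by (simp add: field_simps)
    ultimately have "q i \<le> measure D {s..s + r}" unfolding q_def by (intro D.finite_measure_mono) auto
    then show ?thesis using pq[OF iN] by linarith
  qed
  moreover have "p \<le> 1" using pq[of 0] D.prob_le_1 unfolding q_def by (meson le0 order_trans)
  ultimately show ?thesis using that p by blast
qed

lemma measure_L_box:
  assumes p: "0 \<le> p" "\<And>j. j < k \<Longrightarrow> p \<le> measure D {s j..s j + r}"
  shows "{b \<in> space (L k). \<forall>j<k. s j \<le> b j \<and> b j \<le> s j + r} \<in> sets (L k)"
    and "p ^ k \<le> measure (L k) {b \<in> space (L k). \<forall>j<k. s j \<le> b j \<and> b j \<le> s j + r}"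
proof -
  have e: "{b \<in> space (L k). \<forall>j<k. s j \<le> b j \<and> b j \<le> s j + r} = (\<Pi>\<^sub>E j\<in>{..<k}. {s j..s j + r})"
  proof (rule set_eqI)
    fix b
    show "b \<in> {b \<in> space (L k). \<forall>j<k. s j \<le> b j \<and> b j \<le> s j + r} \<longleftrightarrow> b \<in> (\<Pi>\<^sub>E j\<in>{..<k}. {s j..s j + r})"
      unfolding mem_Collect_eq space_PiM PiE_iff space_D Ball_def lessThan_iff atLeastAtMost_iff by blast
  qed
  show "{b \<in> space (L k). \<forall>j<k. s j \<le> b j \<and> b j \<le> s j + r} \<in> sets (L k)"
    unfolding e by (intro sets_PiM_I_finite) auto
  have "(\<Prod>j<k. p) \<le> (\<Prod>j<k. measure D {s j..s j + r})"
    using p by (intro prod_mono) auto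
  also have "\<dots> = measure (L k) (\<Pi>\<^sub>E j\<in>{..<k}. {s j..s j + r})"
  proof -
    interpret finite_product_prob_space "\<lambda>_. D" "{..<k}" by unfold_locales simp
    show ?thesis by (intro prob_times[symmetric]) simp
  qed
  finally show "p ^ k \<le> measure (L k) {b \<in> space (L k). \<forall>j<k. s j \<le> b j \<and> b j \<le> s j + r}"
    unfolding e by simp
qed

text \<open>Read backwards, these are the states that \<open>n\<close> legs of duration at most
  \<open>M\<close> bring into \<open>Y\<close>. Undoing the last leg first replaces \<open>Y\<close>
  by the continuous image of a compact product.\<close>

lemma compact_backward_orbit:
  assumes "compact Y"
  shows "compact {Jinv a n *v y | a y. (\<forall>j<n. 0 \<le> a j \<and> a j \<le> M) \<and> y \<in> Y}"
  using assms
proof (induction n arbitrary: Y)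
  case 0
  then show ?case by simp
next
  case (Suc n)
  let ?Y = "(\<lambda>(t, y). U n (- t) *v y) ` ({0..M} \<times> Y)"
  have "compact ?Y"
  proof (intro compact_continuous_image compact_Times Suc.prems compact_Icc)
    have "continuous_on UNIV (\<lambda>t. U n (- t))"
      by (rule continuous_on_compose2[OF continuous_U[of UNIV]]) (auto intro!: continuous_intros)
    then have "continuous_on ({0..M} \<times> Y) (\<lambda>p. U n (- fst p))"
      by (rule continuous_on_compose2) (auto intro!: continuous_intros)
    then show "continuous_on ({0..M} \<times> Y) (\<lambda>(t, y). U n (- t) *v y)"
      unfolding case_prod_unfold
      by (intro bounded_bilinear.continuous_on[OF bounded_bilinear_matrix_vector_mult] continuous_intros)
  qed
  then have "compact {Jinv a n *v y | a y. (\<forall>j<n. 0 \<le> a j \<and> a j \<le> M) \<and> y \<in> ?Y}" by (rule Suc.IH)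
  also have "{Jinv a n *v y | a y. (\<forall>j<n. 0 \<le> a j \<and> a j \<le> M) \<and> y \<in> ?Y}
     = {Jinv a (Suc n) *v y | a y. (\<forall>j<Suc n. 0 \<le> a j \<and> a j \<le> M) \<and> y \<in> Y}" (is "?A = ?B")
  proof
    show "?A \<subseteq> ?B"
    proof clarify
      fix a t y assume a: "\<forall>j<n. 0 \<le> a j \<and> a j \<le> M" and t: "t \<in> {0..M}" and y: "y \<in> Y"
      have "Jinv (a(n := t)) n = Jinv a n" by (rule Jinv_cong) simp
      then have "Jinv a n *v (U n (- t) *v y) = Jinv (a(n := t)) (Suc n) *v y"
        by (simp add: matrix_vector_mul_assoc)
      then show "\<exists>a' y'. Jinv a n *v (U n (- t) *v y) = Jinv a' (Suc n) *v y' \<and>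
          (\<forall>j<Suc n. 0 \<le> a' j \<and> a' j \<le> M) \<and> y' \<in> Y"
        using a t y by (intro exI[of _ "a(n := t)"] exI[of _ y]) (auto simp: less_Suc_eq)
    qed
    show "?B \<subseteq> ?A"
    proof clarify
      fix a y assume a: "\<forall>j<Suc n. 0 \<le> a j \<and> a j \<le> M" and y: "y \<in> Y"
      have "U n (- a n) *v y \<in> ?Y" using a y by (intro image_eqI[of _ _ "(a n, y)"]) auto
      then show "\<exists>a' y'. Jinv a (Suc n) *v y = Jinv a' n *v y' \<and> (\<forall>j<n. 0 \<le> a' j \<and> a' j \<le> M) \<and> y' \<in> ?Y"
        using a by (intro exI[of _ a] exI[of _ "U n (- a n) *v y"]) (auto simp: matrix_vector_mul_assoc)
    qed
  qed
  finally show ?case .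
qed

text \<open>Baire: the sphere is the union over \<open>m\<close> of the closed sets of states that can be steered to
  \<open>y0\<close> with durations at most \<open>m\<close>, so one of these sets contains an open piece of the sphere.\<close>
lemma bounded_steering:
  assumes steer: "\<And>x y. norm x = 1 \<Longrightarrow> norm y = 1 \<Longrightarrow> \<exists>s. (\<forall>j. s j \<ge> 0) \<and> J s k *v x = y"
    and y0: "norm y0 = 1"
  obtains v0 e M where "norm v0 = 1" "e > 0" "M \<ge> 0"
    "\<And>x. norm x = 1 \<Longrightarrow> dist x v0 < e \<Longrightarrow> \<exists>a. (\<forall>j. 0 \<le> a j \<and> a j \<le> M) \<and> J a k *v x = y0"
proof -
  define C where "C m = {Jinv a k *v y | a y. (\<forall>j<k. 0 \<le> a j \<and> a j \<le> real m) \<and> y \<in> {y0}}" for m :: nat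
  have clC: "closed (C m)" for m unfolding C_def by (intro compact_imp_closed compact_backward_orbit) auto
  let ?S = "sphere 0 1 :: (complex^'n) set"
  have cover: "\<exists>m. x \<in> C m" if x: "norm x = 1" for x
  proof -
    obtain s where s: "\<forall>j. s j \<ge> 0" "J s k *v x = y0" using steer[OF x y0] by blast
    \<comment> \<open>The total duration bounds every single one and so selects a suitable
      \<open>m\<close>.\<close>
    obtain m :: nat where "(\<Sum>j<k. s j) \<le> real m" using real_arch_simple by blast
    then have "s j \<le> real m" if "j < k" for j
      using member_le_sum[of j "{..<k}" s] s(1) that by fastforce
    moreover have "x = Jinv s k *v y0" using s(2) by (metis Jinv_J matrix_vector_mul_assoc matrix_vector_mul_lid)
    ultimately show ?thesis unfolding C_def using s(1) by blast
  qed
  have "\<exists>m. \<not> ?S \<subseteq> closure (?S - C m)"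
  proof (rule ccontr)
    assume "\<not> ?thesis"
    then have dense: "?S \<subseteq> closure (?S - C m)" for m by blast
    have "?S \<subseteq> closure (\<Inter>(range (\<lambda>m. ?S - C m)))"
    proof (rule Baire)
      fix T assume "T \<in> range (\<lambda>m. ?S - C m)"
      then obtain m where m: "T = ?S - C m" by blast
      have "openin (top_of_set ?S) (?S - C m)"
        using openin_open_Int[of "- C m" ?S] clC[of m] by (simp add: Diff_eq open_Compl)
      then show "openin (top_of_set ?S) T \<and> ?S \<subseteq> closure T" using dense m by simp
    qed auto
    moreover have emp: "\<Inter>(range (\<lambda>m. ?S - C m)) = {}" using cover by auto
    ultimately have "?S = {}" unfolding emp by (simp only: closure_empty subset_empty)
    moreover have "y0 \<in> ?S" using y0 by simp
    ultimately show False by blast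
  qed
  then obtain m v0 where "v0 \<in> ?S" "v0 \<notin> closure (?S - C m)" by blast
  then have v0: "norm v0 = 1" "v0 \<notin> closure (?S - C m)" by simp_all
  then obtain e where e: "e > 0" "\<And>x. x \<in> ?S - C m \<Longrightarrow> \<not> dist x v0 < e"
    unfolding closure_approachable by blast
  show ?thesis
  proof (rule that[of v0 e "real m"])
    fix x :: "complex^'n" assume x: "norm x = 1" "dist x v0 < e"
    then have "x \<in> C m" using e(2)[of x] by auto
    then obtain a where a: "\<forall>j<k. 0 \<le> a j \<and> a j \<le> real m" "x = Jinv a k *v y0" unfolding C_def by blast
    let ?a = "\<lambda>j. if j < k then a j else 0"
    have "J ?a k = J a k" by (rule J_cong) simp
    moreover have "J a k *v x = y0" using a(2) by (metis J_Jinv matrix_vector_mul_assoc matrix_vector_mul_lid)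
    ultimately show "\<exists>a. (\<forall>j. 0 \<le> a j \<and> a j \<le> real m) \<and> J a k *v x = y0"
      using a(1) by (intro exI[of _ ?a]) auto
  qed (use v0 e in auto)
qed

text \<open>The points of a finite \<open>e / 2\<close>-net are steered exactly to
  \<open>v0\<close>. A nearby start uses the durations of its net point: isometry keeps the distance
  below \<open>e / 2\<close>, and an error of at most \<open>r\<close> in each duration adds at most
  \<open>e / 4\<close>. Finitely many paths have bounded durations, so the windows have uniform
  probability.\<close>

lemma uniform_hitting:
  assumes steer: "\<And>x y. norm x = 1 \<Longrightarrow> norm y = 1 \<Longrightarrow> \<exists>s. (\<forall>j. s j \<ge> 0) \<and> J s k *v x = y"
    and v0: "norm v0 = 1" and e: "e > 0"
  obtains p where "p > 0" "p \<le> 1"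
    "\<And>x. norm x = 1 \<Longrightarrow> p \<le> measure (L k) {b \<in> space (L k). dist (J b k *v x) v0 < e}"
proof -
  obtain K where K: "K > 0" "\<And>s s' n x. norm (J s n *v x - J s' n *v x) \<le> K * (\<Sum>j<n. \<bar>s j - s' j\<bar>) * norm x"
    by (rule J_lipschitz) blast
  have "\<exists>F. finite F \<and> F \<subseteq> sphere 0 1 \<and> sphere 0 1 \<subseteq> (\<Union>y\<in>F. ball y (e / 2) :: (complex^'n) set)"
    using compactE_image[of "sphere 0 1 :: (complex^'n) set" "sphere 0 1" "\<lambda>y. ball y (e / 2)"] e
    by (metis (no_types, lifting) UN_I centre_in_ball compact_sphere half_gt_zero open_ball subsetI)
  then obtain F where F: "finite F" "F \<subseteq> sphere 0 1" "sphere 0 1 \<subseteq> (\<Union>y\<in>F. ball y (e / 2) :: (complex^'n) set)"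
    by blast
  have "\<exists>s. (\<forall>j. s j \<ge> 0) \<and> J s k *v y = v0" if "y \<in> F" for y
    using F(2) that v0 by (intro steer) auto
  then obtain s where s: "\<And>y j. y \<in> F \<Longrightarrow> s y j \<ge> 0" "\<And>y. y \<in> F \<Longrightarrow> J (s y) k *v y = v0" by metis
  define M where "M = (\<Sum>y\<in>F. \<Sum>j<k. s y j)"
  have sM: "s y j \<le> M" if "y \<in> F" "j < k" for y j
  proof -
    have "s y j \<le> (\<Sum>j<k. s y j)" using that s(1) by (intro member_le_sum) auto
    also have "\<dots> \<le> M" unfolding M_def using that s(1) F(1)
      by (intro member_le_sum[of y F "\<lambda>y. \<Sum>j<k. s y j"]) (auto intro: sum_nonneg)
    finally show ?thesis .
  qed
  define K2 where "K2 = K * (real k + 1)"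
  have K2: "K2 > 0" unfolding K2_def using K(1) by simp
  define r where "r = e / (4 * K2)"
  have r: "r > 0" unfolding r_def using e K2 by simp
  have "M \<ge> 0" unfolding M_def using s(1) by (intro sum_nonneg) auto
  then obtain p where p: "p > 0" "p \<le> 1" "\<And>s. 0 \<le> s \<Longrightarrow> s \<le> M \<Longrightarrow> p \<le> measure D {s..s + r}"
    by (rule uniform_window_prob[OF r]) blast
  interpret PL: prob_space "L k" by (rule prob_L)
  show ?thesis
  proof (rule that[of "p ^ k"])
    show "p ^ k > 0" "p ^ k \<le> 1" using p by (auto intro: power_le_one)
    fix x :: "complex^'n" assume x: "norm x = 1"
    then obtain y where y: "y \<in> F" "dist y x < e / 2" using F(3) by fastforce
    let ?E = "{b \<in> space (L k). \<forall>j<k. s y j \<le> b j \<and> b j \<le> s y j + r}"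
    have box: "?E \<in> sets (L k)" "p ^ k \<le> measure (L k) ?E"
      using measure_L_box[of p k "s y" r] p(1,3) s(1)[OF y(1)] sM[OF y(1)] by (auto intro: less_imp_le)
    have "?E \<subseteq> {b \<in> space (L k). dist (J b k *v x) v0 < e}"
    proof clarify
      fix b assume b: "\<forall>j<k. s y j \<le> b j \<and> b j \<le> s y j + r"
      have "norm (J b k *v x - J (s y) k *v x) \<le> K * (\<Sum>j<k. \<bar>b j - s y j\<bar>)" using K(2)[of b k x "s y"] x by simp
      also have "\<dots> \<le> K * (\<Sum>j<k. r)" using b K(1) by (intro mult_left_mono sum_mono) (auto simp: abs_le_iff)
      also have "\<dots> \<le> K2 * r" unfolding K2_def using K(1) r by (simp add: mult.assoc mult_right_mono)
      also have "\<dots> = e / 4" unfolding r_def using K2 by simp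
      finally have 1: "dist (J b k *v x) (J (s y) k *v x) \<le> e / 4" by (simp add: dist_norm)
      have "dist (J (s y) k *v x) v0 = norm (J (s y) k *v (x - y))"
        using s(2)[OF y(1)] by (simp add: dist_norm matrix_vector_mult_diff_distrib)
      then have 2: "dist (J (s y) k *v x) v0 < e / 2" using y(2) by (simp add: dist_norm norm_minus_commute)
      show "dist (J b k *v x) v0 < e" using 1 2 dist_triangle[of "J b k *v x" v0 "J (s y) k *v x"] e by linarith
    qed
    then have "measure (L k) ?E \<le> measure (L k) {b \<in> space (L k). dist (J b k *v x) v0 < e}"
      by (rule PL.finite_measure_mono) measurable
    then show "p ^ k \<le> measure (L k) {b \<in> space (L k). dist (J b k *v x) v0 < e}" using box(2) by linarith
  qed
qed

text \<open>Two independent copies are followed. In the first \<open>k\<close> legs both may enter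
  the neighbourhood of \<open>v0\<close>, in the next \<open>k\<close> legs both may stay close to
  paths leading to the same state \<open>y0\<close>, and the last \<open>n\<close> legs smooth the
  remaining displacement. The lower bounds on these probabilities do not depend on the initial
  states.\<close>

lemma doeblin:
  obtains n \<kappa> where "even n" "0 < \<kappa>" "\<kappa> < 1"
    "\<And>f x y. f \<in> borel_measurable borel \<Longrightarrow> (\<And>x. 0 \<le> f x \<and> f x \<le> 1) \<Longrightarrow> norm x = 1 \<Longrightarrow> norm y = 1 \<Longrightarrow>
       R 0 n f x - R 0 n f y \<le> 1 - \<kappa>"
proof -
  obtain k where k: "even k"
    "\<And>x y. norm x = 1 \<Longrightarrow> norm y = 1 \<Longrightarrow> \<exists>s. (\<forall>j. s j \<ge> 0) \<and> J s k *v x = y"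
    by (rule even_controllable) blast
  obtain n r \<kappa> where n: "even n" and r: "r > 0" and \<kappa>: "\<kappa> > 0" and ov:
    "\<And>f x x' a a' b b'. f \<in> borel_measurable borel \<Longrightarrow> (\<And>x. 0 \<le> f x \<and> f x \<le> 1) \<Longrightarrow> norm x = 1 \<Longrightarrow> norm x' = 1 \<Longrightarrow>
      (\<And>j. a j \<ge> 0) \<Longrightarrow> (\<And>j. a' j \<ge> 0) \<Longrightarrow> J a k *v x = J a' k *v x' \<Longrightarrow>
      (\<And>j. j < k \<Longrightarrow> a j \<le> b j \<and> b j \<le> a j + r) \<Longrightarrow> (\<And>j. j < k \<Longrightarrow> a' j \<le> b' j \<and> b' j \<le> a' j + r) \<Longrightarrow>
      R 0 n f (J b k *v x) - R 0 n f (J b' k *v x') \<le> 1 - \<kappa>"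
    by (rule overlap[of k]) blast
  define y0 :: "complex^'n" where "y0 = axis undefined 1"
  have y0: "norm y0 = 1" by (simp add: y0_def norm_axis_1)
  obtain v0 e M where v0: "norm v0 = 1" "e > 0" "M \<ge> 0"
    "\<And>x. norm x = 1 \<Longrightarrow> dist x v0 < e \<Longrightarrow> \<exists>a. (\<forall>j. 0 \<le> a j \<and> a j \<le> M) \<and> J a k *v x = y0"
    using bounded_steering[OF k(2) y0] by blast
  obtain p where p: "p > 0" "p \<le> 1"
    "\<And>x. norm x = 1 \<Longrightarrow> p \<le> measure (L k) {b \<in> space (L k). dist (J b k *v x) v0 < e}"
    using uniform_hitting[OF k(2) v0(1,2)] by blast
  obtain q where q: "q > 0" "q \<le> 1" "\<And>s. 0 \<le> s \<Longrightarrow> s \<le> M \<Longrightarrow> q \<le> measure D {s..s + r}"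
    using uniform_window_prob[OF r v0(3)] by blast
  \<comment> \<open>The square accounts for the boxes of both copies; the minimum with 1/2 keeps the
    final constant below 1.\<close>
  define lam where "lam = min \<kappa> (1/2) * (q ^ k)\<^sup>2"
  have lam: "lam > 0" "lam \<le> 1/2"
  proof -
    show "lam > 0" unfolding lam_def using \<kappa> q(1) by simp
    have "min \<kappa> (1/2) * (q ^ k)\<^sup>2 \<le> (1/2) * 1"
      using q \<kappa> by (intro mult_mono power_le_one) auto
    then show "lam \<le> 1/2" by (simp add: lam_def)
  qed
  have near: "R 0 (k + n) f x - R 0 (k + n) f y \<le> 1 - lam"
    if f: "f \<in> borel_measurable borel" "\<And>x. 0 \<le> f x \<and> f x \<le> 1" and xy: "norm x = 1" "norm y = 1"
      and d: "dist x v0 < e" "dist y v0 < e" for f x y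
  proof -
    obtain a where "\<forall>j. 0 \<le> a j \<and> a j \<le> M" "J a k *v x = y0" using v0(4)[OF xy(1) d(1)] by blast
    then have a: "\<And>j. 0 \<le> a j" "\<And>j. a j \<le> M" "J a k *v x = y0" by simp_all
    obtain a' where "\<forall>j. 0 \<le> a' j \<and> a' j \<le> M" "J a' k *v y = y0" using v0(4)[OF xy(2) d(2)] by blast
    then have a': "\<And>j. 0 \<le> a' j" "\<And>j. a' j \<le> M" "J a' k *v y = y0" by simp_all
    note b = R_bounds[OF f, of 0 n] and [measurable] = R_measurable[OF f(1), of 0 n]
    have eq: "R 0 (k + n) f z = (\<integral>b. R 0 n f (J b k *v z) \<partial>L k)" for z
      using R_add[of 0 k n f] R_parity[OF k(1), of 0 n] R_integral[of "R 0 n f" 0 1 k z] b by simp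
    show ?thesis unfolding eq lam_def
    proof (rule prob_integral_diff_le[OF prob_L prob_L])
      show "q ^ k \<le> measure (L k) {b \<in> space (L k). \<forall>j<k. a j \<le> b j \<and> b j \<le> a j + r}"
        "{b \<in> space (L k). \<forall>j<k. a j \<le> b j \<and> b j \<le> a j + r} \<in> sets (L k)"
        using measure_L_box[of q k a r] q a by (auto intro: less_imp_le)
      show "q ^ k \<le> measure (L k) {b \<in> space (L k). \<forall>j<k. a' j \<le> b j \<and> b j \<le> a' j + r}"
        "{b \<in> space (L k). \<forall>j<k. a' j \<le> b j \<and> b j \<le> a' j + r} \<in> sets (L k)"
        using measure_L_box[of q k a' r] q a' by (auto intro: less_imp_le)
      fix b b' assume "b \<in> {b \<in> space (L k). \<forall>j<k. a j \<le> b j \<and> b j \<le> a j + r}"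
        "b' \<in> {b \<in> space (L k). \<forall>j<k. a' j \<le> b j \<and> b j \<le> a' j + r}"
      then have "R 0 n f (J b k *v x) - R 0 n f (J b' k *v y) \<le> 1 - \<kappa>"
        using a a' by (intro ov[OF f xy, of a a']) auto
      then show "R 0 n f (J b k *v x) - R 0 n f (J b' k *v y) \<le> 1 - min \<kappa> (1/2)" by simp
    qed (use b q(1) \<kappa> in auto)
  qed
  show ?thesis
  proof (rule that[of "k + (k + n)" "lam * p\<^sup>2"])
    show "0 < lam * p\<^sup>2" using lam p by simp
    have "lam * p\<^sup>2 \<le> (1/2) * 1" using lam p by (intro mult_mono power_le_one) auto
    then show "lam * p\<^sup>2 < 1" by simp
    fix f :: "complex^'n \<Rightarrow> real" and x y :: "complex^'n"
    assume f: "f \<in> borel_measurable borel" "\<And>x. 0 \<le> f x \<and> f x \<le> 1" and xy: "norm x = 1" "norm y = 1"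
    note b = R_bounds[OF f, of 0 "k + n"] and [measurable] = R_measurable[OF f(1), of 0 "k + n"]
    have eq: "R 0 (k + (k + n)) f z = (\<integral>b. R 0 (k + n) f (J b k *v z) \<partial>L k)" for z
      using R_add[of 0 k "k + n" f] R_parity[OF k(1), of 0 "k + n"] R_integral[of "R 0 (k + n) f" 0 1 k z] b by simp
    show "R 0 (k + (k + n)) f x - R 0 (k + (k + n)) f y \<le> 1 - lam * p\<^sup>2"
      unfolding eq
    proof (rule prob_integral_diff_le[OF prob_L prob_L])
      show "p \<le> measure (L k) {b \<in> space (L k). dist (J b k *v x) v0 < e}" by (rule p(3)[OF xy(1)])
      show "p \<le> measure (L k) {b \<in> space (L k). dist (J b k *v y) v0 < e}" by (rule p(3)[OF xy(2)])
      fix b b' assume "b \<in> {b \<in> space (L k). dist (J b k *v x) v0 < e}" "b' \<in> {b \<in> space (L k). dist (J b k *v y) v0 < e}"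
      then show "R 0 (k + n) f (J b k *v x) - R 0 (k + n) f (J b' k *v y) \<le> 1 - lam"
        using xy by (intro near[OF f]) auto
    next
      show "{b \<in> space (L k). dist (J b k *v x) v0 < e} \<in> sets (L k)" by measurable
      show "{b \<in> space (L k). dist (J b k *v y) v0 < e} \<in> sets (L k)" by measurable
      show "(\<lambda>b. R 0 (k + n) f (J b k *v x)) \<in> borel_measurable (L k)" by measurable
      show "(\<lambda>b. R 0 (k + n) f (J b k *v y)) \<in> borel_measurable (L k)" by measurable
    qed (use b p(1) lam in auto)
  qed (use k n in simp)
qed

end

section \<open>Invariance of the uniform measure and geometric ergodicity\<close>

lemma emeasure_lborel_unit_ball_neq_0: "emeasure lborel (ball 0 1 :: 'a::euclidean_space set) \<noteq> 0"
proof
  assume "emeasure lborel (ball 0 1 :: 'a set) = 0"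
  then have "negligible (ball 0 1 :: 'a set)"
    by (intro negligible_iff_null_sets[THEN iffD2] null_sets_completionI null_setsI) auto
  then show False using open_not_negligible[of "ball 0 1 :: 'a set"] by simp
qed

text \<open>Uniqueness of Haar measure: with \<open>B\<close> the unit ball, evaluate
  \<open>\<integral>\<integral> 1\<^sub>A(x + y) 1\<^sub>B(y) d\<mu>(x) d\<lambda>(y)\<close> in both orders.\<close>
lemma lborel_distr_isometry:
  fixes f :: "'a::euclidean_space \<Rightarrow> 'a"
  assumes lin: "linear f" and iso: "\<And>x. norm (f x) = norm x"
  shows "distr lborel borel f = lborel"
proof -
  let ?\<mu> = "distr lborel borel f"
  have f_meas[measurable]: "f \<in> borel_measurable borel"
    using lin linear_conv_bounded_linear linear_continuous_on borel_measurable_continuous_onI by blast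
  have "inj f" using lin iso by (metis linear_injective_0 norm_eq_zero)
  then have surj: "surj f" using lin linear_injective_imp_surjective by blast
  have ball: "emeasure ?\<mu> (ball 0 r) = emeasure lborel (ball 0 r :: 'a set)" for r
  proof -
    have "f -` ball 0 r = ball 0 r" using iso by auto
    then show ?thesis by (simp add: emeasure_distr)
  qed
  have shift: "(\<integral>\<^sup>+ x. h (x + y) \<partial>?\<mu>) = (\<integral>\<^sup>+ x. h x \<partial>?\<mu>)" if [measurable]: "h \<in> borel_measurable borel" for h y
  proof -
    \<comment> \<open>Since \<open>f\<close> is onto, translating its image measure by
      \<open>y\<close> corresponds to translating Lebesgue measure by \<open>z\<close>.\<close>
    obtain z where z: "y = f z" using surj by (metis surjD)
    have "(\<integral>\<^sup>+ x. h (x + y) \<partial>?\<mu>) = (\<integral>\<^sup>+ x. h (f (z + x)) \<partial>lborel)"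
      by (simp add: nn_integral_distr z linear_add[OF lin] add.commute)
    also have "\<dots> = (\<integral>\<^sup>+ x. h (f x) \<partial>distr lborel borel ((+) z))" by (simp add: nn_integral_distr)
    also have "\<dots> = (\<integral>\<^sup>+ x. h x \<partial>?\<mu>)" by (simp add: lborel_distr_plus nn_integral_distr)
    finally show ?thesis .
  qed
  have shift': "(\<integral>\<^sup>+ x. h (x + y) \<partial>lborel) = (\<integral>\<^sup>+ x. h x \<partial>lborel)" if [measurable]: "h \<in> borel_measurable borel" for h :: "'a \<Rightarrow> ennreal" and y
  proof -
    have "(\<integral>\<^sup>+ x. h (x + y) \<partial>lborel) = (\<integral>\<^sup>+ x. h x \<partial>distr lborel borel ((+) y))"
      by (simp add: nn_integral_distr add.commute)
    then show ?thesis by (simp add: lborel_distr_plus)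
  qed
  have [measurable]: "ball 0 1 \<in> sets (borel :: 'a measure)" by simp
  have fin: "emeasure lborel (ball 0 r :: 'a set) < \<infinity>" for r by (rule emeasure_bounded_finite) simp
  interpret mu: sigma_finite_measure ?\<mu>
  proof
    show "\<exists>A. countable A \<and> A \<subseteq> sets ?\<mu> \<and> \<Union>A = space ?\<mu> \<and> (\<forall>a\<in>A. emeasure ?\<mu> a \<noteq> \<infinity>)"
    proof (intro exI[of _ "range (\<lambda>n::nat. ball 0 (real n))"] conjI ballI)
      show "\<Union>(range (\<lambda>n::nat. ball 0 (real n))) = space ?\<mu>"
        using reals_Archimedean2 by (auto simp: dist_norm)
      show "emeasure ?\<mu> a \<noteq> \<infinity>" if "a \<in> range (\<lambda>n::nat. ball 0 (real n))" for a
        using that fin ball by (auto simp: less_top[symmetric])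
    qed auto
  qed
  interpret pair: pair_sigma_finite ?\<mu> "lborel :: 'a measure" ..
  show ?thesis
  proof (rule measure_eqI)
    fix A assume "A \<in> sets ?\<mu>"
    then have [measurable]: "A \<in> sets borel" by simp
    let ?B = "ball 0 1 :: 'a set"
    let ?h = "\<lambda>x y. indicator A (x + y) * indicator ?B y :: ennreal"
    have "emeasure ?\<mu> A * emeasure lborel ?B = (\<integral>\<^sup>+ y. \<integral>\<^sup>+ x. ?h x y \<partial>?\<mu> \<partial>lborel)"
    proof -
      have "(\<integral>\<^sup>+ x. ?h x y \<partial>?\<mu>) = emeasure ?\<mu> A * indicator ?B y" for y
      proof -
        have "(\<integral>\<^sup>+ x. ?h x y \<partial>?\<mu>) = (\<integral>\<^sup>+ x. indicator A (x + y) \<partial>?\<mu>) * indicator ?B y"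
          by (intro nn_integral_multc) measurable
        then show ?thesis using shift[of "indicator A" y] by simp
      qed
      then show ?thesis by (simp only:) (simp add: nn_integral_cmult_indicator)
    qed
    also have "\<dots> = (\<integral>\<^sup>+ x. \<integral>\<^sup>+ y. ?h x y \<partial>lborel \<partial>?\<mu>)"
      by (rule pair.Fubini') measurable
    \<comment> \<open>A translation by \<open>x\<close> in the inner integral moves the dependence
      on \<open>x\<close> from \<open>A\<close> to the ball, so that in the other order of
      integration the measure of the ball under the image measure splits off.\<close>
    also have "\<dots> = (\<integral>\<^sup>+ x. \<integral>\<^sup>+ y. indicator A y * indicator ?B (x - y) \<partial>lborel \<partial>?\<mu>)"
    proof (rule nn_integral_cong)
      fix x
      show "(\<integral>\<^sup>+ y. ?h x y \<partial>lborel) = (\<integral>\<^sup>+ y. indicator A y * indicator ?B (x - y) \<partial>lborel)"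
        using shift'[of "\<lambda>y. indicator A y * indicator ?B (x - y)" x]
        by (simp add: add.commute indicator_def)
    qed
    also have "\<dots> = (\<integral>\<^sup>+ y. \<integral>\<^sup>+ x. indicator A y * indicator ?B (x - y) \<partial>?\<mu> \<partial>lborel)"
      by (rule pair.Fubini'[symmetric]) measurable
    also have "\<dots> = emeasure lborel A * emeasure ?\<mu> ?B"
    proof -
      have "(\<integral>\<^sup>+ x. indicator A y * indicator ?B (x - y) \<partial>?\<mu>) = indicator A y * emeasure ?\<mu> ?B" for y
      proof -
        have "(\<integral>\<^sup>+ x. indicator A y * indicator ?B (x - y) \<partial>?\<mu>) = indicator A y * (\<integral>\<^sup>+ x. indicator ?B (x + - y) \<partial>?\<mu>)"
          unfolding diff_conv_add_uminus by (intro nn_integral_cmult) measurable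
        also have "(\<integral>\<^sup>+ x. indicator ?B (x + - y) \<partial>?\<mu>) = emeasure ?\<mu> ?B"
          by (subst shift) simp_all
        finally show ?thesis .
      qed
      then show ?thesis by (simp only:) (simp add: nn_integral_multc)
    qed
    finally have "emeasure lborel ?B * emeasure ?\<mu> A = emeasure lborel ?B * emeasure lborel A"
      by (simp add: ball mult.commute)
    moreover have "emeasure lborel ?B \<noteq> 0" by (rule emeasure_lborel_unit_ball_neq_0)
    moreover have "emeasure lborel ?B \<noteq> \<top>" using fin[of 1] by simp
    ultimately show "emeasure ?\<mu> A = emeasure lborel A"
      by (simp add: ennreal_mult_cancel_left)
  qed simp
qed

lemma emeasure_unit_ball:
  "emeasure lborel (ball 0 1 :: (complex^'n) set) \<noteq> 0" "emeasure lborel (ball 0 1 :: (complex^'n) set) \<noteq> \<infinity>"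
  using emeasure_bounded_finite[of "ball 0 1 :: (complex^'n) set"] emeasure_lborel_unit_ball_neq_0 by auto

lemma prob_space_pi_star: "prob_space (pi_star :: (complex^'n) measure)"
  unfolding pi_star_def
  by (intro prob_space.prob_space_distr prob_space_uniform_measure)
    (use emeasure_unit_ball in auto)

lemma sets_pi_star [measurable_cong, simp]: "sets pi_star = sets borel"
  by (simp add: pi_star_def)

lemma space_pi_star [simp]: "space pi_star = UNIV"
  by (simp add: pi_star_def)

text \<open>\<open>sgn 0 = 0\<close> lies off the sphere, but the origin is a Lebesgue null
  set.\<close>

lemma AE_pi_star: "AE x in (pi_star :: (complex^'n) measure). norm x = 1"
proof -
  have "AE x in uniform_measure lborel (ball 0 1 :: (complex^'n) set). norm (sgn x) = 1"
    using emeasure_unit_ball AE_lborel_singleton[of "0 :: complex^'n"]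
    by (subst AE_uniform_measure) (auto simp: norm_sgn less_top[symmetric])
  then show ?thesis unfolding pi_star_def by (subst AE_distr_iff) auto
qed

text \<open>A linear isometry preserves Lebesgue measure and the unit ball and commutes with
  \<open>sgn\<close>, so invariance passes from the ball to its radial projection.\<close>

lemma pi_star_invariant:
  fixes V :: "complex^'n^'n"
  assumes iso: "\<And>x. norm (V *v x) = norm x"
  shows "distr pi_star borel (\<lambda>x. V *v x) = pi_star"
proof -
  have lin: "linear (\<lambda>x. V *v x)"
    by (rule bounded_linear.linear[OF bounded_bilinear.bounded_linear_right[OF bounded_bilinear_matrix_vector_mult]])
  have V[measurable]: "(\<lambda>x. V *v x) \<in> borel_measurable borel"
    by (intro borel_measurable_continuous_onI bounded_linear.continuous_on[OF bounded_bilinear.bounded_linear_right[OF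
        bounded_bilinear_matrix_vector_mult]] continuous_on_id)
  let ?B = "ball 0 1 :: (complex^'n) set"
  have eq: "distr (uniform_measure lborel ?B) borel (\<lambda>x. V *v x) = uniform_measure lborel ?B"
  proof (rule measure_eqI)
    fix A assume "A \<in> sets (distr (uniform_measure lborel ?B) borel (\<lambda>x. V *v x))"
    then have A[measurable]: "A \<in> sets borel" by simp
    have "?B \<inter> (\<lambda>x. V *v x) -` A = (\<lambda>x. V *v x) -` (?B \<inter> A)" using iso by auto
    then have "emeasure lborel (?B \<inter> (\<lambda>x. V *v x) -` A) = emeasure (distr lborel borel (\<lambda>x. V *v x)) (?B \<inter> A)"
      by (simp add: emeasure_distr)
    also have "\<dots> = emeasure lborel (?B \<inter> A)" using lborel_distr_isometry[OF lin iso] by simp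
    moreover have "(\<lambda>x. V *v x) -` A \<in> sets lborel" using measurable_sets[OF V A] by simp
    ultimately show "emeasure (distr (uniform_measure lborel ?B) borel (\<lambda>x. V *v x)) A = emeasure (uniform_measure lborel ?B) A"
      by (simp add: emeasure_distr)
  qed simp
  have sgn: "sgn (V *v x) = V *v sgn x" for x
    using linear_scale[OF lin] by (simp add: sgn_div_norm iso)
  have "distr pi_star borel (\<lambda>x. V *v x) = distr (uniform_measure lborel ?B) borel (\<lambda>x. V *v sgn x)"
    unfolding pi_star_def by (subst distr_distr) (auto simp: o_def)
  also have "\<dots> = distr (distr (uniform_measure lborel ?B) borel (\<lambda>x. V *v x)) borel sgn"
    by (subst distr_distr) (auto simp: o_def sgn)
  also have "\<dots> = pi_star" unfolding eq pi_star_def ..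
  finally show ?thesis .
qed

section \<open>Geometric convergence of the transition operators\<close>

context controlled_chain begin

sublocale pi: prob_space "pi_star :: (complex^'n) measure" by (rule prob_space_pi_star)

lemma integral_pi_star_U:
  assumes [measurable]: "f \<in> borel_measurable borel"
  shows "(\<integral>x. f (U k t *v x) \<partial>pi_star) = (\<integral>x. (f x :: real) \<partial>pi_star)"
proof -
  have [measurable]: "(\<lambda>x. U k t *v x) \<in> borel_measurable borel"
    by (intro borel_measurable_continuous_onI bounded_linear.continuous_on[OF bounded_bilinear.bounded_linear_right[OF
        bounded_bilinear_matrix_vector_mult]] continuous_on_id)
  have "(\<integral>x. f (U k t *v x) \<partial>pi_star) = (\<integral>x. f x \<partial>distr pi_star borel (\<lambda>x. U k t *v x))"
    by (subst integral_distr) auto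
  also have "\<dots> = (\<integral>x. f x \<partial>pi_star)" by (subst pi_star_invariant) auto
  finally show ?thesis .
qed

lemma integral_T:
  assumes f[measurable]: "f \<in> borel_measurable borel" and b: "\<And>x. lo \<le> f x \<and> f x \<le> hi"
  shows "(\<integral>x. T k f x \<partial>pi_star) = (\<integral>x. f x \<partial>pi_star)"
proof -
  interpret pair: pair_prob_space D "pi_star :: (complex^'n) measure" ..
  have "\<bar>f x\<bar> \<le> \<bar>lo\<bar> + \<bar>hi\<bar>" for x using b[of x] by linarith
  then have int: "integrable (D \<Otimes>\<^sub>M pi_star) (\<lambda>(t, x). f (U k t *v x))"
    by (intro pair.P.integrable_const_bound[of _ "\<bar>lo\<bar> + \<bar>hi\<bar>"]) (auto simp: case_prod_unfold)
  have "(\<integral>x. T k f x \<partial>pi_star) = (\<integral>t. (\<integral>x. f (U k t *v x) \<partial>pi_star) \<partial>D)"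
    unfolding T_def using pair.Fubini_integral[OF int] by simp
  also have "\<dots> = (\<integral>x. f x \<partial>pi_star)" using D.prob_space by (simp add: integral_pi_star_U)
  finally show ?thesis .
qed

lemma integral_R:
  "f \<in> borel_measurable borel \<Longrightarrow> (\<And>x. lo \<le> f x \<and> f x \<le> hi) \<Longrightarrow> (\<integral>x. R a n f x \<partial>pi_star) = (\<integral>x. f x \<partial>pi_star)"
proof (induction n arbitrary: f)
  case (Suc n)
  have "lo \<le> T (a + n) f x \<and> T (a + n) f x \<le> hi" for x by (rule T_bounds[OF Suc.prems])
  then have "(\<integral>x. R a n (T (a + n) f) x \<partial>pi_star) = (\<integral>x. T (a + n) f x \<partial>pi_star)"
    by (intro Suc.IH T_measurable Suc.prems)
  then show ?case using integral_T[OF Suc.prems] by simp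
qed simp

lemma T_cong: "(\<And>x. norm x = 1 \<Longrightarrow> f x = f' x) \<Longrightarrow> norm x = 1 \<Longrightarrow> T k f x = T k f' x"
  by (simp add: T_def)

text \<open>The evolution never leaves the sphere, so a function may be redefined off it. This turns
  bounds that hold on the sphere into the global bounds with which the operators are
  estimated.\<close>

lemma R_cong:
  "(\<And>x. norm x = 1 \<Longrightarrow> f x = f' x) \<Longrightarrow> norm x = 1 \<Longrightarrow> R a n f x = R a n f' x"
proof (induction n arbitrary: f f')
  case (Suc n)
  show ?case unfolding R.simps by (rule Suc.IH[OF T_cong[OF Suc.prems(1)] Suc.prems(2)])
qed simp

lemma T_affine:
  assumes f[measurable]: "f \<in> borel_measurable borel" and b: "\<And>x. lo \<le> f x \<and> f x \<le> hi"
  shows "T k (\<lambda>x. c * f x + d) = (\<lambda>x. c * T k f x + d)"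
proof
  fix x
  have "\<bar>f x\<bar> \<le> \<bar>lo\<bar> + \<bar>hi\<bar>" for x using b[of x] by linarith
  then have int: "integrable D (\<lambda>t. f (U k t *v x))"
    by (intro D.integrable_const_bound[of _ "\<bar>lo\<bar> + \<bar>hi\<bar>"]) auto
  then show "T k (\<lambda>x. c * f x + d) x = c * T k f x + d"
    unfolding T_def using D.prob_space by simp
qed

lemma R_affine:
  "f \<in> borel_measurable borel \<Longrightarrow> (\<And>x. lo \<le> f x \<and> f x \<le> hi) \<Longrightarrow>
     R a n (\<lambda>x. c * f x + d) = (\<lambda>x. c * R a n f x + d)"
proof (induction n arbitrary: f)
  case (Suc n)
  have b: "lo \<le> T (a + n) f x \<and> T (a + n) f x \<le> hi" for x by (rule T_bounds[OF Suc.prems])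
  show ?case unfolding R.simps T_affine[OF Suc.prems] by (rule Suc.IH[OF T_measurable[OF Suc.prems(1)] b])
qed simp

text \<open>Each Doeblin block shrinks the oscillation over the sphere by
  \<open>1 - \<kappa>\<close>, and by invariance the mean of \<open>f\<close> is also the mean of
  every iterate, hence within its oscillation. The starting index is arbitrary because later
  conditioning restarts the chain in mid-course, possibly with \<open>H2\<close>.\<close>

lemma geometric_ergodicity:
  obtains C q where "C \<ge> 1" "0 < q" "q < 1"
    "\<And>a n f x. f \<in> borel_measurable borel \<Longrightarrow> (\<And>x. 0 \<le> f x \<and> f x \<le> 1) \<Longrightarrow> norm x = 1 \<Longrightarrow>
       \<bar>R a n f x - (\<integral>x. f x \<partial>pi_star)\<bar> \<le> C * q ^ n"
proof -
  obtain n \<kappa> where n: "even n" and \<kappa>: "0 < \<kappa>" "\<kappa> < 1" and db: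
    "\<And>f x y. f \<in> borel_measurable borel \<Longrightarrow> (\<And>x. 0 \<le> f x \<and> f x \<le> 1) \<Longrightarrow> norm x = 1 \<Longrightarrow> norm y = 1 \<Longrightarrow>
       R 0 n f x - R 0 n f y \<le> 1 - \<kappa>"
    by (rule doeblin) blast
  \<comment> \<open>With no steps, the indicator of a point would show a gap of 1 between that point
    and its antipode.\<close>
  have n0: "n > 0"
  proof (rule ccontr)
    assume "\<not> n > 0"
    define y0 :: "complex^'n" where "y0 = axis undefined 1"
    have y0: "norm y0 = 1" by (simp add: y0_def norm_axis_1)
    have "- y0 \<noteq> y0"
    proof
      assume "- y0 = y0"
      then have "2 *\<^sub>R y0 = 0" by (metis scaleR_2 add.left_inverse)
      then show False using y0 by simp
    qed
    then show False using db[of "indicator {y0}" y0 "- y0"] y0 \<kappa> \<open>\<not> n > 0\<close> by (auto simp: indicator_def)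
  qed
  have step: "R 0 n f x - R 0 n f y \<le> (1 - \<kappa>) * h"
    if f: "f \<in> borel_measurable borel" "\<And>x. lo \<le> f x \<and> f x \<le> lo + h" and h: "h \<ge> 0" and xy: "norm x = 1" "norm y = 1"
    for f lo h x y
  proof (cases "h = 0")
    case True
    then show ?thesis using R_bounds[OF f, of 0 n x] R_bounds[OF f, of 0 n y] by simp
  next
    case False
    then have h: "h > 0" using h by simp
    define f' where "f' x = (1 / h) * f x + (- lo / h)" for x
    have f': "f' \<in> borel_measurable borel" using f(1) unfolding f'_def by measurable
    have "0 \<le> f' x \<and> f' x \<le> 1" for x using f(2)[of x] h by (simp add: f'_def field_simps)
    then have "R 0 n f' x - R 0 n f' y \<le> 1 - \<kappa>" by (intro db f' xy)
    moreover have "R 0 n f' = (\<lambda>x. (1 / h) * R 0 n f x + (- lo / h))"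
      unfolding f'_def by (rule R_affine[OF f])
    ultimately show ?thesis using h by (simp add: field_simps)
  qed
  have osc: "R 0 (m * n) f x - R 0 (m * n) f y \<le> (1 - \<kappa>) ^ m * h"
    if f: "f \<in> borel_measurable borel" "\<And>x. lo \<le> f x \<and> f x \<le> lo + h" and h: "h \<ge> 0" and xy: "norm x = 1" "norm y = 1"
    for m f lo h x y
    using that
  proof (induction m arbitrary: f lo h x y)
    case 0
    show ?case using "0.prems"(2)[of x] "0.prems"(2)[of y] by simp
  next
    case (Suc m)
    let ?f = "R 0 n f"
    let ?S = "sphere 0 1 :: (complex^'n) set"
    \<comment> \<open>The contracted oscillation is known on the sphere only. Assigning the infimum
      \<open>lo1\<close> to all other points makes the induction hypothesis applicable without
      changing values on the sphere.\<close>
    define lo1 where "lo1 = Inf (?f ` ?S)"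
    note rb = R_bounds[OF Suc.prems(1,2), of 0 n]
    have bdd: "bdd_below (?f ` ?S)" using rb by (intro bdd_belowI[of _ lo]) auto
    define f1 where "f1 x = (if norm x = 1 then ?f x else lo1)" for x
    have "R 0 n f \<in> borel_measurable borel" by (intro R_measurable Suc.prems)
    then have f1m: "f1 \<in> borel_measurable borel" unfolding f1_def by measurable
    have f1b: "lo1 \<le> f1 z \<and> f1 z \<le> lo1 + (1 - \<kappa>) * h" for z
    proof (cases "norm z = 1")
      case True
      have "lo1 \<le> ?f z" unfolding lo1_def using True bdd by (intro cINF_lower) auto
      moreover have "?f z - (1 - \<kappa>) * h \<le> lo1" unfolding lo1_def
      proof (rule cINF_greatest)
        show "?S \<noteq> {}" using True by auto
        show "?f z - (1 - \<kappa>) * h \<le> ?f y" if "y \<in> ?S" for y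
          using step[OF Suc.prems(1,2,3) True, of y] that by simp
      qed
      ultimately show ?thesis using True by (simp add: f1_def)
    qed (use \<kappa> Suc.prems(3) in \<open>simp add: f1_def\<close>)
    have "R 0 (Suc m * n) f z = R 0 (m * n) f1 z" if "norm z = 1" for z
    proof -
      have "R 0 (Suc m * n) f = R 0 (m * n) (R (m * n + 0) n f)" using R_add[of 0 "m * n" n f] by (simp add: add.commute)
      also have "\<dots> = R 0 (m * n) ?f" using R_parity[of "m * n" 0 n] n by simp
      finally show ?thesis using R_cong[of ?f f1 z 0 "m * n"] that by (simp add: f1_def)
    qed
    moreover have "R 0 (m * n) f1 x - R 0 (m * n) f1 y \<le> (1 - \<kappa>) ^ m * ((1 - \<kappa>) * h)"
      using \<kappa> Suc.prems(3,4,5) by (intro Suc.IH[OF f1m f1b]) auto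
    ultimately show ?case using Suc.prems(4,5) by (simp add: mult_ac)
  qed
  have dev: "\<bar>R 0 k f x - (\<integral>x. f x \<partial>pi_star)\<bar> \<le> (1 - \<kappa>) ^ (k div n)"
    if f: "f \<in> borel_measurable borel" "\<And>x. 0 \<le> f x \<and> f x \<le> 1" and x: "norm x = 1" for f x k
  proof -
    \<comment> \<open>The incomplete block is the last one in time and acts on \<open>f\<close>
      first; its result still has values between 0 and 1, and the complete blocks contract
      it.\<close>
    have R_eq: "R 0 k f = R 0 (k div n * n) (R (k div n * n) (k mod n) f)"
      using R_add[of 0 "k div n * n" "k mod n" f] by simp
    define f' where "f' = R (k div n * n) (k mod n) f"
    have f': "f' \<in> borel_measurable borel" "0 \<le> f' x \<and> f' x \<le> 0 + 1" for x
      unfolding f'_def using R_measurable[OF f(1)] R_bounds[OF f] by auto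
    have d: "R 0 k f y - R 0 k f z \<le> (1 - \<kappa>) ^ (k div n)" if "norm y = 1" "norm z = 1" for y z
      using osc[OF f', of y z "k div n"] that unfolding R_eq f'_def[symmetric] by simp
    have "\<bar>R 0 k f y\<bar> \<le> 1" for y using R_bounds[OF f, of 0 k y] by simp
    then have int: "integrable pi_star (R 0 k f)"
      using R_measurable[OF f(1)] by (intro pi.integrable_const_bound[of _ 1]) auto
    have eq: "(\<integral>x. f x \<partial>pi_star) = (\<integral>y. R 0 k f y \<partial>pi_star)" using integral_R[OF f] by simp
    have "AE y in pi_star. R 0 k f y \<le> R 0 k f x + (1 - \<kappa>) ^ (k div n)"
      using AE_pi_star by eventually_elim (use d x in \<open>simp add: diff_le_eq add.commute\<close>)
    then have "(\<integral>y. R 0 k f y \<partial>pi_star) \<le> R 0 k f x + (1 - \<kappa>) ^ (k div n)" by (intro pi.integral_le_const int)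
    moreover have "AE y in pi_star. R 0 k f x - (1 - \<kappa>) ^ (k div n) \<le> R 0 k f y"
      using AE_pi_star by eventually_elim (use d x in \<open>simp add: diff_le_eq add.commute\<close>)
    then have "R 0 k f x - (1 - \<kappa>) ^ (k div n) \<le> (\<integral>y. R 0 k f y \<partial>pi_star)" by (intro pi.integral_ge_const int)
    ultimately show ?thesis unfolding eq by linarith
  qed
  \<comment> \<open>One block corresponds to \<open>q ^ n\<close>, and the rounding in
    \<open>k div n\<close> loses less than one block, which the factor
    \<open>1 / (1 - \<kappa>)\<close> compensates.\<close>
  define q where "q = root n (1 - \<kappa>)"
  have q: "0 < q" "q < 1" "q ^ n = 1 - \<kappa>"
    unfolding q_def using \<kappa> n0 by (auto simp: real_root_gt_zero real_root_lt_1_iff)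
  have pw: "(1 - \<kappa>) ^ (k div n) \<le> (1 / (1 - \<kappa>)) * q ^ k" for k
  proof -
    have "q ^ n \<le> q ^ (k mod n)" using q n0 by (intro power_decreasing) (auto simp: less_imp_le)
    then have "(q ^ n) ^ (k div n) * q ^ n \<le> (q ^ n) ^ (k div n) * q ^ (k mod n)" using q(1) by (intro mult_left_mono zero_le_power) auto
    also have "\<dots> = q ^ k" by (simp add: power_mult[symmetric] power_add[symmetric])
    finally show ?thesis using q \<kappa> by (simp add: field_simps)
  qed
  define C where "C = 1 / (1 - \<kappa>)"
  have C: "C \<ge> 1" unfolding C_def using \<kappa> by simp
  have even_start: "\<bar>R a k f x - (\<integral>x. f x \<partial>pi_star)\<bar> \<le> C * q ^ k"
    if f: "f \<in> borel_measurable borel" "\<And>x. 0 \<le> f x \<and> f x \<le> 1" and x: "norm x = 1" and a: "even a" for a f x k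
    using order_trans[OF dev[OF f x, of k] pw[of k]] R_parity[OF a, of 0 k] by (simp add: C_def)
  show ?thesis
  \<comment> \<open>The additional \<open>1 / q\<close> pays for the one step spent on reaching an
    even index.\<close>
  proof (rule that[of "C / q" q])
    show "C / q \<ge> 1" using C q by (simp add: field_simps)
    fix a k and f :: "complex^'n \<Rightarrow> real" and x :: "complex^'n"
    assume f: "f \<in> borel_measurable borel" "\<And>x. 0 \<le> f x \<and> f x \<le> 1" and x: "norm x = 1"
    have int01: "0 \<le> (\<integral>x. f x \<partial>pi_star) \<and> (\<integral>x. f x \<partial>pi_star) \<le> 1"
    proof -
      have "integrable pi_star f" using f by (intro pi.integrable_const_bound[of _ 1]) auto
      then show ?thesis using f(2) by (auto intro!: pi.integral_ge_const pi.integral_le_const)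
    qed
    show "\<bar>R a k f x - (\<integral>x. f x \<partial>pi_star)\<bar> \<le> C / q * q ^ k"
    proof (cases "even a")
      case True
      have "C * q ^ k \<le> C / q * q ^ k" using C q by (intro mult_right_mono) (auto simp: field_simps)
      then show ?thesis using even_start[OF f x True, of k] by linarith
    next
      case False
      show ?thesis
      proof (cases k)
        case 0
        have "1 \<le> C / q" using C q by (simp add: field_simps)
        moreover have "\<bar>f x - (\<integral>x. f x \<partial>pi_star)\<bar> \<le> 1" using int01 f(2)[of x] by linarith
        ultimately show ?thesis using 0 by simp
      next
        case (Suc j)
        let ?I = "\<integral>x. f x \<partial>pi_star"
        let ?h = "R (a + 1) j f"
        have hm: "?h \<in> borel_measurable borel" using f by (intro R_measurable)
        have hb: "0 \<le> ?h y \<and> ?h y \<le> 1" for y by (rule R_bounds[OF f])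
        \<comment> \<open>After one step the index is even and the estimate holds uniformly in the
          new state; averaging over the duration preserves it.\<close>
        have "R a k f x = T a ?h x" using R_add[of a 1 j f] Suc by simp
        also have "\<dots> - ?I = (\<integral>t. ?h (U a t *v x) - ?I \<partial>D)"
        proof -
          have "integrable D (\<lambda>t. ?h (U a t *v x))"
          proof (rule D.integrable_const_bound[of _ 1])
            have "(\<lambda>t. U a t *v x) \<in> borel_measurable D" by measurable
            then show "(\<lambda>t. ?h (U a t *v x)) \<in> borel_measurable D" by (rule measurable_compose[OF _ hm])
          qed (use hb in auto)
          then show ?thesis unfolding T_def using D.prob_space by simp
        qed
        finally have "\<bar>R a k f x - ?I\<bar> = \<bar>\<integral>t. ?h (U a t *v x) - ?I \<partial>D\<bar>" by simp
        also have "\<dots> \<le> (C * q ^ j) * measure D (space D)"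
          using False x C q by (intro D.abs_integral_le even_start[OF f]) auto
        also have "\<dots> = C / q * q ^ k" using q Suc D.prob_space by simp
        finally show ?thesis .
      qed
    qed
  qed (use q in auto)
qed

end

section \<open>A strong law of large numbers\<close>

lemma cesaro_mean:
  fixes a :: "nat \<Rightarrow> real"
  assumes "a \<longlonglongrightarrow> l"
  shows "(\<lambda>n. (\<Sum>j<n. a j) / real n) \<longlonglongrightarrow> l"
proof (rule LIMSEQ_I)
  fix r :: real assume r: "0 < r"
  obtain N where N: "\<And>n. n \<ge> N \<Longrightarrow> \<bar>a n - l\<bar> < r / 2"
    using LIMSEQ_D[OF assms, of "r / 2"] r by auto
  define B where "B = (\<Sum>j<N. \<bar>a j - l\<bar>)"
  obtain K where K: "2 * B / r < real K" using reals_Archimedean2 by blast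
  have "norm ((\<Sum>j<n. a j) / real n - l) < r" if n: "n \<ge> max (max N K) 1" for n
  proof -
    have np: "real n > 0" using n by simp
    have "(\<Sum>j<n. a j) / real n - l = (\<Sum>j<n. a j - l) / real n"
      using np by (simp add: sum_subtractf field_simps)
    moreover have "\<bar>\<Sum>j<n. a j - l\<bar> \<le> (\<Sum>j<n. \<bar>a j - l\<bar>)" by (rule sum_abs)
    moreover have "(\<Sum>j<n. \<bar>a j - l\<bar>) \<le> B + real n * (r / 2)"
    proof -
      have "(\<Sum>j<n. \<bar>a j - l\<bar>) = (\<Sum>j\<in>{0..<N}. \<bar>a j - l\<bar>) + (\<Sum>j\<in>{N..<n}. \<bar>a j - l\<bar>)"
        using sum.atLeastLessThan_concat[of 0 N n "\<lambda>j. \<bar>a j - l\<bar>"] n by (simp add: lessThan_atLeast0)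
      also have "(\<Sum>j\<in>{0..<N}. \<bar>a j - l\<bar>) = B" by (simp add: B_def lessThan_atLeast0)
      also have "(\<Sum>j\<in>{N..<n}. \<bar>a j - l\<bar>) \<le> (\<Sum>j\<in>{N..<n}. r / 2)"
        using N by (intro sum_mono) (simp add: less_imp_le)
      also have "\<dots> \<le> real n * (r / 2)" using r by (simp add: mult_right_mono)
      finally show ?thesis by simp
    qed
    moreover have "B < real n * (r / 2)"
    proof -
      have "2 * B / r < real n" using K n by linarith
      then show ?thesis using r by (simp add: field_simps)
    qed
    moreover have "real n * (r / 2) = real n * r / 2" by simp
    ultimately have "\<bar>\<Sum>j<n. a j - l\<bar> < real n * r" by linarith
    then show ?thesis using np \<open>(\<Sum>j<n. a j) / real n - l = (\<Sum>j<n. a j - l) / real n\<close>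
      by (simp add: pos_divide_less_eq mult.commute)
  qed
  then show "\<exists>no. \<forall>n\<ge>no. norm ((\<Sum>j<n. a j) / real n - l) < r" by blast
qed

text \<open>Injectivity of \<open>h\<close> makes the summands distinct terms of one geometric
  series.\<close>

lemma sum_power_inj_le:
  fixes q :: real
  assumes "0 \<le> q" "q < 1" "finite F" "inj_on h F"
  shows "(\<Sum>j\<in>F. q ^ h j) \<le> 1 / (1 - q)"
proof -
  have "(\<Sum>j\<in>F. q ^ h j) = (\<Sum>m\<in>h ` F. q ^ m)" using assms(4) by (simp add: sum.reindex)
  also have "\<dots> \<le> (\<Sum>m. q ^ m)" using assms by (intro sum_le_suminf summable_geometric) auto
  also have "\<dots> = 1 / (1 - q)" using assms by (intro suminf_geometric) auto
  finally show ?thesis .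
qed

text \<open>Monotonicity traps \<open>S n\<close> between its values at two consecutive subsequence
  indices, whose ratio is close to 1. A subsequence is requested for each \<open>\<delta>\<close>
  because a fixed geometric growth rate leaves a fixed relative error.\<close>

lemma mean_limit_of_subsequences:
  fixes S :: "nat \<Rightarrow> real"
  assumes S: "mono S" "\<And>n. 0 \<le> S n" and m: "0 \<le> m"
    and sub: "\<And>\<delta>. \<delta> > 0 \<Longrightarrow> \<exists>\<nu> :: nat \<Rightarrow> nat. (\<forall>k. \<nu> k > 0) \<and> filterlim \<nu> at_top sequentially \<and>
        (\<forall>\<^sub>F k in sequentially. real (\<nu> (Suc k)) \<le> (1 + 2 * \<delta>) * real (\<nu> k)) \<and>
        (\<lambda>k. S (\<nu> k) / real (\<nu> k)) \<longlonglongrightarrow> m"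
  shows "(\<lambda>n. S n / real n) \<longlonglongrightarrow> m"
proof (rule LIMSEQ_I)
  fix e :: real assume e: "0 < e"
  \<comment> \<open>The errors from the ratio and from the approximation together stay below
    \<open>\<delta> * (4 + 2 * m)\<close>, which this choice makes at most
    \<open>e / 2\<close>.\<close>
  define \<delta> where "\<delta> = min (1/4) (e / (4 + 2 * m) / 2)"
  have \<delta>: "\<delta> > 0" "\<delta> \<le> 1/4"
  proof -
    show "\<delta> > 0" unfolding \<delta>_def using e m by simp
    show "\<delta> \<le> 1/4" unfolding \<delta>_def by (rule min.cobounded1)
  qed
  have \<delta>e: "\<delta> * (4 + 2 * m) < e"
  proof -
    have "\<delta> \<le> e / (4 + 2 * m) / 2" by (simp add: \<delta>_def)
    then have "\<delta> * (4 + 2 * m) \<le> e / 2" using m by (simp add: field_simps)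
    then show ?thesis using e by linarith
  qed
  obtain \<nu> :: "nat \<Rightarrow> nat" where \<nu>: "\<And>k. \<nu> k > 0" "filterlim \<nu> at_top sequentially"
    "\<forall>\<^sub>F k in sequentially. real (\<nu> (Suc k)) \<le> (1 + 2 * \<delta>) * real (\<nu> k)"
    "(\<lambda>k. S (\<nu> k) / real (\<nu> k)) \<longlonglongrightarrow> m" using sub[OF \<delta>(1)] by blast
  have "\<forall>\<^sub>F k in sequentially. \<bar>S (\<nu> k) / real (\<nu> k) - m\<bar> < \<delta>"
    using tendstoD[OF \<nu>(4) \<delta>(1)] by (simp add: dist_real_def)
  then have "\<forall>\<^sub>F k in sequentially. \<bar>S (\<nu> k) / real (\<nu> k) - m\<bar> < \<delta> \<and> real (\<nu> (Suc k)) \<le> (1 + 2 * \<delta>) * real (\<nu> k)"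
    using \<nu>(3) by eventually_elim simp
  then obtain K where K: "\<And>k. k \<ge> K \<Longrightarrow> \<bar>S (\<nu> k) / real (\<nu> k) - m\<bar> < \<delta>"
    "\<And>k. k \<ge> K \<Longrightarrow> real (\<nu> (Suc k)) \<le> (1 + 2 * \<delta>) * real (\<nu> k)"
    unfolding eventually_sequentially by blast
  have "norm (S n / real n - m) < e" if n: "n \<ge> \<nu> K" for n
  proof -
    have ex: "\<exists>j. n < \<nu> (K + Suc j)"
    proof -
      have "\<forall>\<^sub>F k in sequentially. \<nu> k \<ge> Suc n" using \<nu>(2) by (simp add: filterlim_at_top)
      then obtain k0 where "\<And>k. k \<ge> k0 \<Longrightarrow> \<nu> k \<ge> Suc n" unfolding eventually_sequentially by blast
      from this[of "K + Suc k0"] show ?thesis by (intro exI[of _ k0]) simp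
    qed
    define j where "j = (LEAST j. n < \<nu> (K + Suc j))"
    have j1: "n < \<nu> (Suc (K + j))" unfolding j_def using LeastI_ex[OF ex] by simp
    have j2: "\<nu> (K + j) \<le> n"
    proof (cases j)
      case (Suc i)
      then have "\<not> n < \<nu> (K + Suc i)" using not_less_Least[of i "\<lambda>j. n < \<nu> (K + Suc j)"] j_def by simp
      then show ?thesis using Suc by simp
    qed (use n in simp)
    let ?a = "real (\<nu> (K + j))" and ?b = "real (\<nu> (Suc (K + j)))"
    have ab: "?a > 0" "?b > 0" "?b \<le> (1 + 2 * \<delta>) * ?a" "?a \<le> real n" "real n \<le> ?b"
      using \<nu>(1) K(2)[of "K + j"] j1 j2 by auto
    have up: "S n \<le> (m + \<delta>) * ?b"
    proof -
      have "S n \<le> S (\<nu> (Suc (K + j)))" using S(1) j1 by (auto intro: monoD)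
      moreover have "S (\<nu> (Suc (K + j))) / ?b < m + \<delta>" using K(1)[of "Suc (K + j)"] by (simp add: abs_less_iff)
      ultimately show ?thesis using ab by (simp add: field_simps)
    qed
    have low: "(m - \<delta>) * ?a \<le> S n"
    proof -
      have "S (\<nu> (K + j)) \<le> S n" using S(1) j2 by (auto intro: monoD)
      moreover have "m - \<delta> < S (\<nu> (K + j)) / ?a" using K(1)[of "K + j"] by (simp add: abs_less_iff)
      ultimately show ?thesis using ab by (simp add: field_simps)
    qed
    have n0: "real n > 0" using ab by linarith
    have "S n / real n \<le> (m + \<delta>) * (1 + 2 * \<delta>)"
    proof -
      have "S n \<le> (m + \<delta>) * ((1 + 2 * \<delta>) * real n)"
        using ab \<delta> m by (intro order_trans[OF up] mult_left_mono order_trans[OF ab(3)]) auto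
      then show ?thesis using n0 by (simp add: divide_le_eq mult.assoc)
    qed
    also have "\<dots> \<le> m + \<delta> * (4 + 2 * m) - \<delta> / 2"
    proof -
      have "2 * \<delta> * \<delta> \<le> 2 * \<delta> * (1/4)" using \<delta> by (intro mult_left_mono) auto
      then show ?thesis using \<delta> by (simp add: algebra_simps)
    qed
    finally have 1: "S n / real n - m < e" using \<delta>e \<delta> by linarith
    have 2: "m - S n / real n < e"
    \<comment> \<open>Inequalities can be multiplied by \<open>m - \<delta>\<close> only when it is
      nonnegative; for \<open>m \<le> \<delta>\<close> the nonnegativity of \<open>S\<close> already
      suffices.\<close>
    proof (cases "m \<le> \<delta>")
      case True
      have "\<delta> \<le> \<delta> * (4 + 2 * m)" using \<delta> m by (simp add: algebra_simps)
      then show ?thesis using True S(2)[of n] n0 \<delta>e by (smt (verit) divide_nonneg_pos)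
    next
      case False
      have "(m - \<delta>) * (real n * (1 - 2 * \<delta>)) \<le> (m - \<delta>) * ?a"
      proof (intro mult_left_mono)
        have "real n * (1 - 2 * \<delta>) \<le> ((1 + 2 * \<delta>) * ?a) * (1 - 2 * \<delta>)"
          using ab \<delta> by (intro mult_right_mono) auto
        also have "\<dots> = ?a * (1 - (2 * \<delta>) * (2 * \<delta>))" by (simp add: algebra_simps)
        also have "\<dots> \<le> ?a * 1" using ab \<delta> by (intro mult_left_mono) auto
        finally show "real n * (1 - 2 * \<delta>) \<le> ?a" by simp
      qed (use False in simp)
      then have "(m - \<delta>) * (1 - 2 * \<delta>) * real n \<le> S n" using low by (simp add: mult_ac)
      then have "(m - \<delta>) * (1 - 2 * \<delta>) \<le> S n / real n" using n0 by (simp add: le_divide_eq)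
      moreover have "m - (m - \<delta>) * (1 - 2 * \<delta>) \<le> \<delta> * (4 + 2 * m)" using \<delta> m by (simp add: algebra_simps)
      ultimately show ?thesis using \<delta>e by linarith
    qed
    show ?thesis using 1 2 by (simp add: abs_less_iff)
  qed
  then show "\<exists>no. \<forall>n\<ge>no. norm (S n / real n - m) < e" by blast
qed

text \<open>Etemadi's argument: truncate at the index, control the variance along the geometric
  subsequences \<open>\<lceil>\<alpha> ^ k\<rceil>\<close> and interpolate by monotonicity.\<close>
lemma strong_law_of_large_numbers:
  fixes Y \<sigma> :: "nat \<Rightarrow> 'w \<Rightarrow> real" and D :: "real measure"
  assumes M: "prob_space M"
    and Y[measurable]: "\<And>j. Y j \<in> borel_measurable M" and \<sigma>[measurable]: "\<And>j. \<sigma> j \<in> borel_measurable M"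
    and Y_le: "\<And>j \<omega>. 0 \<le> Y j \<omega> \<and> Y j \<omega> \<le> \<sigma> j \<omega>"
    and D: "\<And>j. distr M borel (\<sigma> j) = D" and intD: "integrable D (\<lambda>x. x)"
    and Y'_def: "\<And>j \<omega>. Y' j \<omega> = (if \<sigma> j \<omega> \<le> real j then Y j \<omega> else 0)"
    and cov: "\<And>i j. i < j \<Longrightarrow> (\<integral>\<omega>. Y' i \<omega> * Y' j \<omega> \<partial>M) - (\<integral>\<omega>. Y' i \<omega> \<partial>M) * (\<integral>\<omega>. Y' j \<omega> \<partial>M) \<le> K * q ^ (j - i)"
    and q: "0 < q" "q < 1" and K: "K \<ge> 0"
    and mean: "(\<lambda>j. \<integral>\<omega>. Y' j \<omega> \<partial>M) \<longlonglongrightarrow> m"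
  shows "AE \<omega> in M. (\<lambda>n. (\<Sum>j<n. Y j \<omega>) / real n) \<longlonglongrightarrow> m"
proof -
  interpret prob_space M by fact
  have setsD[measurable_cong]: "sets D = sets borel" using D[of 0] by auto
  interpret D: prob_space D using prob_space_distr[OF \<sigma>[of 0]] by (simp only: D)
  have AE_D: "AE x in D. 0 \<le> x"
    unfolding D[of 0, symmetric] using Y_le[of 0] by (subst AE_distr_iff) (auto intro: order_trans)
  have Y'm[measurable]: "Y' j \<in> borel_measurable M" for j unfolding Y'_def[abs_def] by measurable
  have Y'b: "0 \<le> Y' j \<omega> \<and> Y' j \<omega> \<le> real j" for j \<omega> using Y_le[of j \<omega>] by (auto simp: Y'_def)
  define \<mu> where "\<mu> j = (\<integral>\<omega>. Y' j \<omega> \<partial>M)" for j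
  have iY: "integrable M (Y' j)" for j
    by (rule integrable_const_bound[of _ "real j"]) (use Y'b in auto)
  have \<mu>b: "0 \<le> \<mu> j \<and> \<mu> j \<le> real j" for j
    unfolding \<mu>_def using Y'b iY by (auto intro!: integral_ge_const integral_le_const)
  have iYY: "integrable M (\<lambda>\<omega>. Y' i \<omega> * Y' j \<omega>)" for i j
    by (rule integrable_const_bound[of _ "real i * real j"]) (use Y'b in \<open>auto simp: abs_mult intro!: mult_mono\<close>)
  define Z where "Z j \<omega> = Y' j \<omega> - \<mu> j" for j \<omega>
  have Zm[measurable]: "Z j \<in> borel_measurable M" for j unfolding Z_def[abs_def] by measurable
  have iZZ: "integrable M (\<lambda>\<omega>. Z i \<omega> * Z j \<omega>)" for i j
    unfolding Z_def using iY iYY by (simp add: algebra_simps)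
  have cZ: "(\<integral>\<omega>. Z i \<omega> * Z j \<omega> \<partial>M) = (\<integral>\<omega>. Y' i \<omega> * Y' j \<omega> \<partial>M) - \<mu> i * \<mu> j" for i j
  proof -
    have "(\<integral>\<omega>. Z i \<omega> * Z j \<omega> \<partial>M) = (\<integral>\<omega>. Y' i \<omega> * Y' j \<omega> - \<mu> j * Y' i \<omega> - \<mu> i * Y' j \<omega> + \<mu> i * \<mu> j \<partial>M)"
      by (intro Bochner_Integration.integral_cong refl) (simp add: Z_def algebra_simps)
    also have "\<dots> = (\<integral>\<omega>. Y' i \<omega> * Y' j \<omega> \<partial>M) - \<mu> j * \<mu> i - \<mu> i * \<mu> j + \<mu> i * \<mu> j"
      using iY iYY by (simp add: \<mu>_def prob_space)
    finally show ?thesis by simp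
  qed
  \<comment> \<open>Only the majorants \<open>\<sigma> j\<close> share a law, so the variances of
    the truncated variables are compared with truncated second moments of \<open>D\<close>.\<close>
  define v where "v n = (\<integral>x. (if x \<le> real n then x\<^sup>2 else 0) \<partial>D)" for n
  have iv: "integrable D (\<lambda>x. if x \<le> real n then x\<^sup>2 else 0)" for n
    by (rule D.integrable_const_bound[of _ "(real n)\<^sup>2"]) (use AE_D in \<open>auto intro!: power_mono\<close>)
  have v_mono: "v n \<le> v k" if "n \<le> k" for n k
    unfolding v_def by (rule integral_mono[OF iv iv]) (use that in auto)
  have diag: "(\<integral>\<omega>. Z j \<omega> * Z j \<omega> \<partial>M) \<le> v j" for j
  proof -
    have "(\<integral>\<omega>. Z j \<omega> * Z j \<omega> \<partial>M) \<le> (\<integral>\<omega>. Y' j \<omega> * Y' j \<omega> \<partial>M)"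
      unfolding cZ by simp
    also have "\<dots> \<le> (\<integral>\<omega>. (if \<sigma> j \<omega> \<le> real j then (\<sigma> j \<omega>)\<^sup>2 else 0) \<partial>M)"
    proof (rule integral_mono[OF iYY])
      show "integrable M (\<lambda>\<omega>. if \<sigma> j \<omega> \<le> real j then (\<sigma> j \<omega>)\<^sup>2 else 0)"
        using iv[of j] unfolding D[of j, symmetric] by (subst (asm) integrable_distr_eq) auto
      show "Y' j \<omega> * Y' j \<omega> \<le> (if \<sigma> j \<omega> \<le> real j then (\<sigma> j \<omega>)\<^sup>2 else 0)" for \<omega>
        using Y_le[of j \<omega>] by (auto simp: Y'_def power2_eq_square intro!: mult_mono)
    qed
    also have "\<dots> = v j" unfolding v_def D[of j, symmetric] by (subst integral_distr) auto
    finally show ?thesis .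
  qed
  have off: "(\<integral>\<omega>. Z i \<omega> * Z j \<omega> \<partial>M) \<le> K * q ^ (j - i)" if "i < j" for i j
    unfolding cZ using cov[OF that] by (simp add: \<mu>_def)
  define V where "V n = (\<integral>\<omega>. (\<Sum>j<n. Z j \<omega>)\<^sup>2 \<partial>M)" for n
  \<comment> \<open>Each index has covariances with smaller and with larger indices, and either
    family sums to at most \<open>K / (1 - q)\<close>.\<close>
  define K2 where "K2 = K * (2 / (1 - q))"
  have K2: "K2 \<ge> 0" unfolding K2_def using K q by simp
  have iV: "integrable M (\<lambda>\<omega>. (\<Sum>j<n. Z j \<omega>)\<^sup>2)" for n
    unfolding power2_eq_square sum_product by (intro Bochner_Integration.integrable_sum iZZ)
  have V_le: "V n \<le> real n * (v n + K2)" for n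
  proof -
    have "V n = (\<Sum>i<n. \<Sum>j<n. \<integral>\<omega>. Z i \<omega> * Z j \<omega> \<partial>M)"
      unfolding V_def power2_eq_square sum_product using iZZ
      by (simp add: Bochner_Integration.integral_sum Bochner_Integration.integrable_sum)
    also have "\<dots> \<le> (\<Sum>i<n. v n + K2)"
    proof (rule sum_mono)
      fix i assume i: "i \<in> {..<n}"
      have un: "{..<n} = insert i ({..<i} \<union> {i<..<n})" using i by auto
      have "(\<Sum>j<n. \<integral>\<omega>. Z i \<omega> * Z j \<omega> \<partial>M) = (\<integral>\<omega>. Z i \<omega> * Z i \<omega> \<partial>M)
          + ((\<Sum>j<i. \<integral>\<omega>. Z i \<omega> * Z j \<omega> \<partial>M) + (\<Sum>j\<in>{i<..<n}. \<integral>\<omega>. Z i \<omega> * Z j \<omega> \<partial>M))"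
        by (subst un, subst sum.insert) (auto intro!: sum.union_disjoint)
      also have "\<dots> \<le> v n + ((\<Sum>j<i. K * q ^ (i - j)) + (\<Sum>j\<in>{i<..<n}. K * q ^ (j - i)))"
      proof (intro add_mono sum_mono)
        show "(\<integral>\<omega>. Z i \<omega> * Z i \<omega> \<partial>M) \<le> v n" using diag[of i] v_mono[of i n] i by auto
        show "(\<integral>\<omega>. Z i \<omega> * Z j \<omega> \<partial>M) \<le> K * q ^ (i - j)" if "j \<in> {..<i}" for j
          using off[of j i] that by (simp add: mult.commute)
        show "(\<integral>\<omega>. Z i \<omega> * Z j \<omega> \<partial>M) \<le> K * q ^ (j - i)" if "j \<in> {i<..<n}" for j
          using off[of i j] that by simp
      qed
      also have "(\<Sum>j<i. K * q ^ (i - j)) + (\<Sum>j\<in>{i<..<n}. K * q ^ (j - i)) \<le> K * (1 / (1 - q)) + K * (1 / (1 - q))"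
        unfolding sum_distrib_left[symmetric] using q K
        by (intro add_mono mult_left_mono sum_power_inj_le) (auto simp: inj_on_def)
      finally show "(\<Sum>j<n. \<integral>\<omega>. Z i \<omega> * Z j \<omega> \<partial>M) \<le> v n + K2" by (simp add: K2_def algebra_simps)
    qed
    finally show ?thesis by simp
  qed
  have sub: "AE \<omega> in M. (\<lambda>k. (\<Sum>j<nat \<lceil>\<alpha> ^ k\<rceil>. Z j \<omega>) / real (nat \<lceil>\<alpha> ^ k\<rceil>)) \<longlonglongrightarrow> 0"
    if \<alpha>: "\<alpha> > 1" for \<alpha> :: real
  proof -
    define \<nu> where "\<nu> k = nat \<lceil>\<alpha> ^ k\<rceil>" for k
    have \<alpha>k: "\<alpha> ^ k \<ge> 1" for k using \<alpha> by (simp add: one_le_power)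
    have \<nu>1: "\<alpha> ^ k \<le> real (\<nu> k)" for k unfolding \<nu>_def by (rule of_nat_ceiling)
    have \<nu>2: "real (\<nu> k) \<le> 2 * \<alpha> ^ k" for k
    proof -
      have "real (\<nu> k) < \<alpha> ^ k + 1" unfolding \<nu>_def using \<alpha>k[of k] by (simp add: of_nat_nat ceiling_less_iff) linarith
      then show ?thesis using \<alpha>k[of k] by linarith
    qed
    have \<nu>0: "real (\<nu> k) > 0" for k using \<nu>1[of k] \<alpha>k[of k] by linarith
    have inv: "1 / real (\<nu> k) \<le> (1 / \<alpha>) ^ k" for k
      unfolding power_one_over using \<nu>1[of k] \<alpha>k[of k] by (intro divide_left_mono mult_pos_pos) auto
    define c where "c = 2 * (1 / (1 - 1 / \<alpha>))"
    have i\<alpha>: "0 < 1 / \<alpha>" "1 / \<alpha> < 1" using \<alpha> by auto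
    have c: "c \<ge> 0" unfolding c_def using i\<alpha> by simp
    \<comment> \<open>Only those \<open>k\<close> contribute for which \<open>\<nu> k\<close> has
      reached \<open>x\<close>. From the first such \<open>k0\<close> on the bounds decay
      geometrically, and \<open>x \<le> 2 * \<alpha> ^ k0\<close> turns the leading
      \<open>x\<^sup>2 / \<alpha> ^ k0\<close> into a multiple of \<open>x\<close>. This is how a
      first moment controls the sum of the variances.\<close>
    have pt: "(\<Sum>k<N. (if x \<le> real (\<nu> k) then x\<^sup>2 else 0) / real (\<nu> k)) \<le> c * x" if x: "x \<ge> 0" for x N
    proof -
      let ?F = "{k\<in>{..<N}. x \<le> real (\<nu> k)}"
      have "(\<Sum>k<N. (if x \<le> real (\<nu> k) then x\<^sup>2 else 0) / real (\<nu> k)) = (\<Sum>k\<in>?F. x\<^sup>2 / real (\<nu> k))"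
        by (intro sum.mono_neutral_cong_right) auto
      also have "\<dots> \<le> (\<Sum>k\<in>?F. x\<^sup>2 * (1 / \<alpha>) ^ k)"
        using mult_left_mono[OF inv, of "x\<^sup>2"] by (intro sum_mono) simp
      also have "\<dots> \<le> c * x"
      proof (cases "?F = {}")
        case True
        then show ?thesis unfolding True using c x by simp
      next
        case False
        define k0 where "k0 = Min ?F"
        have finF: "finite ?F" by simp
        have k0: "k0 \<in> ?F" "\<And>k. k \<in> ?F \<Longrightarrow> k0 \<le> k"
          unfolding k0_def by (rule Min_in[OF finF False], rule Min_le[OF finF])
        have "(\<Sum>k\<in>?F. x\<^sup>2 * (1 / \<alpha>) ^ k) = x\<^sup>2 * (1 / \<alpha>) ^ k0 * (\<Sum>k\<in>?F. (1 / \<alpha>) ^ (k - k0))"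
          unfolding sum_distrib_left
        proof (intro sum.cong refl)
          fix k assume "k \<in> ?F"
          then have "k = k0 + (k - k0)" using k0(2) by simp
          then show "x\<^sup>2 * (1 / \<alpha>) ^ k = x\<^sup>2 * (1 / \<alpha>) ^ k0 * (1 / \<alpha>) ^ (k - k0)"
            by (metis mult.assoc power_add)
        qed
        also have "\<dots> \<le> x\<^sup>2 * (1 / \<alpha>) ^ k0 * (1 / (1 - 1 / \<alpha>))"
        proof (intro mult_left_mono sum_power_inj_le)
          show "inj_on (\<lambda>k. k - k0) ?F" using k0(2) by (intro inj_onI) (metis le_add_diff_inverse)
        qed (use i\<alpha> in auto)
        also have "\<dots> \<le> (2 * x) * (1 / (1 - 1 / \<alpha>))"
        proof (intro mult_right_mono)
          have "x \<le> 2 * \<alpha> ^ k0" using k0(1) \<nu>2[of k0] by auto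
          then have "x * x \<le> x * (2 * \<alpha> ^ k0)" using x by (intro mult_left_mono)
          then show "x\<^sup>2 * (1 / \<alpha>) ^ k0 \<le> 2 * x"
            using \<alpha>k[of k0] by (simp add: power2_eq_square power_one_over field_simps)
        qed (use i\<alpha> in simp)
        finally show ?thesis by (simp add: c_def)
      qed
      finally show ?thesis .
    qed
    have sv: "(\<Sum>k<N. v (\<nu> k) / real (\<nu> k)) \<le> c * (\<integral>x. x \<partial>D)" for N
    proof -
      have "(\<Sum>k<N. v (\<nu> k) / real (\<nu> k)) = (\<integral>x. (\<Sum>k<N. (if x \<le> real (\<nu> k) then x\<^sup>2 else 0) / real (\<nu> k)) \<partial>D)"
        unfolding v_def using iv by (simp add: Bochner_Integration.integral_sum)
      also have "\<dots> \<le> (\<integral>x. c * x \<partial>D)"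
      proof (rule integral_mono_AE)
        show "integrable D (\<lambda>x. \<Sum>k<N. (if x \<le> real (\<nu> k) then x\<^sup>2 else 0) / real (\<nu> k))"
          using iv by (intro Bochner_Integration.integrable_sum integrable_divide)
        show "AE x in D. (\<Sum>k<N. (if x \<le> real (\<nu> k) then x\<^sup>2 else 0) / real (\<nu> k)) \<le> c * x"
          using AE_D by eventually_elim (rule pt)
      qed (use intD in simp)
      finally show ?thesis by simp
    qed
    have v0: "v n \<ge> 0" for n unfolding v_def by (intro integral_nonneg_AE) auto
    have V0: "V n \<ge> 0" for n unfolding V_def by (intro integral_nonneg_AE) auto
    have sumV: "summable (\<lambda>k. V (\<nu> k) / (real (\<nu> k))\<^sup>2)"
    proof (rule summable_comparison_test'[where N=0])
      have "summable (\<lambda>k. v (\<nu> k) / real (\<nu> k))"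
        by (rule summableI_nonneg_bounded[OF _ sv]) (use v0 in auto)
      moreover have "summable (\<lambda>k. K2 * (1 / \<alpha>) ^ k)" using i\<alpha> by (intro summable_mult summable_geometric) auto
      ultimately show "summable (\<lambda>k. v (\<nu> k) / real (\<nu> k) + K2 * (1 / \<alpha>) ^ k)" by (rule summable_add)
      fix k
      have "V (\<nu> k) / (real (\<nu> k))\<^sup>2 \<le> (real (\<nu> k) * (v (\<nu> k) + K2)) / (real (\<nu> k))\<^sup>2"
        by (intro divide_right_mono V_le) simp
      also have "\<dots> = v (\<nu> k) / real (\<nu> k) + K2 / real (\<nu> k)" using \<nu>0[of k] by (simp add: power2_eq_square field_simps)
      also have "K2 / real (\<nu> k) \<le> K2 * (1 / \<alpha>) ^ k"
        using mult_left_mono[OF inv K2, of k] by simp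
      finally show "norm (V (\<nu> k) / (real (\<nu> k))\<^sup>2) \<le> v (\<nu> k) / real (\<nu> k) + K2 * (1 / \<alpha>) ^ k"
        using V0[of "\<nu> k"] by simp
    qed
    \<comment> \<open>Since the expectations of the squares are summable, the series of squares is
      almost surely finite and its terms tend to zero.\<close>
    let ?X = "\<lambda>k \<omega>. ((\<Sum>j<\<nu> k. Z j \<omega>) / real (\<nu> k))\<^sup>2"
    have EX: "(\<integral>\<^sup>+\<omega>. ennreal (?X k \<omega>) \<partial>M) = ennreal (V (\<nu> k) / (real (\<nu> k))\<^sup>2)" for k
      unfolding V_def power_divide using iV
      by (subst nn_integral_eq_integral) auto
    have "(\<integral>\<^sup>+\<omega>. (\<Sum>k. ennreal (?X k \<omega>)) \<partial>M) = (\<Sum>k. ennreal (V (\<nu> k) / (real (\<nu> k))\<^sup>2))"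
      by (subst nn_integral_suminf) (auto simp: EX)
    also have "\<dots> \<noteq> \<infinity>"
      using sumV V0 by (subst suminf_ennreal2) auto
    finally have "AE \<omega> in M. (\<Sum>k. ennreal (?X k \<omega>)) \<noteq> \<infinity>"
      by (intro nn_integral_PInf_AE) auto
    then show ?thesis
    proof eventually_elim
      case (elim \<omega>)
      then have "summable (\<lambda>k. ?X k \<omega>)" by (intro summable_suminf_not_top) auto
      then have "(\<lambda>k. ?X k \<omega>) \<longlonglongrightarrow> 0" by (rule summable_LIMSEQ_zero)
      then have "(\<lambda>k. sqrt (?X k \<omega>)) \<longlonglongrightarrow> 0" using tendsto_real_sqrt by fastforce
      then have "(\<lambda>k. \<bar>(\<Sum>j<\<nu> k. Z j \<omega>) / real (\<nu> k)\<bar>) \<longlonglongrightarrow> 0" by simp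
      then show ?case unfolding \<nu>_def by (rule tendsto_rabs_zero_cancel)
    qed
  qed
  \<comment> \<open>At most \<open>x + 1\<close> indices lie below a value \<open>x\<close>, so the
    probabilities of \<open>\<sigma> j > j\<close> sum to at most the mean plus one. By
    Borel-Cantelli the truncation almost surely changes finitely many terms.\<close>
  have trunc: "AE \<omega> in M. \<forall>\<^sub>F j in sequentially. Y' j \<omega> = Y j \<omega>"
  proof -
    have "AE \<omega> in M. \<forall>\<^sub>F j in sequentially. \<omega> \<in> space M - {\<omega> \<in> space M. real j < \<sigma> j \<omega>}"
    proof (rule borel_cantelli_AE1)
      show "emeasure M {\<omega> \<in> space M. real j < \<sigma> j \<omega>} < \<infinity>" for j by (simp add: emeasure_eq_measure)
      have eq: "measure M {\<omega> \<in> space M. real j < \<sigma> j \<omega>} = (\<integral>x. indicator {real j<..} x \<partial>D)" for j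
      proof -
        have "measure D {real j<..} = measure M {\<omega> \<in> space M. real j < \<sigma> j \<omega>}"
          unfolding D[of j, symmetric] by (subst measure_distr) (auto intro!: arg_cong[of _ _ "measure M"])
        moreover have "(\<integral>x. indicator {real j<..} x \<partial>D) = measure D {real j<..}"
          by simp
        ultimately show ?thesis by simp
      qed
      have iI: "integrable D (\<lambda>x. indicator {real j<..} x :: real)" for j
        by (rule D.integrable_const_bound[of _ 1]) auto
      have pt: "(\<Sum>j<N. indicator {real j<..} x) \<le> x + 1" if "x \<ge> 0" for x :: real and N
      proof -
        have "(\<Sum>j<N. indicator {real j<..} x) = real (card {j\<in>{..<N}. real j < x})"
          by (simp add: indicator_def sum.If_cases Int_def flip: of_bool_def)
        also have "card {j\<in>{..<N}. real j < x} \<le> card {..<nat \<lceil>x\<rceil>}"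
          by (intro card_mono) (auto simp: less_ceiling_iff zless_nat_eq_int_zless)
        also have "real (card {..<nat \<lceil>x\<rceil>}) \<le> x + 1" using that by (simp add: of_nat_nat)
        finally show ?thesis by simp
      qed
      show "summable (\<lambda>j. measure M {\<omega> \<in> space M. real j < \<sigma> j \<omega>})"
      proof (rule summableI_nonneg_bounded)
        fix N
        have "(\<Sum>j<N. measure M {\<omega> \<in> space M. real j < \<sigma> j \<omega>}) = (\<integral>x. (\<Sum>j<N. indicator {real j<..} x) \<partial>D)"
          unfolding eq using iI by (subst Bochner_Integration.integral_sum) auto
        also have "\<dots> \<le> (\<integral>x. x + 1 \<partial>D)"
        proof (rule integral_mono_AE)
          show "integrable D (\<lambda>x. \<Sum>j<N. indicator {real j<..} x :: real)" using iI by (rule Bochner_Integration.integrable_sum)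
          show "AE x in D. (\<Sum>j<N. indicator {real j<..} x) \<le> x + 1" using AE_D by eventually_elim (rule pt)
        qed (use intD in simp)
        finally show "(\<Sum>j<N. measure M {\<omega> \<in> space M. real j < \<sigma> j \<omega>}) \<le> (\<integral>x. x + 1 \<partial>D)" .
      qed simp
    qed measurable
    then show ?thesis
    proof eventually_elim
      case (elim \<omega>)
      then show ?case by eventually_elim (auto simp: Y'_def)
    qed
  qed
  have mm: "(\<lambda>n. (\<Sum>j<n. \<mu> j) / real n) \<longlonglongrightarrow> m"
    using mean unfolding \<mu>_def[symmetric] by (rule cesaro_mean)
  have m0: "0 \<le> m" by (rule LIMSEQ_le_const[OF mean]) (use \<mu>b in \<open>auto simp: \<mu>_def\<close>)
  \<comment> \<open>Countably many growth rates arbitrarily close to 1 leave a single exceptional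
    null set.\<close>
  have "AE \<omega> in M. \<forall>p::nat. (\<lambda>k. (\<Sum>j<nat \<lceil>(1 + 1 / real (Suc p)) ^ k\<rceil>. Z j \<omega>) / real (nat \<lceil>(1 + 1 / real (Suc p)) ^ k\<rceil>)) \<longlonglongrightarrow> 0"
    unfolding AE_all_countable by (intro allI sub) simp
  then show ?thesis using trunc
  proof eventually_elim
    case (elim \<omega>)
    define S where "S n = (\<Sum>j<n. Y j \<omega>)" for n
    have diff: "(\<lambda>n. (\<Sum>j<n. Y j \<omega> - Y' j \<omega>) / real n) \<longlonglongrightarrow> 0"
      by (rule cesaro_mean, rule tendsto_eventually) (use elim(2) in \<open>eventually_elim, simp\<close>)
    show ?case unfolding S_def[symmetric]
    proof (rule mean_limit_of_subsequences)
      show "mono S" unfolding S_def using Y_le by (intro monoI sum_mono2) auto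
      show "0 \<le> S n" for n unfolding S_def using Y_le by (intro sum_nonneg) auto
      fix \<delta> :: real assume \<delta>: "\<delta> > 0"
      obtain p :: nat where "inverse (real (Suc p)) < \<delta>" using reals_Archimedean[OF \<delta>] by blast
      then have p: "1 / real (Suc p) < \<delta>" by (simp add: inverse_eq_divide)
      define \<alpha> where "\<alpha> = 1 + 1 / real (Suc p)"
      have \<alpha>: "\<alpha> > 1" "\<alpha> < 1 + \<delta>" unfolding \<alpha>_def using p by auto
      define \<nu> where "\<nu> k = nat \<lceil>\<alpha> ^ k\<rceil>" for k
      have \<alpha>k: "\<alpha> ^ k \<ge> 1" for k using \<alpha> by (simp add: one_le_power)
      have \<nu>1: "\<alpha> ^ k \<le> real (\<nu> k)" for k unfolding \<nu>_def by (rule of_nat_ceiling)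
      have \<nu>2: "real (\<nu> k) \<le> \<alpha> ^ k + 1" for k
        unfolding \<nu>_def using \<alpha>k[of k] by (simp add: of_nat_nat)
      have \<nu>0: "\<nu> k > 0" for k using \<nu>1[of k] \<alpha>k[of k] by (metis gr0I of_nat_0 not_one_le_zero order_trans)
      have \<alpha>lim: "filterlim (\<lambda>k. \<alpha> ^ k) at_top sequentially"
        by (rule filterlim_at_infinity_imp_filterlim_at_top[OF filterlim_realpow_sequentially_gt1])
          (use \<alpha> in \<open>auto intro!: always_eventually\<close>)
      have "filterlim (\<lambda>k. real (\<nu> k)) at_top sequentially"
        by (rule filterlim_at_top_mono[OF \<alpha>lim]) (use \<nu>1 in auto)
      then have \<nu>lim: "filterlim \<nu> at_top sequentially" by (simp add: filterlim_sequentially_iff_filterlim_real)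
      have ratio: "\<forall>\<^sub>F k in sequentially. real (\<nu> (Suc k)) \<le> (1 + 2 * \<delta>) * real (\<nu> k)"
      proof -
        \<comment> \<open>Rounding adds at most 1, which is below
          \<open>\<delta> * \<alpha> ^ k\<close> for large \<open>k\<close>; this explains the
          second \<open>\<delta>\<close> in the ratio.\<close>
        have "\<forall>\<^sub>F k in sequentially. 1 / \<delta> \<le> \<alpha> ^ k" using \<alpha>lim by (simp add: filterlim_at_top)
        then show ?thesis
        proof eventually_elim
          case (elim k)
          then have "1 \<le> \<delta> * \<alpha> ^ k" using \<delta> by (simp add: field_simps)
          have "real (\<nu> (Suc k)) \<le> \<alpha> * \<alpha> ^ k + 1" using \<nu>2[of "Suc k"] by simp
          also have "\<dots> \<le> (1 + \<delta>) * \<alpha> ^ k + \<delta> * \<alpha> ^ k"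
            using \<alpha> \<alpha>k[of k] \<open>1 \<le> \<delta> * \<alpha> ^ k\<close> by (intro add_mono mult_right_mono) auto
          also have "\<dots> = (1 + 2 * \<delta>) * \<alpha> ^ k" by (simp add: algebra_simps)
          also have "\<dots> \<le> (1 + 2 * \<delta>) * real (\<nu> k)" using \<nu>1 \<delta> by (intro mult_left_mono) auto
          finally show ?case .
        qed
      qed
      have z: "(\<lambda>k. (\<Sum>j<\<nu> k. Z j \<omega>) / real (\<nu> k)) \<longlonglongrightarrow> 0"
        using elim(1) unfolding \<nu>_def \<alpha>_def by blast
      have "(\<lambda>k. (\<Sum>j<\<nu> k. Z j \<omega>) / real (\<nu> k) + (\<Sum>j<\<nu> k. \<mu> j) / real (\<nu> k)
          + (\<Sum>j<\<nu> k. Y j \<omega> - Y' j \<omega>) / real (\<nu> k)) \<longlonglongrightarrow> 0 + m + 0"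
        by (intro tendsto_add z filterlim_compose[OF mm \<nu>lim] filterlim_compose[OF diff \<nu>lim])
      moreover have "(\<Sum>j<\<nu> k. Z j \<omega>) / real (\<nu> k) + (\<Sum>j<\<nu> k. \<mu> j) / real (\<nu> k)
          + (\<Sum>j<\<nu> k. Y j \<omega> - Y' j \<omega>) / real (\<nu> k) = S (\<nu> k) / real (\<nu> k)" for k
        unfolding add_divide_distrib[symmetric] sum.distrib[symmetric] S_def by (simp add: Z_def)
      ultimately have "(\<lambda>k. S (\<nu> k) / real (\<nu> k)) \<longlonglongrightarrow> m" by simp
      then show "\<exists>\<nu> :: nat \<Rightarrow> nat. (\<forall>k. \<nu> k > 0) \<and> filterlim \<nu> at_top sequentially \<and>
        (\<forall>\<^sub>F k in sequentially. real (\<nu> (Suc k)) \<le> (1 + 2 * \<delta>) * real (\<nu> k)) \<and>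
        (\<lambda>k. S (\<nu> k) / real (\<nu> k)) \<longlonglongrightarrow> m" using \<nu>0 \<nu>lim ratio by blast
    qed (rule m0)
  qed
qed

section \<open>Time averages\<close>

locale driven_chain = controlled_chain H1 H2 D g
  for H1 H2 :: "complex^'n^'n" and D g +
  fixes M :: "'w measure" and \<tau> :: "nat \<Rightarrow> 'w \<Rightarrow> real"
  assumes prob_M: "prob_space M"
    and \<tau>_meas [measurable]: "\<And>j. \<tau> j \<in> borel_measurable M"
    and \<tau>_indep: "prob_space.indep_vars M (\<lambda>_. borel) \<tau> UNIV"
    and \<tau>_distr: "\<And>j. distr M borel (\<tau> j) = D"
    and \<tau>_pos: "\<And>j. AE \<omega> in M. \<tau> j \<omega> > 0"
    and \<tau>_int: "integrable M (\<tau> 0)"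
begin

sublocale M: prob_space M by (rule prob_M)

lemma AE_D_pos: "AE t in D. t > 0"
  unfolding \<tau>_distr[of 0, symmetric] using \<tau>_pos by (subst AE_distr_iff) auto

lemma integrable_D: "integrable D (\<lambda>t. t)"
  unfolding \<tau>_distr[of 0, symmetric] using \<tau>_int by (subst integrable_distr_eq) auto

lemma law_of_durations: "distr M (L n) (\<lambda>\<omega>. \<lambda>j\<in>{..<n}. \<tau> j \<omega>) = L n"
proof (cases "n = 0")
  \<comment> \<open>For the empty family both laws are probability measures on a space whose only
    measurable sets are the empty set and the whole space.\<close>
  case True
  interpret P: prob_space "distr M (L 0) (\<lambda>\<omega>. \<lambda>j\<in>{..<0}. \<tau> j \<omega>)"
    by (rule M.prob_space_distr) simp
  interpret P': prob_space "L 0" by (rule prob_L)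
  have "distr M (L 0) (\<lambda>\<omega>. \<lambda>j\<in>{..<0}. \<tau> j \<omega>) = L 0"
  proof (rule measure_eqI)
    fix A assume "A \<in> sets (distr M (L 0) (\<lambda>\<omega>. \<lambda>j\<in>{..<0}. \<tau> j \<omega>))"
    then have "A \<in> sets (Pi\<^sub>M {} (\<lambda>_. D))" by (simp only: sets_distr lessThan_0)
    then have "A = {} \<or> A = space (L 0)" unfolding lessThan_0 sets_PiM_empty space_PiM PiE_empty_domain by blast
    then show "emeasure (distr M (L 0) (\<lambda>\<omega>. \<lambda>j\<in>{..<0}. \<tau> j \<omega>)) A = emeasure (L 0) A"
      using P.emeasure_space_1 P'.emeasure_space_1 by (elim disjE) (simp_all only: emeasure_empty space_distr)
  qed simp
  then show ?thesis using True by simp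
next
  case False
  have "M.indep_vars (\<lambda>_. borel) \<tau> {..<n}" using \<tau>_indep by (rule M.indep_vars_subset) simp
  then have "distr M (\<Pi>\<^sub>M j\<in>{..<n}. borel) (\<lambda>\<omega>. \<lambda>j\<in>{..<n}. \<tau> j \<omega>) = (\<Pi>\<^sub>M j\<in>{..<n}. distr M borel (\<tau> j))"
    using False by (subst (asm) M.indep_vars_iff_distr_eq_PiM) auto
  then show ?thesis unfolding \<tau>_distr by (metis distr_cong sets_L)
qed

text \<open>A functional of the durations reads a whole sequence, whereas points of the product
  space carry no information from \<open>n\<close> on; the dependence assumption identifies the two
  readings.\<close>

lemma expectation_durations:
  fixes \<Psi> :: "(nat \<Rightarrow> real) \<Rightarrow> real"
  assumes \<Psi>: "\<Psi> \<in> borel_measurable (L n)" and dep: "\<And>b b'. (\<And>j. j < n \<Longrightarrow> b j = b' j) \<Longrightarrow> \<Psi> b = \<Psi> b'"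
  shows "(\<integral>\<omega>. \<Psi> (\<lambda>j. \<tau> j \<omega>) \<partial>M) = (\<integral>b. \<Psi> b \<partial>L n)"
proof -
  have m: "(\<lambda>\<omega>. \<lambda>j\<in>{..<n}. \<tau> j \<omega>) \<in> measurable M (L n)"
    by (intro measurable_restrict) (auto cong: measurable_cong_sets)
  have "(\<integral>b. \<Psi> b \<partial>L n) = (\<integral>b. \<Psi> b \<partial>distr M (L n) (\<lambda>\<omega>. \<lambda>j\<in>{..<n}. \<tau> j \<omega>))"
    by (simp only: law_of_durations)
  also have "\<dots> = (\<integral>\<omega>. \<Psi> (\<lambda>j\<in>{..<n}. \<tau> j \<omega>) \<partial>M)" using m \<Psi> by (rule integral_distr)
  also have "\<dots> = (\<integral>\<omega>. \<Psi> (\<lambda>j. \<tau> j \<omega>) \<partial>M)"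
    by (intro Bochner_Integration.integral_cong refl dep) simp
  finally show ?thesis by simp
qed

lemma measurable_J_L': "n \<le> m \<Longrightarrow> (\<lambda>b. J b n) \<in> borel_measurable (L m)"
  by (subst measurable_cong_sets[OF sets_L refl]) (intro measurable_J_PiM, auto)

lemma measurable_coord_L: "j < m \<Longrightarrow> (\<lambda>b. b j) \<in> borel_measurable (L m)"
  by (subst measurable_cong_sets[OF sets_L refl]) (intro measurable_component_singleton, auto)

lemma integral_L_Suc:
  fixes \<Psi> :: "(nat \<Rightarrow> real) \<Rightarrow> real"
  assumes "\<Psi> \<in> borel_measurable (L (Suc n))" "\<And>b. \<bar>\<Psi> b\<bar> \<le> B"
  shows "(\<integral>b. \<Psi> b \<partial>L (Suc n)) = (\<integral>b. (\<integral>t. \<Psi> (b(n := t)) \<partial>D) \<partial>L n)"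
proof -
  interpret PS: prob_space "L (Suc n)" by (rule prob_L)
  have fin: "insert n {..<n} = {..<Suc n}" by auto
  have "integrable (L (Suc n)) \<Psi>" using assms by (intro PS.integrable_const_bound[of _ B]) auto
  then show ?thesis using PD.product_integral_insert[of "{..<n}" n \<Psi>] unfolding fin by simp
qed

text \<open>The durations after index \<open>i\<close> are integrated out one by one from the end.
  \<open>\<Gamma>\<close> belongs to the past and is untouched, while each integration applies one
  transition operator to \<open>f\<close>.\<close>

lemma markov_property:
  assumes \<Gamma>: "\<And>n. i < n \<Longrightarrow> \<Gamma> \<in> borel_measurable (L n)" "\<And>b. \<bar>\<Gamma> b\<bar> \<le> B"
      "\<And>b n t. i < n \<Longrightarrow> \<Gamma> (b(n := t)) = \<Gamma> b"
    and f: "f \<in> borel_measurable borel" "\<And>x. lo \<le> f x \<and> f x \<le> hi"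
  shows "(\<integral>b. \<Gamma> b * f (J b (Suc i + m) *v x) \<partial>L (Suc i + m)) = (\<integral>b. \<Gamma> b * R (Suc i) m f (J b (Suc i) *v x) \<partial>L (Suc i))"
  using f
proof (induction m arbitrary: f)
  case (Suc m)
  let ?n = "Suc i + m"
  have fm[measurable]: "f \<in> borel_measurable borel" by fact
  have [measurable]: "\<Gamma> \<in> borel_measurable (L (Suc ?n))" by (rule \<Gamma>) simp
  have [measurable]: "(\<lambda>b. J b (Suc ?n)) \<in> borel_measurable (L (Suc ?n))" by (rule measurable_J_L') simp
  have fb: "\<bar>f x\<bar> \<le> \<bar>lo\<bar> + \<bar>hi\<bar>" for x using Suc.prems(2)[of x] by linarith
  have "(\<integral>b. \<Gamma> b * f (J b (Suc ?n) *v x) \<partial>L (Suc ?n)) = (\<integral>b. (\<integral>t. \<Gamma> (b(?n := t)) * f (J (b(?n := t)) (Suc ?n) *v x) \<partial>D) \<partial>L ?n)"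
  proof (rule integral_L_Suc)
    show "(\<lambda>b. \<Gamma> b * f (J b (Suc ?n) *v x)) \<in> borel_measurable (L (Suc ?n))" by measurable
    show "\<bar>\<Gamma> b * f (J b (Suc ?n) *v x)\<bar> \<le> \<bar>B\<bar> * (\<bar>lo\<bar> + \<bar>hi\<bar>)" for b
      unfolding abs_mult using \<Gamma>(2)[of b] by (intro mult_mono fb) auto
  qed
  also have "\<dots> = (\<integral>b. \<Gamma> b * T ?n f (J b ?n *v x) \<partial>L ?n)"
  proof (intro Bochner_Integration.integral_cong refl)
    fix b
    have "J (b(?n := t)) ?n = J b ?n" for t by (rule J_cong) simp
    then have "\<Gamma> (b(?n := t)) * f (J (b(?n := t)) (Suc ?n) *v x) = \<Gamma> b * f (U ?n t *v (J b ?n *v x))" for t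
      using \<Gamma>(3)[of ?n b t] unfolding J_Suc by (simp add: matrix_vector_mul_assoc)
    then show "(\<integral>t. \<Gamma> (b(?n := t)) * f (J (b(?n := t)) (Suc ?n) *v x) \<partial>D) = \<Gamma> b * T ?n f (J b ?n *v x)"
      by (simp only: T_def integral_mult_right_zero)
  qed
  also have "\<dots> = (\<integral>b. \<Gamma> b * R (Suc i) m (T ?n f) (J b (Suc i) *v x) \<partial>L (Suc i))"
    by (rule Suc.IH[OF T_measurable[OF fm] T_bounds[OF Suc.prems]])
  finally show ?case by simp
qed simp

section \<open>Integrals of an observable over the cycles\<close>

lemma geometric_ergodicity_scaled:
  obtains C q where "C > 0" "0 < q" "q < 1"
    "\<And>a n f x B. f \<in> borel_measurable borel \<Longrightarrow> (\<And>x. 0 \<le> f x \<and> f x \<le> B) \<Longrightarrow> B > 0 \<Longrightarrow> norm x = 1 \<Longrightarrow>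
       \<bar>R a n f x - (\<integral>x. f x \<partial>pi_star)\<bar> \<le> B * C * q ^ n"
proof -
  obtain C q where C: "C \<ge> 1" and q: "0 < q" "q < 1" and geo:
    "\<And>a n f x. f \<in> borel_measurable borel \<Longrightarrow> (\<And>x. 0 \<le> f x \<and> f x \<le> 1) \<Longrightarrow> norm x = 1 \<Longrightarrow>
       \<bar>R a n f x - (\<integral>x. f x \<partial>pi_star)\<bar> \<le> C * q ^ n"
    by (rule geometric_ergodicity) blast
  show ?thesis
  proof (rule that[of C q])
    fix a n and f :: "complex^'n \<Rightarrow> real" and x :: "complex^'n" and B :: real
    assume f: "f \<in> borel_measurable borel" "\<And>x. 0 \<le> f x \<and> f x \<le> B" and B: "B > 0" and x: "norm x = 1"
    let ?f = "\<lambda>x. (1 / B) * f x + 0"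
    have fm: "?f \<in> borel_measurable borel" using f(1) by measurable
    have fb: "0 \<le> ?f x \<and> ?f x \<le> 1" for x using f(2)[of x] B by simp
    have "\<bar>R a n ?f x - (\<integral>x. ?f x \<partial>pi_star)\<bar> \<le> C * q ^ n" by (rule geo[OF fm fb x])
    moreover have "R a n ?f x = (1 / B) * R a n f x + 0" using R_affine[OF f, of a n "1 / B" 0] by simp
    moreover have "(\<integral>x. ?f x \<partial>pi_star) = (1 / B) * (\<integral>x. f x \<partial>pi_star)" by simp
    ultimately have "\<bar>(1 / B) * (R a n f x - (\<integral>x. f x \<partial>pi_star))\<bar> \<le> C * q ^ n"
      by (simp add: right_diff_distrib)
    then show "\<bar>R a n f x - (\<integral>x. f x \<partial>pi_star)\<bar> \<le> B * C * q ^ n"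
      unfolding abs_mult using B by (simp add: field_simps)
  qed (use C q in auto)
qed

text \<open>The contribution of one leg to the time integral. Writing the domain as a condition on
  \<open>s\<close> and \<open>t\<close> makes joint measurability evident and gives the value 0 for
  negative \<open>t\<close>.\<close>

definition occupation :: "(complex^'n \<Rightarrow> real) \<Rightarrow> nat \<Rightarrow> real \<Rightarrow> complex^'n \<Rightarrow> real" where
  "occupation f k t x = (\<integral>s. (if 0 \<le> s \<and> s \<le> t then f (U k s *v x) else 0) \<partial>lborel)"

lemma occupation_measurable:
  assumes [measurable]: "f \<in> borel_measurable borel" "h \<in> borel_measurable N" "z \<in> borel_measurable N"
  shows "(\<lambda>\<omega>. occupation f k (h \<omega>) (z \<omega>)) \<in> borel_measurable N"
  unfolding occupation_def by measurable

lemma occupation_bounds: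
  assumes [measurable]: "f \<in> borel_measurable borel" and f: "\<And>x. 0 \<le> f x \<and> f x \<le> 1"
  shows "0 \<le> occupation f k t x \<and> occupation f k t x \<le> \<bar>t\<bar>"
proof -
  have i1: "integrable lborel (indicator {0..t} :: real \<Rightarrow> real)"
    by (intro integrable_real_indicator) (auto simp: emeasure_lborel_Icc_eq)
  have "occupation f k t x \<le> (\<integral>s. indicator {0..t} s \<partial>lborel)"
    unfolding occupation_def
  proof (rule integral_mono[OF Bochner_Integration.integrable_bound[OF i1] i1])
    show "AE s in lborel. norm (if 0 \<le> s \<and> s \<le> t then f (U k s *v x) else 0) \<le> norm (indicator {0..t} s :: real)"
      using f by (intro AE_I2) (auto simp: indicator_def)
    show "(if 0 \<le> s \<and> s \<le> t then f (U k s *v x) else 0) \<le> indicator {0..t} s" for s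
      using f by (auto simp: indicator_def)
  qed measurable
  also have "\<dots> \<le> \<bar>t\<bar>" by (cases "t \<ge> 0") auto
  finally show ?thesis unfolding occupation_def using f by (auto intro!: integral_nonneg_AE)
qed

text \<open>By Fubini the state is averaged first, and at each time of the leg the invariant measure
  returns the mean of \<open>f\<close>; only the length of the leg remains.\<close>

lemma integral_occupation:
  assumes fm[measurable]: "f \<in> borel_measurable borel" and f: "\<And>x. 0 \<le> f x \<and> f x \<le> 1" and t: "t \<ge> 0"
  shows "(\<integral>x. occupation f k t x \<partial>pi_star) = t * (\<integral>x. f x \<partial>pi_star)"
proof -
  interpret pair: pair_sigma_finite "lborel :: real measure" "pi_star :: (complex^'n) measure" ..
  let ?F = "\<lambda>(s, x). if 0 \<le> s \<and> s \<le> t then f (U k s *v x) else 0"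
  have int: "integrable (lborel \<Otimes>\<^sub>M pi_star) ?F"
  proof (rule Bochner_Integration.integrable_bound)
    have "emeasure (lborel \<Otimes>\<^sub>M (pi_star :: (complex^'n) measure)) ({0..t} \<times> UNIV) = emeasure lborel {0..t} * emeasure (pi_star :: (complex^'n) measure) UNIV"
      by (intro pi.emeasure_pair_measure_Times) auto
    also have "\<dots> < \<infinity>" using pi.emeasure_space_1 t by simp
    finally show "integrable (lborel \<Otimes>\<^sub>M pi_star) (indicator ({0..t} \<times> (UNIV :: (complex^'n) set)) :: _ \<Rightarrow> real)"
      by (intro integrable_real_indicator) auto
    show "AE p in lborel \<Otimes>\<^sub>M pi_star. norm (?F p) \<le> norm (indicator ({0..t} \<times> (UNIV :: (complex^'n) set)) p :: real)"
      using f by (intro AE_I2) (auto simp: indicator_def split: if_splits)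
  qed measurable
  have "(\<integral>x. occupation f k t x \<partial>pi_star) = (\<integral>s. (\<integral>x. (if 0 \<le> s \<and> s \<le> t then f (U k s *v x) else 0) \<partial>pi_star) \<partial>lborel)"
    unfolding occupation_def using pair.Fubini_integral[OF int] by simp
  also have "\<dots> = (\<integral>s. (\<integral>x. f x \<partial>pi_star) * indicator {0..t} s \<partial>lborel)"
    by (intro Bochner_Integration.integral_cong refl) (auto simp: indicator_def integral_pi_star_U)
  also have "\<dots> = t * (\<integral>x. f x \<partial>pi_star)" using t by simp
  finally show ?thesis .
qed

text \<open>Given the past, the truncated integral over cycle \<open>j\<close> has a mean
  \<open>\<phi> j\<close> of the current state. Geometric ergodicity applied to
  \<open>\<phi> j\<close> yields the limit of the means and the decay of the covariances that the
  strong law asks for.\<close>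

lemma occupation_average:
  assumes fm[measurable]: "f \<in> borel_measurable borel" and f: "\<And>x. 0 \<le> f x \<and> f x \<le> 1" and x: "norm x = 1"
  shows "AE \<omega> in M. (\<lambda>n. (\<Sum>j<n. occupation f j (\<tau> j \<omega>) (J (\<lambda>j. \<tau> j \<omega>) j *v x)) / real n)
      \<longlonglongrightarrow> (\<integral>t. t \<partial>D) * (\<integral>x. f x \<partial>pi_star)"
proof -
  obtain C q where C: "C > 0" and q: "0 < q" "q < 1" and geo:
    "\<And>a n f x B. f \<in> borel_measurable borel \<Longrightarrow> (\<And>x. 0 \<le> f x \<and> f x \<le> B) \<Longrightarrow> B > 0 \<Longrightarrow> norm x = 1 \<Longrightarrow>
       \<bar>R a n f x - (\<integral>x. f x \<partial>pi_star)\<bar> \<le> B * C * q ^ n"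
    by (rule geometric_ergodicity_scaled) blast
  define h where "h j t y = (if \<bar>t\<bar> \<le> real j then occupation f j t y else 0)" for j t y
  have hm: "(\<lambda>\<omega>. h j (a \<omega>) (z \<omega>)) \<in> borel_measurable N"
    if [measurable]: "a \<in> borel_measurable N" "z \<in> borel_measurable N" for a z j and N :: "((complex^'n) \<times> real) measure"
  proof -
    note [measurable] = occupation_measurable[OF fm that, of j]
    show ?thesis unfolding h_def by measurable
  qed
  have hb: "0 \<le> h j t y \<and> h j t y \<le> real j" "h j t y \<le> \<bar>t\<bar>" for j t y
    using occupation_bounds[OF fm f, of j t y] by (auto simp: h_def)
  \<comment> \<open>The first moment of a duration bounds all conditional means, whatever the
    truncation level; this makes the covariance estimate uniform in the indices. The added 1 ensures
    positivity.\<close>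
  define B where "B = (\<integral>t. \<bar>t\<bar> \<partial>D) + 1"
  have B: "B > 0" unfolding B_def by (simp add: add_nonneg_pos integral_nonneg_AE)
  define \<phi> where "\<phi> j y = (\<integral>t. h j t y \<partial>D)" for j y
  have \<phi>m: "\<phi> j \<in> borel_measurable borel" for j
  proof -
    have "(\<lambda>p. h j (snd p) (fst p)) \<in> borel_measurable (borel \<Otimes>\<^sub>M D)" by (rule hm) measurable
    then show ?thesis unfolding \<phi>_def[abs_def]
      by (intro D.borel_measurable_lebesgue_integral) (simp add: case_prod_unfold)
  qed
  have mid: "(\<lambda>t. t) \<in> borel_measurable D" by simp
  have ih: "integrable D (\<lambda>t. h j t y)" for j y
  proof (rule D.integrable_const_bound[of _ "real j"])
    show "(\<lambda>t. h j t y) \<in> borel_measurable D"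
      unfolding h_def using occupation_measurable[OF fm mid borel_measurable_const, of j y] by measurable
  qed (use hb in auto)
  have \<phi>b: "0 \<le> \<phi> j y \<and> \<phi> j y \<le> B" for j y
  proof
    show "0 \<le> \<phi> j y" unfolding \<phi>_def using hb by (intro integral_nonneg_AE) auto
    have "\<phi> j y \<le> (\<integral>t. \<bar>t\<bar> \<partial>D)"
      unfolding \<phi>_def using integrable_D hb by (intro integral_mono[OF ih]) auto
    then show "\<phi> j y \<le> B" by (simp add: B_def)
  qed
  define Y' where "Y' j \<omega> = h j (\<tau> j \<omega>) (J (\<lambda>j. \<tau> j \<omega>) j *v x)" for j \<omega>
  define H where "H j b = h j (b j) (J b j *v x)" for j b
  have Hm: "H j \<in> borel_measurable (L n)" if "j < n" for j n
  proof -
    have [measurable]: "(\<lambda>b. J b j) \<in> borel_measurable (L n)" using that by (intro measurable_J_L') simp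
    have a: "(\<lambda>b. b j) \<in> borel_measurable (L n)" using that by (rule measurable_coord_L)
    have b: "(\<lambda>b. J b j *v x) \<in> borel_measurable (L n)" by measurable
    note [measurable] = a occupation_measurable[OF fm a b, of j]
    show ?thesis unfolding H_def[abs_def] h_def by measurable
  qed
  have Hb: "\<bar>H j b\<bar> \<le> real j" for j b using hb by (simp add: H_def)
  have Hdep: "H j b = H j b'" if "\<And>i. i \<le> j \<Longrightarrow> b i = b' i" for j b b'
    using that J_cong[of j b b'] by (simp add: H_def)
  have E1: "(\<integral>\<omega>. Y' j \<omega> * z (J (\<lambda>j. \<tau> j \<omega>) (Suc j) *v x) \<partial>M) = (\<integral>b. H j b * z (J b (Suc j) *v x) \<partial>L (Suc j))"
    if [measurable]: "z \<in> borel_measurable borel" for z j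
  proof -
    have [measurable]: "H j \<in> borel_measurable (L (Suc j))" by (rule Hm) simp
    have "(\<lambda>b. H j b * z (J b (Suc j) *v x)) \<in> borel_measurable (L (Suc j))" by measurable
    then have "(\<integral>\<omega>. H j (\<lambda>j. \<tau> j \<omega>) * z (J (\<lambda>j. \<tau> j \<omega>) (Suc j) *v x) \<partial>M) = (\<integral>b. H j b * z (J b (Suc j) *v x) \<partial>L (Suc j))"
    proof (rule expectation_durations)
      fix b b' :: "nat \<Rightarrow> real" assume e: "\<And>k. k < Suc j \<Longrightarrow> b k = b' k"
      have "H j b = H j b'" using e by (intro Hdep) simp
      moreover have "J b (Suc j) = J b' (Suc j)" using e by (rule J_cong)
      ultimately show "H j b * z (J b (Suc j) *v x) = H j b' * z (J b' (Suc j) *v x)" by (simp only:)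
    qed
    then show ?thesis by (simp only: Y'_def H_def)
  qed
  have EY: "(\<integral>\<omega>. Y' j \<omega> \<partial>M) = R 0 j (\<phi> j) x" for j
  proof -
    have "(\<integral>\<omega>. Y' j \<omega> \<partial>M) = (\<integral>b. H j b \<partial>L (Suc j))" using E1[of "\<lambda>_. 1" j] by simp
    also have "\<dots> = (\<integral>b. (\<integral>t. H j (b(j := t)) \<partial>D) \<partial>L j)" by (rule integral_L_Suc[OF Hm Hb]) simp
    also have "\<dots> = (\<integral>b. \<phi> j (J b j *v x) \<partial>L j)"
    proof (intro Bochner_Integration.integral_cong refl)
      fix b
      have "J (b(j := t)) j = J b j" for t by (rule J_cong) simp
      then show "(\<integral>t. H j (b(j := t)) \<partial>D) = \<phi> j (J b j *v x)" by (simp add: H_def \<phi>_def)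
    qed
    also have "\<dots> = R 0 j (\<phi> j) x" by (rule R_integral[OF \<phi>m \<phi>b, symmetric])
    finally show ?thesis .
  qed
  define \<mu> where "\<mu> j = (\<integral>y. \<phi> j y \<partial>pi_star)" for j
  have EY\<mu>: "\<bar>(\<integral>\<omega>. Y' j \<omega> \<partial>M) - \<mu> j\<bar> \<le> B * C * q ^ j" for j
    unfolding EY \<mu>_def by (rule geo[OF \<phi>m \<phi>b B x])
  have EYb: "0 \<le> (\<integral>\<omega>. Y' j \<omega> \<partial>M) \<and> (\<integral>\<omega>. Y' j \<omega> \<partial>M) \<le> B" for j
    unfolding EY by (rule R_bounds[OF \<phi>m \<phi>b])
  have Y'm: "Y' j \<in> borel_measurable M" for j
  proof -
    have [measurable]: "(\<lambda>\<omega>. J (\<lambda>j. \<tau> j \<omega>) j) \<in> borel_measurable M" by (rule measurable_J) simp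
    have b: "(\<lambda>\<omega>. J (\<lambda>j. \<tau> j \<omega>) j *v x) \<in> borel_measurable M" by measurable
    note [measurable] = occupation_measurable[OF fm \<tau>_meas b, of j]
    show ?thesis unfolding Y'_def[abs_def] h_def by measurable
  qed
  have Y'b: "0 \<le> Y' j \<omega> \<and> Y' j \<omega> \<le> real j" for j \<omega> using hb by (simp add: Y'_def)
  have cov: "(\<integral>\<omega>. Y' i \<omega> * Y' j \<omega> \<partial>M) - (\<integral>\<omega>. Y' i \<omega> \<partial>M) * (\<integral>\<omega>. Y' j \<omega> \<partial>M) \<le> (2 * B * B * C / q) * q ^ (j - i)"
    if ij: "i < j" for i j
  proof -
    \<comment> \<open>Between the end of cycle \<open>i\<close> and the start of cycle
      \<open>j\<close> there are \<open>m\<close> steps, over which the conditional mean of cycle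
      \<open>j\<close> forgets the state.\<close>
    obtain m where m: "j = Suc i + m" using ij less_iff_Suc_add by auto
    let ?z = "R (Suc i) m (\<phi> j)"
    have zm: "?z \<in> borel_measurable borel" by (rule R_measurable[OF \<phi>m])
    have zb: "0 \<le> ?z y \<and> ?z y \<le> B" for y by (rule R_bounds[OF \<phi>m \<phi>b])
    have [measurable]: "H i \<in> borel_measurable (L (Suc j))" "H j \<in> borel_measurable (L (Suc j))"
      using ij by (auto intro!: Hm)
    have "(\<lambda>b. H i b * H j b) \<in> borel_measurable (L (Suc j))" by measurable
    then have "(\<integral>\<omega>. Y' i \<omega> * Y' j \<omega> \<partial>M) = (\<integral>b. H i b * H j b \<partial>L (Suc j))"
    proof (subst expectation_durations[symmetric])
      show "H i b * H j b = H i b' * H j b'" if "\<And>k. k < Suc j \<Longrightarrow> b k = b' k" for b b'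
        using Hdep[of i b b'] Hdep[of j b b'] that ij by simp
    qed (simp_all add: Y'_def H_def)
    also have "\<dots> = (\<integral>b. (\<integral>t. H i (b(j := t)) * H j (b(j := t)) \<partial>D) \<partial>L j)"
    proof (rule integral_L_Suc)
      show "\<bar>H i b * H j b\<bar> \<le> real i * real j" for b unfolding abs_mult using Hb by (intro mult_mono) auto
    qed measurable
    also have "\<dots> = (\<integral>b. H i b * \<phi> j (J b j *v x) \<partial>L j)"
    proof (intro Bochner_Integration.integral_cong refl)
      fix b
      have "J (b(j := t)) j = J b j" for t by (rule J_cong) simp
      moreover have "H i (b(j := t)) = H i b" for t using ij by (intro Hdep) simp
      ultimately show "(\<integral>t. H i (b(j := t)) * H j (b(j := t)) \<partial>D) = H i b * \<phi> j (J b j *v x)"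
        by (simp add: H_def[of j] \<phi>_def)
    qed
    also have "\<dots> = (\<integral>b. H i b * ?z (J b (Suc i) *v x) \<partial>L (Suc i))"
      unfolding m by (rule markov_property[OF Hm Hb _ \<phi>m \<phi>b]) (auto intro: Hdep)
    also have "\<dots> = (\<integral>\<omega>. Y' i \<omega> * ?z (J (\<lambda>j. \<tau> j \<omega>) (Suc i) *v x) \<partial>M)" by (rule E1[OF zm, symmetric])
    also have "\<dots> \<le> (\<integral>\<omega>. Y' i \<omega> * (\<mu> j + B * C * q ^ m) \<partial>M)"
    proof (rule integral_mono)
      have [measurable]: "(\<lambda>\<omega>. J (\<lambda>j. \<tau> j \<omega>) (Suc i)) \<in> borel_measurable M" by (rule measurable_J) simp
      have "(\<lambda>\<omega>. J (\<lambda>j. \<tau> j \<omega>) (Suc i) *v x) \<in> borel_measurable M" by measurable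
      then have zM: "(\<lambda>\<omega>. ?z (J (\<lambda>j. \<tau> j \<omega>) (Suc i) *v x)) \<in> borel_measurable M" by (rule measurable_compose[OF _ zm])
      show "integrable M (\<lambda>\<omega>. Y' i \<omega> * ?z (J (\<lambda>j. \<tau> j \<omega>) (Suc i) *v x))"
      proof (rule M.integrable_const_bound[of _ "real i * B"])
        show "AE \<omega> in M. norm (Y' i \<omega> * ?z (J (\<lambda>j. \<tau> j \<omega>) (Suc i) *v x)) \<le> real i * B"
        proof (rule AE_I2)
          fix \<omega>
          have "\<bar>Y' i \<omega>\<bar> \<le> real i" using Y'b[of i \<omega>] by simp
          moreover have "\<bar>?z y\<bar> \<le> B" for y using zb[of y] by simp
          ultimately show "norm (Y' i \<omega> * ?z (J (\<lambda>j. \<tau> j \<omega>) (Suc i) *v x)) \<le> real i * B"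
            unfolding real_norm_def abs_mult by (rule mult_mono) (rule of_nat_0_le_iff, rule abs_ge_zero)
        qed
      qed (rule borel_measurable_times[OF Y'm zM])
      show "integrable M (\<lambda>\<omega>. Y' i \<omega> * (\<mu> j + B * C * q ^ m))"
        by (intro integrable_mult_left M.integrable_const_bound[of _ "real i"] Y'm) (use Y'b in auto)
      fix \<omega>
      have "\<bar>?z (J (\<lambda>j. \<tau> j \<omega>) (Suc i) *v x) - \<mu> j\<bar> \<le> B * C * q ^ m"
        unfolding \<mu>_def using x by (intro geo[OF \<phi>m \<phi>b B]) (simp only: norm_J)
      then have "?z (J (\<lambda>j. \<tau> j \<omega>) (Suc i) *v x) \<le> \<mu> j + B * C * q ^ m" by linarith
      moreover have "0 \<le> Y' i \<omega>" using Y'b[of i \<omega>] by simp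
      ultimately show "Y' i \<omega> * ?z (J (\<lambda>j. \<tau> j \<omega>) (Suc i) *v x) \<le> Y' i \<omega> * (\<mu> j + B * C * q ^ m)"
        by (rule mult_left_mono)
    qed
    also have "\<dots> = (\<integral>\<omega>. Y' i \<omega> \<partial>M) * (\<mu> j + B * C * q ^ m)" by simp
    finally have 1: "(\<integral>\<omega>. Y' i \<omega> * Y' j \<omega> \<partial>M) \<le> (\<integral>\<omega>. Y' i \<omega> \<partial>M) * (\<mu> j + B * C * q ^ m)" .
    have "q ^ j \<le> q ^ m" using q m by (intro power_decreasing) auto
    then have "B * C * q ^ j \<le> B * C * q ^ m" using B C by (intro mult_left_mono) auto
    then have "\<mu> j - B * C * q ^ m \<le> (\<integral>\<omega>. Y' j \<omega> \<partial>M)" using EY\<mu>[of j] by (simp add: abs_le_iff)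
    then have 2: "(\<integral>\<omega>. Y' i \<omega> \<partial>M) * (\<mu> j - B * C * q ^ m) \<le> (\<integral>\<omega>. Y' i \<omega> \<partial>M) * (\<integral>\<omega>. Y' j \<omega> \<partial>M)"
      using EYb[of i] by (intro mult_left_mono) auto
    have "(\<integral>\<omega>. Y' i \<omega> \<partial>M) * (2 * (B * C * q ^ m)) \<le> B * (2 * (B * C * q ^ m))"
      using EYb[of i] B C q by (intro mult_right_mono) auto
    \<comment> \<open>Since \<open>j - i = m + 1\<close>, the power \<open>q ^ m\<close> is
      \<open>q ^ (j - i)\<close> divided by \<open>q\<close>.\<close>
    moreover have "B * (2 * (B * C * q ^ m)) = (2 * B * B * C / q) * q ^ (j - i)"
      using q m by (simp add: field_simps)
    ultimately show ?thesis using 1 2 by (simp add: algebra_simps)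
  qed
  have mean: "(\<lambda>j. \<integral>\<omega>. Y' j \<omega> \<partial>M) \<longlonglongrightarrow> (\<integral>t. t \<partial>D) * (\<integral>x. f x \<partial>pi_star)"
  proof -
    let ?p = "\<integral>x. f x \<partial>pi_star"
    have \<mu>eq: "\<mu> j = (\<integral>t. (if \<bar>t\<bar> \<le> real j then t * ?p else 0) \<partial>D)" for j
    proof -
      interpret pair: pair_prob_space D "pi_star :: (complex^'n) measure" ..
      have hm3: "(\<lambda>p. h j (fst p) (snd p)) \<in> borel_measurable (D \<Otimes>\<^sub>M pi_star)"
      proof -
        have a: "fst \<in> borel_measurable (D \<Otimes>\<^sub>M pi_star)" "snd \<in> borel_measurable (D \<Otimes>\<^sub>M (pi_star :: (complex^'n) measure))"
          by measurable
        note [measurable] = a occupation_measurable[OF fm a, of j]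
        show ?thesis unfolding h_def by measurable
      qed
      have "integrable (D \<Otimes>\<^sub>M pi_star) (\<lambda>(t, y). h j t y)"
        using hm3 hb by (intro pair.P.integrable_const_bound[of _ "real j"]) (auto simp: case_prod_unfold)
      then have "\<mu> j = (\<integral>t. (\<integral>y. h j t y \<partial>pi_star) \<partial>D)"
        unfolding \<mu>_def \<phi>_def using pair.Fubini_integral by fastforce
      also have "\<dots> = (\<integral>t. (if \<bar>t\<bar> \<le> real j then t * ?p else 0) \<partial>D)"
      proof (rule integral_cong_AE)
        show "(\<lambda>t. \<integral>y. h j t y \<partial>pi_star) \<in> borel_measurable D"
          using hm3 by (intro pi.borel_measurable_lebesgue_integral) (simp add: case_prod_unfold)
        show "AE t in D. (\<integral>y. h j t y \<partial>pi_star) = (if \<bar>t\<bar> \<le> real j then t * ?p else 0)"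
          using AE_D_pos by eventually_elim (simp add: h_def integral_occupation[OF fm f])
      qed measurable
      finally show ?thesis .
    qed
    \<comment> \<open>The truncation disappears in the limit by dominated convergence with the
      integrable duration as majorant.\<close>
    have "(\<lambda>j. \<integral>t. (if \<bar>t\<bar> \<le> real j then t * ?p else 0) \<partial>D) \<longlonglongrightarrow> (\<integral>t. t * ?p \<partial>D)"
    proof (rule integral_dominated_convergence[where w="\<lambda>t. \<bar>t * ?p\<bar>"])
      show "integrable D (\<lambda>t. \<bar>t * ?p\<bar>)" using integrable_D by simp
      show "AE t in D. (\<lambda>j. if \<bar>t\<bar> \<le> real j then t * ?p else 0) \<longlonglongrightarrow> t * ?p"
      proof (intro AE_I2 tendsto_eventually)
        fix t :: real
        obtain N :: nat where "\<bar>t\<bar> \<le> real N" using real_arch_simple by blast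
        then show "\<forall>\<^sub>F j in sequentially. (if \<bar>t\<bar> \<le> real j then t * ?p else 0) = t * ?p"
          unfolding eventually_sequentially by (intro exI[of _ N]) auto
      qed
    qed auto
    then have \<mu>lim: "\<mu> \<longlonglongrightarrow> (\<integral>t. t \<partial>D) * ?p" by (simp add: \<mu>eq[abs_def, symmetric] \<mu>eq)
    have "(\<lambda>j. (\<integral>\<omega>. Y' j \<omega> \<partial>M) - \<mu> j) \<longlonglongrightarrow> 0"
    proof (rule Lim_null_comparison[OF always_eventually[OF allI]])
      show "norm ((\<integral>\<omega>. Y' j \<omega> \<partial>M) - \<mu> j) \<le> B * C * q ^ j" for j using EY\<mu> by simp
      show "(\<lambda>j. B * C * q ^ j) \<longlonglongrightarrow> 0" using q by (intro tendsto_mult_right_zero LIMSEQ_power_zero) simp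
    qed
    from tendsto_add[OF this \<mu>lim] show ?thesis by simp
  qed
  show ?thesis
  \<comment> \<open>The durations are positive only almost surely, while the majorants must bound
    the cycle integrals at every point; hence the absolute values and the law
    \<open>distr D borel abs\<close>.\<close>
  proof (rule strong_law_of_large_numbers[where \<sigma>="\<lambda>j \<omega>. \<bar>\<tau> j \<omega>\<bar>" and D="distr D borel abs" and Y'=Y'
        and K="2 * B * B * C / q" and q=q])
    show "prob_space M" by (rule prob_M)
    show "(\<lambda>\<omega>. \<bar>\<tau> j \<omega>\<bar>) \<in> borel_measurable M" for j by measurable
    show "(\<lambda>\<omega>. occupation f j (\<tau> j \<omega>) (J (\<lambda>j. \<tau> j \<omega>) j *v x)) \<in> borel_measurable M" for j
    proof (rule occupation_measurable[OF fm \<tau>_meas])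
      have [measurable]: "(\<lambda>\<omega>. J (\<lambda>j. \<tau> j \<omega>) j) \<in> borel_measurable M" by (rule measurable_J) simp
      show "(\<lambda>\<omega>. J (\<lambda>j. \<tau> j \<omega>) j *v x) \<in> borel_measurable M" by measurable
    qed
    show "distr M borel (\<lambda>\<omega>. \<bar>\<tau> j \<omega>\<bar>) = distr D borel abs" for j
      unfolding \<tau>_distr[of j, symmetric] by (subst distr_distr) (auto simp: o_def)
    show "integrable (distr D borel abs) (\<lambda>x. x)"
      using integrable_abs[OF integrable_D] by (subst integrable_distr_eq) simp_all
    show "2 * B * B * C / q \<ge> 0" using B C q by simp
    show "0 \<le> occupation f j (\<tau> j \<omega>) (J (\<lambda>j. \<tau> j \<omega>) j *v x) \<and>
        occupation f j (\<tau> j \<omega>) (J (\<lambda>j. \<tau> j \<omega>) j *v x) \<le> \<bar>\<tau> j \<omega>\<bar>" for j \<omega>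
      by (rule occupation_bounds[OF fm f])
    show "Y' j \<omega> = (if \<bar>\<tau> j \<omega>\<bar> \<le> real j then occupation f j (\<tau> j \<omega>) (J (\<lambda>j. \<tau> j \<omega>) j *v x) else 0)" for j \<omega>
      by (simp only: Y'_def h_def)
  qed (fact q cov mean)+
qed

end

section \<open>From cycles to continuous time\<close>

context driven_chain begin

lemma Xt_segment:
  assumes s: "\<And>j. \<tau> j \<omega> > 0" and t: "tsum \<tau> \<omega> n \<le> t" "t < tsum \<tau> \<omega> (Suc n)"
  shows "Xt H1 H2 \<tau> \<omega> t *v x = U n (t - tsum \<tau> \<omega> n) *v (J (\<lambda>j. \<tau> j \<omega>) n *v x)"
proof -
  have mono: "tsum \<tau> \<omega> i \<le> tsum \<tau> \<omega> k" if "i \<le> k" for i k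
    unfolding tsum_def using that s by (intro sum_mono2) (auto intro: less_imp_le)
  \<comment> \<open>The least index lies one above the number of completed legs, so the running leg
    has zero-based index \<open>n\<close>, and \<open>n - 1\<close> in \<open>Xt\<close> becomes
    \<open>n\<close> here.\<close>
  have least: "(LEAST m. t < tsum \<tau> \<omega> m) = Suc n"
  proof (rule Least_equality)
    fix m assume "t < tsum \<tau> \<omega> m"
    then show "Suc n \<le> m" using mono[of m n] t(1) by (cases "m \<le> n") auto
  qed (rule t(2))
  let ?s = "\<lambda>j. if j < n then \<tau> j \<omega> else t - tsum \<tau> \<omega> n"
  have "Xt H1 H2 \<tau> \<omega> t = J ?s (Suc n)" by (simp only: Xt_def least Let_def diff_Suc_1)
  also have "\<dots> = U n (t - tsum \<tau> \<omega> n) ** J ?s n" by (simp only: J_Suc less_irrefl if_False)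
  also have "J ?s n = J (\<lambda>j. \<tau> j \<omega>) n" by (rule J_cong) simp
  finally show ?thesis by (simp add: matrix_vector_mul_assoc)
qed

text \<open>The time integral up to \<open>T\<close> lies between the sums over the completed
  cycles and over the cycles begun before \<open>T\<close>.\<close>
lemma path_average:
  fixes f :: "complex^'n \<Rightarrow> real"
  assumes s: "\<And>j. \<tau> j \<omega> > 0"
    and fm[measurable]: "f \<in> borel_measurable borel" and f: "\<And>x. 0 \<le> f x \<and> f x \<le> 1"
    and e: "e > 0" "(\<lambda>n. tsum \<tau> \<omega> n / real n) \<longlonglongrightarrow> e"
    and S: "(\<lambda>n. (\<Sum>j<n. occupation f j (\<tau> j \<omega>) (J (\<lambda>j. \<tau> j \<omega>) j *v x)) / real n) \<longlonglongrightarrow> e * p"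
  shows "\<And>T. integrable lborel (\<lambda>t. indicator {0..T} t * f (Xt H1 H2 \<tau> \<omega> t *v x))"
    and "((\<lambda>T. (\<integral>t. indicator {0..T} t * f (Xt H1 H2 \<tau> \<omega> t *v x) \<partial>lborel) / T) \<longlongrightarrow> p) at_top"
proof -
  let ?t = "tsum \<tau> \<omega>" and ?u = "\<lambda>t. f (Xt H1 H2 \<tau> \<omega> t *v x)"
  have t_Suc: "?t (Suc n) = ?t n + \<tau> n \<omega>" for n by (simp add: tsum_def)
  have t_0: "?t 0 = 0" by (simp add: tsum_def)
  have t_mono: "?t i \<le> ?t k" if "i \<le> k" for i k
    unfolding tsum_def using that s by (intro sum_mono2) (auto intro: less_imp_le)
  have t_pos: "?t n > 0" if "n > 0" for n
    using t_mono[of 1 n] that s[of 0] by (simp add: tsum_def)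
  have t_lim: "filterlim ?t at_top sequentially"
  proof -
    have "filterlim (\<lambda>n. (?t n / real n) * real n) at_top sequentially"
      by (rule filterlim_tendsto_pos_mult_at_top[OF e(2,1) filterlim_real_sequentially])
    moreover have "(?t n / real n) * real n = ?t n" for n using t_0 by (cases "n = 0") auto
    ultimately show ?thesis by simp
  qed
  have segment: "\<exists>n. ?t n \<le> t \<and> t < ?t (Suc n)" if "t \<ge> 0" for t
  proof -
    have ex: "\<exists>n. t < ?t (Suc n)"
    proof -
      have "\<forall>\<^sub>F n in sequentially. t + 1 \<le> ?t n" using t_lim by (simp add: filterlim_at_top)
      then obtain N where "\<And>n. n \<ge> N \<Longrightarrow> t + 1 \<le> ?t n" unfolding eventually_sequentially by blast
      from this[of "Suc N"] show ?thesis by (intro exI[of _ N]) simp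
    qed
    define n where "n = (LEAST n. t < ?t (Suc n))"
    have 1: "t < ?t (Suc n)" unfolding n_def by (rule LeastI_ex[OF ex])
    have 2: "?t n \<le> t"
    proof (cases n)
      case (Suc i)
      then show ?thesis using not_less_Least[of i "\<lambda>n. t < ?t (Suc n)"] n_def by simp
    qed (use that t_0 in simp)
    show ?thesis using 1 2 by blast
  qed
  define y where "y n = J (\<lambda>j. \<tau> j \<omega>) n *v x" for n
  \<comment> \<open>Half-open legs tile the half-line, so at each nonnegative time exactly one of
    these functions carries the value of the path.\<close>
  define g where "g n t = (if ?t n \<le> t \<and> t < ?t (Suc n) then f (U n (t - ?t n) *v y n) else 0)" for n t
  have [measurable]: "g n \<in> borel_measurable borel" for n unfolding g_def[abs_def] by measurable
  have g0: "0 \<le> g n t" for n t using f by (simp add: g_def)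
  have int_g: "integrable lborel (g n)" for n
  proof (rule Bochner_Integration.integrable_bound)
    show "integrable lborel (indicator {?t n..?t (Suc n)} :: real \<Rightarrow> real)"
      by (intro integrable_real_indicator) (auto simp: emeasure_lborel_Icc_eq)
    show "AE t in lborel. norm (g n t) \<le> norm (indicator {?t n..?t (Suc n)} t :: real)"
      using f by (intro AE_I2) (auto simp: g_def indicator_def)
  qed measurable
  have I_g: "(\<integral>t. g n t \<partial>lborel) = occupation f n (\<tau> n \<omega>) (y n)" for n
  proof -
    let ?F = "\<lambda>r. if 0 \<le> r \<and> r \<le> \<tau> n \<omega> then f (U n r *v y n) else 0"
    have "occupation f n (\<tau> n \<omega>) (y n) = (\<integral>t. ?F (- ?t n + 1 * t) \<partial>lborel)"
      unfolding occupation_def using lborel_integral_real_affine[of 1 ?F "- ?t n"] by simp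
    also have "\<dots> = (\<integral>t. g n t \<partial>lborel)"
    proof (rule integral_cong_AE)
      \<comment> \<open>The integrands differ at most at the right end of the leg:
        \<open>occupation\<close> uses a closed interval, the legs of the path are
        half-open.\<close>
      show "AE t in lborel. ?F (- ?t n + 1 * t) = g n t"
        using AE_lborel_singleton[of "?t (Suc n)"]
        by eventually_elim (auto simp: g_def t_Suc algebra_simps)
    qed measurable
    finally show ?thesis by simp
  qed
  define Gs where "Gs N t = (\<Sum>n<N. g n t)" for N t
  have g_eq: "g n t = (if n = k then ?u t else 0)" if k: "?t k \<le> t" "t < ?t (Suc k)" for n k t
  proof (cases "n = k")
    case True
    then show ?thesis using k Xt_segment[OF s k, of x] by (simp add: g_def y_def)
  next
    case False
    have "\<not> (?t n \<le> t \<and> t < ?t (Suc n))"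
    proof (cases "n < k")
      case True
      then show ?thesis using t_mono[of "Suc n" k] k by auto
    next
      case f: False
      then show ?thesis using t_mono[of "Suc k" n] k False by auto
    qed
    then have "g n t = 0" unfolding g_def by (rule if_not_P)
    then show ?thesis using False by simp
  qed
  have Gs_eq: "Gs N t = (if k < N then ?u t else 0)" if k: "?t k \<le> t" "t < ?t (Suc k)" for N k t
    unfolding Gs_def g_eq[OF k] by simp
  have Gs_neg: "Gs N t = 0" if "t < 0" for N t
    unfolding Gs_def g_def
  proof (intro sum.neutral ballI if_not_P)
    show "\<not> (?t n \<le> t \<and> t < ?t (Suc n))" for n using that t_mono[of 0 n] t_0 by auto
  qed
  have int_Gs: "integrable lborel (Gs N)" for N unfolding Gs_def[abs_def] by (intro Bochner_Integration.integrable_sum int_g)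
  define \<Sigma> where "\<Sigma> N = (\<Sum>j<N. occupation f j (\<tau> j \<omega>) (J (\<lambda>j. \<tau> j \<omega>) j *v x))" for N
  have I_Gs: "(\<integral>t. Gs N t \<partial>lborel) = \<Sigma> N" for N
    unfolding Gs_def \<Sigma>_def using int_g by (simp add: Bochner_Integration.integral_sum I_g y_def)
  let ?w = "\<lambda>T t. indicator {0..T} t * ?u t"
  have w_eq: "?w T t = indicator {0..T} t * Gs (Suc N) t" if "T < ?t (Suc N)" for T N t
  proof (cases "t \<in> {0..T}")
    case True
    then obtain k where k: "?t k \<le> t" "t < ?t (Suc k)" using segment by auto
    have "k < Suc N"
    proof (rule ccontr)
      assume "\<not> k < Suc N"
      then have "?t (Suc N) \<le> ?t k" by (intro t_mono) simp
      then show False using k True that by auto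
    qed
    then show ?thesis using Gs_eq[OF k, of "Suc N"] by simp
  qed simp
  have int_w: "integrable lborel (?w T)" for T
  proof -
    obtain N where N: "T < ?t (Suc N)"
    proof (cases "T \<ge> 0")
      case True
      then show ?thesis using segment that by blast
    next
      case False
      then show ?thesis using that[of 0] s[of 0] by (simp add: tsum_def)
    qed
    have "integrable lborel (\<lambda>t. indicator {0..T} t * Gs (Suc N) t)"
      using integrable_mult_indicator[OF _ int_Gs, of "{0..T}" "Suc N"] by simp
    moreover have "?w T = (\<lambda>t. indicator {0..T} t * Gs (Suc N) t)" by (rule ext) (rule w_eq[OF N])
    ultimately show ?thesis by (simp only:)
  qed
  show "integrable lborel (?w T)" for T by (rule int_w)
  have sandwich: "\<Sigma> N \<le> (\<integral>t. ?w T t \<partial>lborel) \<and> (\<integral>t. ?w T t \<partial>lborel) \<le> \<Sigma> (Suc N)"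
    if T: "?t N \<le> T" "T < ?t (Suc N)" for T N
  proof
    have Gs0: "0 \<le> Gs n t" for n t unfolding Gs_def using g0 by (intro sum_nonneg) auto
    show "(\<integral>t. ?w T t \<partial>lborel) \<le> \<Sigma> (Suc N)"
      unfolding I_Gs[symmetric]
    proof (rule integral_mono[OF int_w int_Gs])
      show "?w T t \<le> Gs (Suc N) t" for t
        unfolding w_eq[OF T(2)] using Gs0[of "Suc N" t] by (simp add: indicator_def)
    qed
    show "\<Sigma> N \<le> (\<integral>t. ?w T t \<partial>lborel)"
      unfolding I_Gs[symmetric]
    proof (rule integral_mono[OF int_Gs int_w])
      fix t
      show "Gs N t \<le> ?w T t"
      proof (cases "t < 0")
        case True
        then show ?thesis using Gs_neg by simp
      next
        case False
        then obtain k where k: "?t k \<le> t" "t < ?t (Suc k)" using segment[of t] by auto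
        show ?thesis
        proof (cases "k < N")
          case True
          then have "?t (Suc k) \<le> ?t N" by (intro t_mono) simp
          then have "t \<in> {0..T}" using False k T by auto
          then show ?thesis using Gs_eq[OF k, of N] True by simp
        next
          case False
          then show ?thesis using Gs_eq[OF k, of N] f by (simp add: indicator_def)
        qed
      qed
    qed
  qed
  have S': "(\<lambda>n. \<Sigma> n / real n) \<longlonglongrightarrow> e * p" using S by (simp only: \<Sigma>_def)
  \<comment> \<open>During cycle \<open>n\<close> the time \<open>T\<close> lies between
    \<open>?t n\<close> and \<open>?t (Suc n)\<close>, so lower and upper bounds pair a sum with a
    time of adjacent index. The shift is harmless because the quotient of consecutive integers tends
    to 1.\<close>
  have low: "(\<lambda>n. \<Sigma> n / ?t (Suc n)) \<longlonglongrightarrow> p"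
  proof -
    have "(\<lambda>n. (\<Sigma> n / real n) * (real n / real (Suc n)) / (?t (Suc n) / real (Suc n))) \<longlonglongrightarrow> (e * p) * 1 / e"
      (is "?L \<longlonglongrightarrow> _")
      using e(1) by (intro tendsto_intros S' LIMSEQ_Suc[OF e(2)] LIMSEQ_n_over_Suc_n) simp
    moreover have "(e * p) * 1 / e = p" using e(1) by simp
    ultimately have "?L \<longlonglongrightarrow> p" by (simp only:)
    then show ?thesis
    proof (rule Lim_transform_eventually)
      show "\<forall>\<^sub>F n in sequentially. (\<Sigma> n / real n) * (real n / real (Suc n)) / (?t (Suc n) / real (Suc n)) = \<Sigma> n / ?t (Suc n)"
        using eventually_gt_at_top[of 0] by eventually_elim (simp del: of_nat_Suc)
    qed
  qed
  have high: "(\<lambda>n. \<Sigma> (Suc n) / ?t n) \<longlonglongrightarrow> p"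
  proof -
    have "(\<lambda>n. (\<Sigma> (Suc n) / real (Suc n)) * (real (Suc n) / real n) / (?t n / real n)) \<longlonglongrightarrow> (e * p) * 1 / e"
      (is "?L \<longlonglongrightarrow> _")
      using e(1) by (intro tendsto_intros LIMSEQ_Suc[OF S'] e(2) LIMSEQ_Suc_n_over_n) simp
    moreover have "(e * p) * 1 / e = p" using e(1) by simp
    ultimately have "?L \<longlonglongrightarrow> p" by (simp only:)
    then show ?thesis
    proof (rule Lim_transform_eventually)
      show "\<forall>\<^sub>F n in sequentially. (\<Sigma> (Suc n) / real (Suc n)) * (real (Suc n) / real n) / (?t n / real n) = \<Sigma> (Suc n) / ?t n"
        using eventually_gt_at_top[of 0] by eventually_elim (simp del: of_nat_Suc)
    qed
  qed
  show "((\<lambda>T. (\<integral>t. ?w T t \<partial>lborel) / T) \<longlongrightarrow> p) at_top"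
  proof (rule tendstoI)
    fix r :: real assume r: "r > 0"
    have "\<forall>\<^sub>F n in sequentially. dist (\<Sigma> n / ?t (Suc n)) p < r \<and> dist (\<Sigma> (Suc n) / ?t n) p < r"
      using tendstoD[OF low r] tendstoD[OF high r] by (rule eventually_conj)
    then obtain N where N: "\<And>n. n \<ge> N \<Longrightarrow> dist (\<Sigma> n / ?t (Suc n)) p < r \<and> dist (\<Sigma> (Suc n) / ?t n) p < r"
      unfolding eventually_sequentially by blast
    have \<Sigma>0: "0 \<le> \<Sigma> n" for n
      unfolding \<Sigma>_def using occupation_bounds[OF fm f] by (intro sum_nonneg) auto
    have "dist ((\<integral>t. ?w T t \<partial>lborel) / T) p < r" if T: "T \<ge> ?t (Suc N)" for T
    proof -
      have T0: "T > 0" using T t_pos[of "Suc N"] by simp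
      then obtain n where n: "?t n \<le> T" "T < ?t (Suc n)" using segment[of T] by auto
      have nN: "n \<ge> Suc N"
      proof (rule ccontr)
        assume "\<not> n \<ge> Suc N"
        then have "?t (Suc n) \<le> ?t (Suc N)" by (intro t_mono) simp
        then show False using n T by simp
      qed
      have tn: "?t n > 0" using nN by (intro t_pos) simp
      have "\<Sigma> n / ?t (Suc n) \<le> \<Sigma> n / T" using n(2) T0 \<Sigma>0 by (intro divide_left_mono) auto
      also have "\<dots> \<le> (\<integral>t. ?w T t \<partial>lborel) / T" using sandwich[OF n] T0 by (intro divide_right_mono) auto
      finally have 1: "\<Sigma> n / ?t (Suc n) \<le> (\<integral>t. ?w T t \<partial>lborel) / T" .
      have "(\<integral>t. ?w T t \<partial>lborel) / T \<le> \<Sigma> (Suc n) / T" using sandwich[OF n] T0 by (intro divide_right_mono) auto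
      also have "\<dots> \<le> \<Sigma> (Suc n) / ?t n" using n(1) tn T0 \<Sigma>0 by (intro divide_left_mono) auto
      finally have 2: "(\<integral>t. ?w T t \<partial>lborel) / T \<le> \<Sigma> (Suc n) / ?t n" .
      show ?thesis using 1 2 N[of n] nN by (auto simp: dist_real_def abs_less_iff)
    qed
    then show "\<forall>\<^sub>F T in at_top. dist ((\<integral>t. ?w T t \<partial>lborel) / T) p < r"
      unfolding eventually_at_top_linorder by blast
  qed
qed

lemma mean_duration_pos: "(\<integral>t. t \<partial>D) > 0"
proof -
  have "0 \<le> (\<integral>t. t \<partial>D)" using AE_D_pos by (intro integral_nonneg_AE) (auto elim: eventually_mono)
  moreover have "(\<integral>t. t \<partial>D) \<noteq> 0"
  proof
    assume "(\<integral>t. t \<partial>D) = 0"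
    moreover have "AE t in D. 0 \<le> t" using AE_D_pos by eventually_elim simp
    ultimately have "AE t in D. t = 0" using integral_nonneg_eq_0_iff_AE[OF integrable_D] by simp
    then have "AE t in D. False" using AE_D_pos by eventually_elim simp
    then show False by simp
  qed
  ultimately show ?thesis by simp
qed

text \<open>The strong law for the durations is the case of the constant observable 1, whose cycle
  integrals are the durations themselves. It is combined with the one for \<open>f\<close> on a
  common set of full measure.\<close>

lemma time_average_unit:
  assumes fm: "f \<in> borel_measurable borel" and f: "\<And>x. 0 \<le> f x \<and> f x \<le> 1" and x: "norm x = 1"
  shows "AE \<omega> in M. (\<forall>T. integrable lborel (\<lambda>t. indicator {0..T} t * f (Xt H1 H2 \<tau> \<omega> t *v x))) \<and>
    ((\<lambda>T. (\<integral>t. indicator {0..T} t * f (Xt H1 H2 \<tau> \<omega> t *v x) \<partial>lborel) / T) \<longlongrightarrow> (\<integral>x. f x \<partial>pi_star)) at_top"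
proof -
  have pos: "AE \<omega> in M. \<forall>j. \<tau> j \<omega> > 0" unfolding AE_all_countable using \<tau>_pos by blast
  have one: "AE \<omega> in M. (\<lambda>n. (\<Sum>j<n. occupation (\<lambda>_. 1) j (\<tau> j \<omega>) (J (\<lambda>j. \<tau> j \<omega>) j *v x)) / real n)
      \<longlonglongrightarrow> (\<integral>t. t \<partial>D) * (\<integral>x. 1 \<partial>(pi_star :: (complex^'n) measure))"
    by (rule occupation_average[OF _ _ x]) auto
  have occ1: "occupation (\<lambda>_. 1) j t y = t" if "t \<ge> 0" for j t y
  proof -
    have "occupation (\<lambda>_. 1) j t y = (\<integral>s. indicator {0..t} s \<partial>lborel)"
      unfolding occupation_def by (intro Bochner_Integration.integral_cong refl) (simp add: indicator_def)
    then show ?thesis using that by simp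
  qed
  have pi1: "(\<integral>x. 1 \<partial>(pi_star :: (complex^'n) measure)) = (1 :: real)" using pi.prob_space by simp
  show ?thesis using pos one occupation_average[OF fm f x]
  proof eventually_elim
    case (elim \<omega>)
    have "tsum \<tau> \<omega> n = (\<Sum>j<n. occupation (\<lambda>_. 1) j (\<tau> j \<omega>) (J (\<lambda>j. \<tau> j \<omega>) j *v x))" for n
      unfolding tsum_def using elim(1) by (intro sum.cong refl) (simp add: occ1 less_imp_le)
    then have e: "(\<lambda>n. tsum \<tau> \<omega> n / real n) \<longlonglongrightarrow> (\<integral>t. t \<partial>D)" using elim(2) by (simp only: pi1 mult_1_right)
    have s: "\<And>j. \<tau> j \<omega> > 0" using elim(1) by blast
    show ?case
      using path_average[OF s fm f mean_duration_pos e elim(3)] by blast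
  qed
qed

text \<open>\<open>f\<close> is bounded on the sphere only, so it is rescaled there to values
  between 0 and 1 and replaced by zero elsewhere. Neither the path nor the uniform measure notices
  the change off the sphere.\<close>

lemma time_average:
  fixes f :: "complex^'n \<Rightarrow> real"
  assumes fm: "f \<in> borel_measurable borel" and f: "bounded (f ` sphere 0 1)" and x: "norm x = 1"
  shows "AE \<omega> in M. ((\<lambda>T. (1 / T) * (LINT t:{0..T}|lborel. f (Xt H1 H2 \<tau> \<omega> t *v x)))
                  \<longlongrightarrow> (\<integral>x. f x \<partial>pi_star)) at_top"
proof -
  obtain B where B: "B > 0" "\<And>y. norm y = 1 \<Longrightarrow> \<bar>f y\<bar> \<le> B"
    using f unfolding bounded_pos by auto
  define h where "h y = (if norm y = 1 then (f y + B) / (2 * B) else 0)" for y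
  have hm: "h \<in> borel_measurable borel" using fm unfolding h_def by measurable
  have hb: "0 \<le> h y \<and> h y \<le> 1" for y
    using B(1) B(2)[of y] by (auto simp: h_def abs_le_iff field_simps)
  have fh: "f y = 2 * B * h y - B" if "norm y = 1" for y using that B(1) by (simp add: h_def)
  have inth: "integrable pi_star h"
    using hm hb by (intro pi.integrable_const_bound[of _ 1]) auto
  have "(\<integral>x. f x \<partial>pi_star) = (\<integral>x. 2 * B * h x - B \<partial>pi_star)"
  proof (rule integral_cong_AE)
    show "AE x in pi_star. f x = 2 * B * h x - B" using AE_pi_star by eventually_elim (rule fh)
  qed (use fm hm in measurable)
  then have If: "(\<integral>x. f x \<partial>pi_star) = 2 * B * (\<integral>x. h x \<partial>pi_star) - B"
    using inth pi.prob_space by simp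
  have pos: "AE \<omega> in M. \<forall>j. \<tau> j \<omega> > 0" unfolding AE_all_countable using \<tau>_pos by blast
  have nX: "norm (Xt H1 H2 \<tau> \<omega> t *v x) = 1" for \<omega> t
    unfolding Xt_def Let_def by (simp add: x)
  show ?thesis using time_average_unit[OF hm hb x]
  proof eventually_elim
    case (elim \<omega>)
    let ?X = "\<lambda>t. Xt H1 H2 \<tau> \<omega> t *v x"
    have eq: "(1 / T) * (LINT t:{0..T}|lborel. f (?X t)) = 2 * B * ((\<integral>t. indicator {0..T} t * h (?X t) \<partial>lborel) / T) - B"
      if T: "T > 0" for T
    proof -
      have "(LINT t:{0..T}|lborel. f (?X t)) = (\<integral>t. 2 * B * (indicator {0..T} t * h (?X t)) - B * indicator {0..T} t \<partial>lborel)"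
        unfolding set_lebesgue_integral_def fh[OF nX]
        by (intro Bochner_Integration.integral_cong refl) (simp add: algebra_simps)
      also have "\<dots> = (\<integral>t. 2 * B * (indicator {0..T} t * h (?X t)) \<partial>lborel) - (\<integral>t. B * indicator {0..T} t \<partial>lborel)"
      proof (rule Bochner_Integration.integral_diff)
        show "integrable lborel (\<lambda>t. 2 * B * (indicator {0..T} t * h (?X t)))" using elim by (intro integrable_mult_right) blast
        show "integrable lborel (\<lambda>t. B * indicator {0..T} t)"
          by (intro integrable_mult_right integrable_real_indicator) (auto simp: emeasure_lborel_Icc_eq)
      qed
      also have "\<dots> = 2 * B * (\<integral>t. indicator {0..T} t * h (?X t) \<partial>lborel) - B * T" using T by simp
      finally show ?thesis using T by (simp add: field_simps)
    qed
    have "((\<lambda>T. 2 * B * ((\<integral>t. indicator {0..T} t * h (?X t) \<partial>lborel) / T) - B) \<longlongrightarrow> 2 * B * (\<integral>x. h x \<partial>pi_star) - B) at_top"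
      using elim by (intro tendsto_intros) blast
    then show ?case unfolding If
    proof (rule Lim_transform_eventually)
      show "\<forall>\<^sub>F T in at_top. 2 * B * ((\<integral>t. indicator {0..T} t * h (?X t) \<partial>lborel) / T) - B
          = (1 / T) * (LINT t:{0..T}|lborel. f (?X t))"
        using eventually_gt_at_top[of 0] by eventually_elim (rule eq[symmetric])
    qed
  qed
qed

section \<open>The law of the chain and conclusion\<close>

lemma Pn_eq_R:
  assumes E: "E \<in> sets borel"
  shows "Pn M H1 H2 \<tau> n \<psi> E = R 0 n (indicator E) \<psi>"
proof -
  have [measurable]: "E \<in> sets borel" by fact
  have [measurable]: "(\<lambda>\<omega>. J (\<lambda>j. \<tau> j \<omega>) n) \<in> borel_measurable M" by (rule measurable_J) simp
  have s: "{\<omega> \<in> space M. J (\<lambda>j. \<tau> j \<omega>) n *v \<psi> \<in> E} \<in> sets M" by measurable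
  have "Pn M H1 H2 \<tau> n \<psi> E = (\<integral>\<omega>. indicator {\<omega> \<in> space M. J (\<lambda>j. \<tau> j \<omega>) n *v \<psi> \<in> E} \<omega> \<partial>M)"
    using s by (simp add: Pn_def Xn_def)
  also have "\<dots> = (\<integral>\<omega>. indicator E (J (\<lambda>j. \<tau> j \<omega>) n *v \<psi>) \<partial>M)"
    by (intro Bochner_Integration.integral_cong refl) (simp add: indicator_def)
  also have "\<dots> = (\<integral>b. indicator E (J b n *v \<psi>) \<partial>L n)"
  proof (rule expectation_durations)
    show "(\<lambda>b. indicator E (J b n *v \<psi>) :: real) \<in> borel_measurable (L n)" by measurable
    show "indicator E (J b n *v \<psi>) = (indicator E (J b' n *v \<psi>) :: real)" if "\<And>j. j < n \<Longrightarrow> b j = b' j" for b b'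
      using J_cong[OF that] by simp
  qed
  also have "\<dots> = R 0 n (indicator E) \<psi>"
    by (rule R_integral[symmetric, where lo=0 and hi=1]) (auto simp: indicator_def E)
  finally show ?thesis .
qed

lemma geometric_convergence:
  "\<exists>c q. c > 0 \<and> 0 < q \<and> q < 1 \<and>
     (\<forall>E \<in> sets borel. \<forall>\<psi>. norm \<psi> = 1 \<longrightarrow> (\<forall>n. \<bar>Pn M H1 H2 \<tau> n \<psi> E - measure pi_star E\<bar> \<le> c * q ^ n))"
proof -
  obtain C q where C: "C \<ge> 1" and q: "0 < q" "q < 1" and geo:
    "\<And>a n f x. f \<in> borel_measurable borel \<Longrightarrow> (\<And>x. 0 \<le> f x \<and> f x \<le> 1) \<Longrightarrow> norm x = 1 \<Longrightarrow>
       \<bar>R a n f x - (\<integral>x. f x \<partial>pi_star)\<bar> \<le> C * q ^ n"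
    by (rule geometric_ergodicity) blast
  have "\<bar>Pn M H1 H2 \<tau> n \<psi> E - measure pi_star E\<bar> \<le> C * q ^ n"
    if E: "E \<in> sets borel" and \<psi>: "norm \<psi> = 1" for E \<psi> n
  proof -
    have "measure pi_star E = (\<integral>x. indicator E x \<partial>pi_star)" using E by simp
    then show ?thesis
      unfolding Pn_eq_R[OF E] using geo[of "indicator E" \<psi> 0 n] E \<psi> by (simp add: indicator_def)
  qed
  then show ?thesis using C q by (intro exI[of _ C] exI[of _ q]) auto
qed

end

lemma driven_chain_of_condition_D:
  assumes "hermitian H1" "hermitian H2" "condition_D M \<tau>" "pure_state_controllable H1 H2"
  obtains g where "driven_chain H1 H2 (distr M borel (\<tau> 0)) g M \<tau>"
proof -
  obtain g where g: "distributed M lborel (\<tau> 0) g" "\<And>x. x \<ge> 0 \<Longrightarrow> g x > 0"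
    using assms(3) unfolding condition_D_def by blast
  have M: "prob_space M" and \<tau>: "\<And>j. \<tau> j \<in> borel_measurable M" and ind: "prob_space.indep_vars M (\<lambda>_. borel) \<tau> UNIV"
    and eq: "\<And>j. distr M borel (\<tau> j) = distr M borel (\<tau> 0)" and pos: "\<And>j. AE \<omega> in M. \<tau> j \<omega> > 0"
    and int: "integrable M (\<tau> 0)" using assms(3) unfolding condition_D_def by auto
  have D: "distr M borel (\<tau> 0) = density lborel g"
    using distributed_distr_eq_density[OF g(1)] by (metis distr_cong sets_lborel)
  have gm: "g \<in> borel_measurable borel" using distributed_borel_measurable[OF g(1)] by simp
  have "driven_chain H1 H2 (distr M borel (\<tau> 0)) g M \<tau>"
    by (intro driven_chain.intro controlled_chain.intro hermitian_pair.intro controlled_chain_axioms.intro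
        driven_chain_axioms.intro assms M \<tau> ind eq pos int D gm g(2) prob_space.prob_space_distr[OF M \<tau>])
  then show ?thesis by (rule that)
qed

theorem mainTheorem14:
  fixes H1 H2 :: "complex^'n^'n"
    and M :: "'w measure" and \<tau> :: "nat \<Rightarrow> 'w \<Rightarrow> real"
  assumes "CARD('n) > 1"
    and "hermitian H1" and "hermitian H2"
    and "condition_D M \<tau>"
    and "pure_state_controllable H1 H2"
  shows "(\<exists>c q. c > 0 \<and> 0 < q \<and> q < 1 \<and>
            (\<forall>A \<in> sets borel. A \<subseteq> unit_sphere \<longrightarrow>
              (\<forall>\<psi> \<in> unit_sphere. \<forall>n \<ge> 1.
                 \<bar>Pn M H1 H2 \<tau> n \<psi> A - measure pi_star A\<bar> \<le> c * q ^ n)))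
       \<and> (\<forall>f :: complex^'n \<Rightarrow> real. f \<in> borel_measurable borel \<longrightarrow> bounded (f ` unit_sphere) \<longrightarrow>
            (\<forall>\<psi>0 \<in> unit_sphere. AE \<omega> in M.
               ((\<lambda>T. (1 / T) * (LINT t:{0..T}|lborel. f (Xt H1 H2 \<tau> \<omega> t *v \<psi>0)))
                  \<longlongrightarrow> (\<integral>x. f x \<partial>pi_star)) at_top))"
proof -
  obtain g where "driven_chain H1 H2 (distr M borel (\<tau> 0)) g M \<tau>"
    using driven_chain_of_condition_D[OF assms(2-5)] by blast
  then interpret driven_chain H1 H2 "distr M borel (\<tau> 0)" g M \<tau> .
  show ?thesis
  proof (intro conjI allI impI ballI)
    obtain c q where cq: "c > 0" "0 < q" "q < 1" "\<And>E \<psi> n. E \<in> sets borel \<Longrightarrow> norm \<psi> = 1 \<Longrightarrow>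
        \<bar>Pn M H1 H2 \<tau> n \<psi> E - measure pi_star E\<bar> \<le> c * q ^ n"
      using geometric_convergence by blast
    show "\<exists>c q. c > 0 \<and> 0 < q \<and> q < 1 \<and> (\<forall>A \<in> sets borel. A \<subseteq> unit_sphere \<longrightarrow>
        (\<forall>\<psi> \<in> unit_sphere. \<forall>n \<ge> 1. \<bar>Pn M H1 H2 \<tau> n \<psi> A - measure pi_star A\<bar> \<le> c * q ^ n))"
      using cq by (intro exI[of _ c] exI[of _ q]) simp
    fix f :: "complex^'n \<Rightarrow> real" and \<psi>0 :: "complex^'n"
    assume "f \<in> borel_measurable borel" "bounded (f ` unit_sphere)" "\<psi>0 \<in> unit_sphere"
    then show "AE \<omega> in M. ((\<lambda>T. (1 / T) * (LINT t:{0..T}|lborel. f (Xt H1 H2 \<tau> \<omega> t *v \<psi>0)))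
        \<longlongrightarrow> (\<integral>x. f x \<partial>pi_star)) at_top"
      by (intro time_average) auto
  qed
qed

end
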